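(* Let $n\in\mathbb{C}\setminus\{0,-\tfrac12,-1,-\tfrac32,-2,-\tfrac52\}$ and $\lambda,\mu,\lambda',\mu'\in\mathbb{C}$ with $\delta=\mu-\lambda$, $\delta'=\mu'-\lambda'$. Then $\mathrm{SQ}^{\delta-n,0,7}_{\lambda,\mu}\cong\mathrm{SQ}^{\delta'-n,0,7}_{\lambda',\mu'}$ if and only if they satisfy the SVC and at least one of the following holds: (i) at least one of $\delta-n$, $\delta'-n$ equals $1$ or $2$; (ii) at least one of $\delta-n$, $\delta'-n$ equals $0$, and $\mathrm{SQ}^{\delta-n-1/2,1,6}_{\lambda,\mu}\cong\mathrm{SQ}^{\delta'-n-1/2,1,6}_{\lambda',\mu'}$; (iii) for every ratio $\mathcal{I}$ of products of $I^0_n$, $I^1_{n+1/2}$ and $J^0_n$ such that none of the factors $B^\bullet_{\bullet,\bullet}(\gamma,\delta)$ of $\mathrm{Simp}(\mathcal{I})$ is zero, $\mathrm{Simp}(\mathcal{I})(\gamma,\delta)=\mathrm{Simp}(\mathcal{I})(\gamma',\delta')$.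
   Context: Work over $\mathbb{C}$ on the superline $\mathbb{R}^{1|1}$ in the polynomial category. Let $\mathbb{C}[x,\xi]$ be the polynomial superalgebra with even $x$ and odd $\xi$ ($\xi^2=0$), $D=\partial_\xi+\xi\partial_x$, $\bar D=\partial_\xi-\xi\partial_x$; $X_F=F\partial_x+\tfrac12 D(F)\bar D$ for $F\in\mathbb{C}[x,\xi]$, and $\mathcal{K}=\{X_F\}$ (contact vector fields). For $\nu\in\mathbb{C}$, $\mathcal{F}_\nu=\alpha^\nu\mathbb{C}[x,\xi]$ ($\alpha^\nu$ formal, even), $L_\nu(X_F)(\alpha^\nu G)=\alpha^\nu(X_F(G)+\nu\,\partial_x(F)\,G)$. For $z\in\mathbb{C}$, $\bar D^z_0=e^{i\pi z/2}\partial_x^{z/2}$ (even), $\bar D^z_1=e^{i\pi(z-1)/2}\partial_x^{(z-1)/2}\bar D$ (odd). For $\lambda,\mu,k\in\mathbb{C}$, $p\in\mathbb{Z}_2$, $\delta=\mu-\lambda$: $\Psi^{k,p}_{\lambda,\mu}=\{\alpha^{\delta}\sum_{j\in\mathbb{N}}T_{2k-j}\bar D^{2k-j}_{p+(j\bmod 2)}:T_{2k-j}\in\mathbb{C}[x,\xi]\}$ (formal series), composition via $\bar D^{z'}_{p'}\circ\bar D^z_p=\bar D^{z+z'}_{p+p'}$, $[\bar D,\partial_x^z]=0$, $\partial_x^z\circ F=\sum_{j}\binom{z}{j}\partial_x^j(F)\circ\partial_x^{z-j}$, and $\mathcal{K}$-action $L_{\lambda,\mu}(X)(T)=L_\mu(X)\circ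 T-(-1)^{|X||T|}T\circ L_\lambda(X)$. $\mathrm{SQ}^{k,p,l}_{\lambda,\mu}=\Psi^{k,p}_{\lambda,\mu}/\Psi^{k-l/2,\,p+l}_{\lambda,\mu}$; $\cong$ is $\mathcal{K}$-equivalence. Set $\gamma^{1/2}=\sqrt3(\lambda+\mu-\tfrac12)$, $\gamma=(\gamma^{1/2})^2$, $\gamma^{3/2}=\gamma\gamma^{1/2}$, and similarly $\gamma',\delta'$. For $m\in\mathbb{C}$ define functions of $(\gamma,\delta)$ (superscript of $B^q_{a,b}$ read mod 2; $m=b$, $r=a-b$): $B^0_{m+3/2,m}=\gamma^{1/2}$; $B^1_{m+3/2,m}=\gamma-3(m+\tfrac12)\delta-\tfrac34$; $B^0_{m+2,m}=\gamma-(m+\tfrac32)(2\delta+m+\tfrac12)$; $B^1_{m+2,m}=\gamma-m(2\delta+m+1)$; $B^0_{m+5/2,m}=\gamma-(m+1)\delta-\tfrac34$; $B^1_{m+5/2,m}=\gamma^{3/2}-\gamma^{1/2}[4(m+1)\delta-(m+1)^2+3]$. Let $(x)_r=x(x-1)\cdots(x-r+1)$, $(x)_0=1$, $\{j\}=j-\lfloor j\rfloor$. For $i,j\in\tfrac12\mathbb{N}$: $S^0_{i,j}=(\delta-n-\lceil j\rceil)_{\lceil i\rceil-\lceil j\rceil}B^{2\{j\}}_{n+i,n+j}$, $S^1_{i,j}=(\delta-n-\tfrac12-\lfloor j\rfloor)_{\lfloor i\rfloor-\lfloor j\rfloor}B^{1-2\{j\}}_{n+i,n+j}$. Subquotients $\mathrm{SQ}^{\delta-n,p,l}_{\lambda,\mu}$,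 $\mathrm{SQ}^{\delta'-n,p',l}_{\lambda',\mu'}$ satisfy the SVC if for all $i,j\in\tfrac12\mathbb{N}$ with $i\le\tfrac12(l-1)$ and $\tfrac32\le i-j\le\tfrac52$, $S^p_{i,j}(\gamma,\delta)$ and $S^{p'}_{i,j}(\gamma',\delta')$ are both zero or both nonzero. Regard the following as formal ratios of products of the symbols $B^q_{a,b}$: $I^0_n=\dfrac{B^0_{n+5/2,n}B^1_{n+2,n+1/2}}{B^1_{n+5/2,n+1/2}B^0_{n+2,n}}$, $I^1_{n+1/2}=\dfrac{B^1_{n+3,n+1/2}B^0_{n+5/2,n+1}}{B^0_{n+3,n+1}B^1_{n+5/2,n+1/2}}$, $J^0_n=\dfrac{B^1_{n+3,n+1/2}B^0_{n+5/2,n}}{B^1_{n+3,n+3/2}B^1_{n+5/2,n+1/2}B^0_{n+3/2,n}}$. For a ratio $\mathcal{I}$ of products of these, $\mathrm{Simp}(\mathcal{I})$ denotes the ratio of products of symbols $B^q_{a,b}$ obtained by cancelling as many common symbols between numerator and denominator as possible; $\mathrm{Simp}(\mathcal{I})(\gamma,\delta)$ is its value when each symbol is evaluated at $(\gamma,\delta)$, and its factors are the symbols remaining in it. *)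

theory Defs
  imports "HOL-Computational_Algebra.Polynomial" "HOL-Library.Multiset"
begin

text \<open>A superfunction F = f0(x) + xi f1(x) is represented by the pair (f0, f1).\<close>
type_synonym spoly = "complex poly \<times> complex poly"

definition sp_zero :: spoly where "sp_zero = (0, 0)"
definition sp_add :: "spoly \<Rightarrow> spoly \<Rightarrow> spoly" where
  "sp_add F G = (fst F + fst G, snd F + snd G)"
definition sp_smult :: "complex \<Rightarrow> spoly \<Rightarrow> spoly" where
  "sp_smult c F = (smult c (fst F), smult c (snd F))"
text \<open>(a0 + xi a1)(b0 + xi b1) = a0 b0 + xi (a0 b1 + a1 b0)\<close>
definition sp_mult :: "spoly \<Rightarrow> spoly \<Rightarrow> spoly" where
  "sp_mult F G = (fst F * fst G, fst F * snd G + snd F * fst G)"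
definition sp_dx :: "spoly \<Rightarrow> spoly" where
  "sp_dx F = (pderiv (fst F), pderiv (snd F))"
text \<open>D = d_xi + xi d_x,  Dbar = d_xi - xi d_x (applied to a function)\<close>
definition sp_D :: "spoly \<Rightarrow> spoly" where
  "sp_D F = (snd F, pderiv (fst F))"
definition sp_Dbar :: "spoly \<Rightarrow> spoly" where
  "sp_Dbar F = (snd F, - pderiv (fst F))"
definition sp_even :: "spoly \<Rightarrow> spoly" where "sp_even F = (fst F, 0)"
definition sp_odd :: "spoly \<Rightarrow> spoly" where "sp_odd F = (0, snd F)"
definition sp_sigma :: "spoly \<Rightarrow> spoly" where "sp_sigma F = (fst F, - snd F)"
text \<open>all derivatives of order at least this bound vanish\<close>
definition sp_bound :: "spoly \<Rightarrow> nat" where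
  "sp_bound F = Suc (max (degree (fst F)) (degree (snd F)))"
definition sp_sum :: "spoly list \<Rightarrow> spoly" where
  "sp_sum xs = foldr sp_add xs sp_zero"

text \<open>A term (c, w, q) stands for c \<circ> d_x^w \<circ> Dbar^q (q = True means one factor Dbar);
  an operator is a finite formal sum (list) of terms.\<close>
type_synonym pterm = "spoly \<times> complex \<times> bool"

text \<open>d_x^w Dbar^q \<circ> H written in normal form, using
  d_x^w \<circ> K = sum_j (w choose j) d_x^j(K) d_x^(w-j) and
  Dbar \<circ> H = Dbar(H) + (-1)^|H| H Dbar.\<close>
definition E_pass :: "complex \<Rightarrow> bool \<Rightarrow> spoly \<Rightarrow> pterm list" where
  "E_pass w q H = (if \<not> q then
      map (\<lambda>i. (sp_smult (w gchoose i) ((sp_dx ^^ i) H), w - of_nat i, False)) [0..<sp_bound H]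
    else
      map (\<lambda>i. (sp_smult (w gchoose i) ((sp_dx ^^ i) (sp_Dbar H)), w - of_nat i, False)) [0..<sp_bound H]
      @ map (\<lambda>i. (sp_smult (w gchoose i) ((sp_dx ^^ i) (sp_sigma H)), w - of_nat i, True)) [0..<sp_bound H])"

text \<open>(d_x^w' Dbar^q')(d_x^w Dbar^q), using [Dbar, d_x^z] = 0 and Dbar^2 = - d_x:
  returns (scalar, exponent, Dbar-flag).\<close>
definition E_mul :: "complex \<times> bool \<Rightarrow> complex \<times> bool \<Rightarrow> complex \<times> complex \<times> bool" where
  "E_mul a b = (if snd a \<and> snd b then (-1, fst a + fst b + 1, False)
                else (1, fst a + fst b, snd a \<or> snd b))"

definition pt_comp :: "pterm \<Rightarrow> pterm \<Rightarrow> pterm list" where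
  "pt_comp s t = (case s of (G, w', q') \<Rightarrow> case t of (H, w, q) \<Rightarrow>
     map (\<lambda>(c, w2, q2). case E_mul (w2, q2) (w, q) of (sg, w3, q3) \<Rightarrow>
            (sp_smult sg (sp_mult G c), w3, q3)) (E_pass w' q' H))"

definition op_comp :: "pterm list \<Rightarrow> pterm list \<Rightarrow> pterm list" where
  "op_comp A B = concat (map (\<lambda>s. concat (map (pt_comp s) B)) A)"

definition op_scale :: "complex \<Rightarrow> pterm list \<Rightarrow> pterm list" where
  "op_scale a A = map (\<lambda>(c, w, q). (sp_smult a c, w, q)) A"

text \<open>even / odd parts of an operator (parity of c d_x^w Dbar^q is |c| + q)\<close>
definition pt_even :: "pterm \<Rightarrow> pterm" where
  "pt_even t = (case t of (c, w, q) \<Rightarrow> (if q then sp_odd c else sp_even c, w, q))"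
definition pt_odd :: "pterm \<Rightarrow> pterm" where
  "pt_odd t = (case t of (c, w, q) \<Rightarrow> (if q then sp_even c else sp_odd c, w, q))"

text \<open>L_nu(X_F) = F d_x + 1/2 D(F) Dbar + nu d_x(F)\<close>
definition Lop :: "complex \<Rightarrow> spoly \<Rightarrow> pterm list" where
  "Lop nu F = [(F, 1, False), (sp_smult (1/2) (sp_D F), 0, True), (sp_smult nu (sp_dx F), 0, False)]"

text \<open>L_{lam,mu}(X_F)(T) = L_mu(X_F) T - (-1)^{|X||T|} T L_lam(X_F) for F homogeneous of parity s\<close>
definition L_hom :: "complex \<Rightarrow> complex \<Rightarrow> bool \<Rightarrow> spoly \<Rightarrow> pterm list \<Rightarrow> pterm list" where
  "L_hom lam mu s F T =
     op_comp (Lop mu F) T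
     @ op_scale (-1) (op_comp (map pt_even T) (Lop lam F))
     @ op_scale (if s then 1 else -1) (op_comp (map pt_odd T) (Lop lam F))"

definition L_act :: "complex \<Rightarrow> complex \<Rightarrow> spoly \<Rightarrow> pterm list \<Rightarrow> pterm list" where
  "L_act lam mu F T = L_hom lam mu False (sp_even F) T @ L_hom lam mu True (sp_odd F) T"

text \<open>Dbar^z_0 = e^{i pi z/2} d_x^{z/2}, Dbar^z_1 = e^{i pi (z-1)/2} d_x^{(z-1)/2} Dbar;
  returns (phase, exponent of d_x, Dbar-flag). Parity p is a bool (True = 1).\<close>
definition Dbar_sym :: "complex \<Rightarrow> bool \<Rightarrow> complex \<times> complex \<times> bool" where
  "Dbar_sym z q = (if q then (exp (\<i> * of_real pi * (z - 1) / 2), (z - 1) / 2, True)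
                   else (exp (\<i> * of_real pi * z / 2), z / 2, False))"

text \<open>The operator sum_{j<l} T_j Dbar^{2k-j}_{p + (j mod 2)}\<close>
definition psi_ops :: "complex \<Rightarrow> bool \<Rightarrow> nat \<Rightarrow> (nat \<Rightarrow> spoly) \<Rightarrow> pterm list" where
  "psi_ops k p l T = map (\<lambda>j. case Dbar_sym (2 * k - of_nat j) (p \<noteq> odd j) of
       (ph, w, q) \<Rightarrow> (sp_smult ph (T j), w, q)) [0..<l]"

definition psi_coeff :: "complex \<Rightarrow> bool \<Rightarrow> pterm list \<Rightarrow> nat \<Rightarrow> spoly" where
  "psi_coeff k p A j = (case Dbar_sym (2 * k - of_nat j) (p \<noteq> odd j) of
       (ph, w, q) \<Rightarrow> sp_smult (inverse ph)
          (sp_sum (map fst (filter (\<lambda>(c, w', q'). w' = w \<and> q' = q) A))))"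

text \<open>SQ^{k,p,l} = Psi^{k,p} / Psi^{k-l/2,p+l}: coefficient families (T_{2k-j})_{j<l}\<close>
definition SQ_space :: "nat \<Rightarrow> (nat \<Rightarrow> spoly) set" where
  "SQ_space l = {T. \<forall>j\<ge>l. T j = sp_zero}"

definition SQ_act :: "complex \<Rightarrow> complex \<Rightarrow> complex \<Rightarrow> bool \<Rightarrow> nat \<Rightarrow> spoly \<Rightarrow>
    (nat \<Rightarrow> spoly) \<Rightarrow> (nat \<Rightarrow> spoly)" where
  "SQ_act lam mu k p l F T =
     (\<lambda>j. if j < l then psi_coeff k p (L_act lam mu F (psi_ops k p l T)) j else sp_zero)"

definition SQ_linear :: "nat \<Rightarrow> ((nat \<Rightarrow> spoly) \<Rightarrow> (nat \<Rightarrow> spoly)) \<Rightarrow> bool" where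
  "SQ_linear l Phi \<longleftrightarrow>
     (\<forall>T U. T \<in> SQ_space l \<longrightarrow> U \<in> SQ_space l \<longrightarrow>
        Phi (\<lambda>j. sp_add (T j) (U j)) = (\<lambda>j. sp_add (Phi T j) (Phi U j))) \<and>
     (\<forall>c T. T \<in> SQ_space l \<longrightarrow> Phi (\<lambda>j. sp_smult c (T j)) = (\<lambda>j. sp_smult c (Phi T j)))"

definition SQ_equiv :: "complex \<Rightarrow> complex \<Rightarrow> complex \<Rightarrow> bool \<Rightarrow>
    complex \<Rightarrow> complex \<Rightarrow> complex \<Rightarrow> bool \<Rightarrow> nat \<Rightarrow> bool" where
  "SQ_equiv lam mu k p lam' mu' k' p' l \<longleftrightarrow>
     (\<exists>Phi. SQ_linear l Phi \<and> bij_betw Phi (SQ_space l) (SQ_space l) \<and>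
        (\<forall>F. \<forall>T\<in>SQ_space l. Phi (SQ_act lam mu k p l F T) = SQ_act lam' mu' k' p' l F (Phi T)))"

definition gam_half :: "complex \<Rightarrow> complex \<Rightarrow> complex" where
  "gam_half lam mu = complex_of_real (sqrt 3) * (lam + mu - 1/2)"

definition Bval :: "nat \<Rightarrow> complex \<Rightarrow> complex \<Rightarrow> complex \<Rightarrow> complex \<Rightarrow> complex" where
  "Bval q a b lam mu = (let g = gam_half lam mu; gm = g^2; d = mu - lam; m = b; r = a - b in
     if r = 3/2 then (if even q then g else gm - 3 * (m + 1/2) * d - 3/4)
     else if r = 2 then (if even q then gm - (m + 3/2) * (2 * d + m + 1/2) else gm - m * (2 * d + m + 1))
     else if r = 5/2 then (if even q then gm - (m + 1) * d - 3/4
                           else g^3 - g * (4 * (m + 1) * d - (m + 1)^2 + 3))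
     else 0)"

definition ffall :: "complex \<Rightarrow> nat \<Rightarrow> complex" where
  "ffall x r = (\<Prod>i<r. x - of_nat i)"

definition S_fun :: "bool \<Rightarrow> complex \<Rightarrow> nat \<Rightarrow> nat \<Rightarrow> complex \<Rightarrow> complex \<Rightarrow> complex" where
  "S_fun p n I J lam mu = (let d = mu - lam; i = of_nat I / 2; j = of_nat J / 2 in
     if \<not> p then ffall (d - n - of_nat ((J + 1) div 2)) ((I + 1) div 2 - (J + 1) div 2)
                 * Bval (J mod 2) (n + i) (n + j) lam mu
     else ffall (d - n - 1/2 - of_nat (J div 2)) (I div 2 - J div 2)
                 * Bval (1 - J mod 2) (n + i) (n + j) lam mu)"

definition SVC :: "complex \<Rightarrow> bool \<Rightarrow> bool \<Rightarrow> nat \<Rightarrow> complex \<Rightarrow> complex \<Rightarrow> complex \<Rightarrow> complex \<Rightarrow> bool" where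
  "SVC n p p' l lam mu lam' mu' \<longleftrightarrow>
     (\<forall>I J::nat. I < l \<and> 3 \<le> int I - int J \<and> int I - int J \<le> 5 \<longrightarrow>
        (S_fun p n I J lam mu = 0 \<longleftrightarrow> S_fun p' n I J lam' mu' = 0))"

text \<open>the formal symbol B^q_{a,b} is the triple (q, a, b)\<close>
type_synonym Bsym = "nat \<times> complex \<times> complex"
text \<open>formal ratio: (numerator multiset, denominator multiset)\<close>
type_synonym fratio = "Bsym multiset \<times> Bsym multiset"

datatype Iname = I0 | I1 | J0

definition Iratio :: "complex \<Rightarrow> Iname \<Rightarrow> fratio" where
  "Iratio n x = (case x of
      I0 \<Rightarrow> ({#(0, n + 5/2, n), (1, n + 2, n + 1/2)#}, {#(1, n + 5/2, n + 1/2), (0, n + 2, n)#})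
    | I1 \<Rightarrow> ({#(1, n + 3, n + 1/2), (0, n + 5/2, n + 1)#}, {#(0, n + 3, n + 1), (1, n + 5/2, n + 1/2)#})
    | J0 \<Rightarrow> ({#(1, n + 3, n + 1/2), (0, n + 5/2, n)#},
             {#(1, n + 3, n + 3/2), (1, n + 5/2, n + 1/2), (0, n + 3/2, n)#}))"

definition ratio_of :: "complex \<Rightarrow> Iname multiset \<Rightarrow> Iname multiset \<Rightarrow> fratio" where
  "ratio_of n N M =
     (sum_mset (image_mset (\<lambda>x. fst (Iratio n x)) N) + sum_mset (image_mset (\<lambda>x. snd (Iratio n x)) M),
      sum_mset (image_mset (\<lambda>x. snd (Iratio n x)) N) + sum_mset (image_mset (\<lambda>x. fst (Iratio n x)) M))"

definition Simp :: "fratio \<Rightarrow> fratio" where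
  "Simp R = (fst R - snd R, snd R - fst R)"

definition ratio_factors :: "fratio \<Rightarrow> Bsym set" where
  "ratio_factors R = set_mset (fst R) \<union> set_mset (snd R)"

definition Bsym_val :: "Bsym \<Rightarrow> complex \<Rightarrow> complex \<Rightarrow> complex" where
  "Bsym_val s lam mu = Bval (fst s) (fst (snd s)) (snd (snd s)) lam mu"

definition ratio_value :: "fratio \<Rightarrow> complex \<Rightarrow> complex \<Rightarrow> complex" where
  "ratio_value R lam mu =
     prod_mset (image_mset (\<lambda>s. Bsym_val s lam mu) (fst R)) /
     prod_mset (image_mset (\<lambda>s. Bsym_val s lam mu) (snd R))"

end

theory Submission imports Defs "HOL-Library.Product_Plus" begin

text \<open>The coefficients of a symbol of order at most \<open>\<delta> - n\<close> are superfunctions indexed by half-integral steps; here the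
  steps are doubled, so the indices are \<open>j = 0, \<dots>, 6\<close>. The fields \<open>X_F\<close> with \<open>F = \<xi> g\<close> generate all contact fields, so only
  these have to be intertwined. As long as \<open>2 n\<close> avoids \<open>0, -1, \<dots>, -5\<close>, there is a unitriangular map, built from powers of \<open>D\<close>,
  that carries the action to a normal form: density actions of weight \<open>n + j/2\<close> on the diagonal, and below it multiples of
  supertransvectants, which first appear three steps down. The multiples at distance 3, 4, 5 are universal non-zero
  constants times \<open>S_{i,j}\<close>, and the one at distance 6 is a constant times \<open>S_{6,3} S_{3,0}\<close>.

  A map that intertwines two normal forms commutes with \<open>osp(1|2)\<close>. Its density modules of different weights admit no
  non-zero homomorphisms between each other here, so the map is a diagonal matrix of scalars \<open>c_j\<close>, and it exists if and only if
  \<open>c_i S_{i,j} = c_j S'_{i,j}\<close> on the graph with seven vertices and the nine edges \<open>3 \<le> i - j \<le> 5\<close>. Non-zero solutions exist if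
  and only if \<open>S\<close> and \<open>S'\<close> vanish simultaneously and \<open>S'/S\<close> has product 1 around every cycle of edges on which they do not vanish.
  The cycle lattice has rank three, with basis \<open>I^0_n, I^1_{n+1/2}, J^0_n\<close>. If \<open>\<delta> - n\<close> is 1 or 2, then so many weights
  vanish that no cycle is left; if it is 0, the vertex 0 is isolated.\<close>

section \<open>The action on coefficients\<close>

text \<open>Odd fields suffice because \<open>2 xi\<close> acts as \<open>D\<close> on every
  component and an even field \<open>f\<close> acts as the anticommutator of \<open>D\<close> with
  the action of \<open>xi f\<close>. An equivalence is therefore a linear bijection commuting with
  \<open>D\<close> and with kernels indexed by a single polynomial \<open>g\<close>. Below the
  diagonal these kernels multiply by derivatives of \<open>g\<close>; for \<open>g = x\<close> only
  the entries one step below the diagonal survive. The entries of the lift are multiples of powers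
  of \<open>D\<close>, so it commutes with \<open>D\<close>, and equivariance under
  \<open>xi x\<close> becomes a two-term recursion with divisors \<open>N + 1\<close> and
  \<open>2 n + r\<close>, \<open>r < 6\<close>: this is where the six excluded values of
  \<open>n\<close> come from. The recursion leaves no freedom, so the higher derivatives of
  \<open>g\<close> yield rational identities to be verified, and their size dictates the form of the
  \<open>lift_chain\<close> lemmas. The weight at distance 6 imposes no condition of its own: its
  equation is the product of those for \<open>(6, 3)\<close> and \<open>(3, 0)\<close>. The falling
  factorials in \<open>S\<close> are quotients of a function at the two ends of an edge as long as
  no factor vanishes; this is why condition (iii) sees only the symbols \<open>B\<close>.\<close>

lemma sp_add_eq: "sp_add F G = F + G" by (simp add: sp_add_def plus_prod_def)
lemma sp_zero_eq: "sp_zero = 0" by (simp add: sp_zero_def zero_prod_def)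
lemma sp_sum_eq: "sp_sum xs = sum_list xs"
  by (induction xs) (simp_all add: sp_sum_def sp_add_eq sp_zero_eq)

lemma sp_smult_add: "sp_smult c (F + G) = sp_smult c F + sp_smult c G"
  by (simp add: sp_smult_def smult_add_right)
lemma sp_smult_0 [simp]: "sp_smult c 0 = 0"
  by (simp add: sp_smult_def zero_prod_def)
lemma sp_smult_1 [simp]: "sp_smult 1 F = F"
  by (simp add: sp_smult_def)
lemma sp_smult_sum: "sp_smult c (\<Sum>x\<in>A. f x) = (\<Sum>x\<in>A. sp_smult c (f x))"
  by (induction A rule: infinite_finite_induct) (simp_all add: sp_smult_add)
lemma sp_smult_smult [simp]: "sp_smult c (sp_smult d F) = sp_smult (c * d) F"
  by (simp add: sp_smult_def)
lemma sp_smult_sum_list: "sp_smult c (sum_list Fs) = (\<Sum>F\<leftarrow>Fs. sp_smult c F)"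
  by (induction Fs) (simp_all add: sp_smult_add)

text \<open>Operator lists may repeat a monomial \<open>d_x^w Dbar^q\<close>; the collected
  coefficient depends on the operator alone and is what \<open>psi_coeff\<close> reads off.\<close>

definition coef_at :: "complex \<Rightarrow> bool \<Rightarrow> pterm list \<Rightarrow> spoly" where
  "coef_at w q A = sum_list (map fst (filter (\<lambda>(c, w', q'). w' = w \<and> q' = q) A))"

lemma coef_at_Nil [simp]: "coef_at w q [] = 0" by (simp add: coef_at_def)
lemma coef_at_Cons: "coef_at w q (t # A) = (if snd t = (w, q) then fst t else 0) + coef_at w q A"
  by (auto simp: coef_at_def split: prod.splits)
lemma coef_at_append [simp]: "coef_at w q (A @ B) = coef_at w q A + coef_at w q B"
  by (simp add: coef_at_def)
lemma coef_at_concat: "coef_at w q (concat (map f xs)) = (\<Sum>x\<leftarrow>xs. coef_at w q (f x))"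
  by (induction xs) simp_all
lemma coef_at_scale [simp]: "coef_at w q (op_scale a A) = sp_smult a (coef_at w q A)"
  by (induction A) (auto simp: op_scale_def coef_at_Cons sp_smult_add)

lemma psi_coeff_eq: "psi_coeff k p A j = (case Dbar_sym (2 * k - of_nat j) (p \<noteq> odd j) of
       (ph, w, q) \<Rightarrow> sp_smult (inverse ph) (coef_at w q A))"
  by (simp add: psi_coeff_def coef_at_def sp_sum_eq)

lemma sum_list_add: "(\<Sum>x\<leftarrow>xs. f x + g x) = (\<Sum>x\<leftarrow>xs. f x) + (\<Sum>x\<leftarrow>xs. (g x :: 'a :: comm_monoid_add))"
  by (induction xs) (simp_all add: algebra_simps)
lemma sum_list_swap: "(\<Sum>x\<leftarrow>xs. \<Sum>y\<leftarrow>ys. f x y) = (\<Sum>y\<leftarrow>ys. \<Sum>x\<leftarrow>xs. (f x y :: 'a :: comm_monoid_add))"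
  by (induction xs) (simp_all add: sum_list_add)

lemma coef_at_comp:
  "coef_at w q (op_comp A B) = (\<Sum>s\<leftarrow>A. \<Sum>t\<leftarrow>B. coef_at w q (pt_comp s t))"
  by (simp add: op_comp_def coef_at_concat)

text \<open>Additivity in the operator reduces the action on a symbol to the action on single
  monomials \<open>c d_x^w Dbar^q\<close>.\<close>

lemma coef_at_L_act_map:
  "coef_at w q (L_act lam mu F (map h xs)) = (\<Sum>x\<leftarrow>xs. coef_at w q (L_act lam mu F [h x]))"
proof -
  have 1: "coef_at w q (op_comp A (map h xs)) = (\<Sum>x\<leftarrow>xs. coef_at w q (op_comp A [h x]))" for A
    by (simp add: coef_at_comp sum_list_swap[of _ _ A] o_def)
  have 2: "coef_at w q (op_comp (map f (map h xs)) A) = (\<Sum>x\<leftarrow>xs. coef_at w q (op_comp (map f [h x]) A))" for A f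
    by (simp add: coef_at_comp o_def)
  show ?thesis
    unfolding L_act_def L_hom_def coef_at_append coef_at_scale 1 2
    by (simp only: sp_smult_sum_list sum_list_add map_map o_def)
qed

lemma sum_list_single_index:
  assumes "\<And>i. i < b \<Longrightarrow> i \<noteq> m \<Longrightarrow> f i = 0"
  shows "(\<Sum>i\<leftarrow>[0..<b]. f i) = (if m < b then f m else (0 :: 'a :: comm_monoid_add))"
proof -
  have "(\<Sum>i\<leftarrow>[0..<b]. f i) = sum f {0..<b}"
    by (simp add: sum_list_distinct_conv_sum_set)
  also have "\<dots> = (if m < b then f m else 0)"
    using assms by (auto intro!: sum.neutral simp: sum.remove[of "{0..<b}" m])
  finally show ?thesis .
qed

lemma sp_dx_funpow: "(sp_dx ^^ i) F = ((pderiv ^^ i) (fst F), (pderiv ^^ i) (snd F))"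
  by (induction i) (simp_all add: sp_dx_def)

lemma pderiv_funpow_eq_0: "degree p < i \<Longrightarrow> (pderiv ^^ i) p = (0 :: complex poly)"
proof (induction i arbitrary: p)
  case (Suc i)
  show ?case
  proof (cases "degree p = 0")
    case True
    then have "pderiv p = 0" by (simp add: pderiv_eq_0_iff)
    moreover have "(pderiv ^^ i) (0 :: complex poly) = 0" by (induction i) simp_all
    ultimately show ?thesis by (simp add: funpow_swap1)
  next
    case False
    with Suc show ?thesis by (simp add: funpow_swap1 degree_pderiv)
  qed
qed simp

text \<open>The Leibniz series in \<open>E_pass\<close> is cut off at \<open>sp_bound\<close>; the
  cut removes only zeros.\<close>

lemma sp_dx_beyond_bound: "i \<ge> sp_bound F \<Longrightarrow> (sp_dx ^^ i) F = 0"
  by (simp add: sp_dx_funpow sp_bound_def pderiv_funpow_eq_0 zero_prod_def)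

text \<open>The lower index is a drop of the exponent of \<open>d_x\<close>. It is an integer
  because the exponent asked for may exceed the leading one, and then the coefficient has to be
  0.\<close>

definition gb :: "complex \<Rightarrow> int \<Rightarrow> complex" where
  "gb a d = (if d < 0 then 0 else a gchoose nat d)"

text \<open>The exponents \<open>a - i + w\<close> are distinct, so only the summand
  \<open>i = d\<close> can be hit. The cut-off \<open>b\<close> may exceed \<open>sp_bound H\<close>
  because \<open>E_pass\<close> cuts the series of \<open>sp_Dbar H\<close> and
  \<open>sp_sigma H\<close> at the bound of \<open>H\<close> itself.\<close>

lemma coef_at_passing:
  assumes "W = a + w - of_int d" "sp_bound H \<le> b"
  shows "coef_at W q (map (\<lambda>i. (sp_mult G (sp_smult (a gchoose i) ((sp_dx ^^ i) H)), a - of_nat i + w, q')) [0..<b])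
    = (if q' = q then sp_smult (gb a d) (sp_mult G ((sp_dx ^^ nat d) H)) else 0)"
proof -
  have *: "of_int d = (of_nat i :: complex) \<longleftrightarrow> d \<ge> 0 \<and> i = nat d" for i
    by (metis int_nat_eq nat_int of_int_of_nat_eq of_int_eq_iff of_nat_0_le_iff)
  have sm: "sp_mult G (sp_smult c K) = sp_smult c (sp_mult G K)" for c K
    by (simp add: sp_mult_def sp_smult_def smult_add_right)
  have "coef_at (a + w - of_int d) q (map (\<lambda>i. (sp_mult G (sp_smult (a gchoose i) ((sp_dx ^^ i) H)), a - of_nat i + w, q')) [0..<b])
     = (\<Sum>i\<leftarrow>[0..<b]. if q' = q \<and> d \<ge> 0 \<and> i = nat d then sp_smult (a gchoose i) (sp_mult G ((sp_dx ^^ i) H)) else 0)" for b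
    by (induction b) (auto simp: coef_at_Cons sm * algebra_simps)
  also have "\<dots> b = (if q' = q \<and> d \<ge> 0 \<and> nat d < b then sp_smult (gb a d) (sp_mult G ((sp_dx ^^ nat d) H)) else 0)" for b
    by (subst sum_list_single_index[where m = "nat d"]) (auto simp: gb_def)
  finally show ?thesis
    using assms by (auto simp: gb_def sp_dx_beyond_bound sp_mult_def sp_smult_def zero_prod_def)
qed

lemma gb_1: "gb 1 d = (if d = 0 \<or> d = 1 then 1 else 0)"
proof -
  have "(1 :: complex) gchoose (Suc (Suc i)) = 0" for i
    using binomial_gbinomial[of 1 "Suc (Suc i)", where 'a = complex] by simp
  moreover have "nat d = Suc (Suc (nat (d - 2)))" if "d \<ge> 2" using that by simp
  ultimately show ?thesis
    by (cases "d \<ge> 2") (force simp: gb_def, auto simp: gb_def not_le)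
qed

lemma gb_0: "gb 0 d = (if d = 0 then 1 else 0)"
proof -
  have "nat d = Suc (nat (d - 1))" if "d \<ge> 1" using that by simp
  then show ?thesis by (cases "d \<ge> 1") (force simp: gb_def, auto simp: gb_def not_le)
qed

lemma coef_at_pt_comp_dx:
  assumes "W = a + w - of_int d"
  shows "coef_at W Q (pt_comp (G, a, False) (H, w, q))
    = (if q = Q then sp_smult (gb a d) (sp_mult G ((sp_dx ^^ nat d) H)) else 0)"
proof -
  have "pt_comp (G, a, False) (H, w, q) =
     map (\<lambda>i. (sp_mult G (sp_smult (a gchoose i) ((sp_dx ^^ i) H)), a - of_nat i + w, q)) [0..<sp_bound H]"
    by (simp add: pt_comp_def E_pass_def E_mul_def sp_smult_def)
  then show ?thesis by (simp only: coef_at_passing[OF assms order.refl])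
qed

lemma coef_at_pt_comp_Dbar:
  assumes "W = a + w - of_int d"
  shows "coef_at W Q (pt_comp (G, a, True) (H, w, False))
    = sp_smult (gb a d) (sp_mult G ((sp_dx ^^ nat d) (if Q then sp_sigma H else sp_Dbar H)))"
proof -
  have le: "sp_bound (sp_sigma H) \<le> sp_bound H" "sp_bound (sp_Dbar H) \<le> sp_bound H"
    using degree_pderiv[of "fst H"] by (auto simp: sp_bound_def sp_sigma_def sp_Dbar_def)
  have "pt_comp (G, a, True) (H, w, False) =
     map (\<lambda>i. (sp_mult G (sp_smult (a gchoose i) ((sp_dx ^^ i) (sp_Dbar H))), a - of_nat i + w, False)) [0..<sp_bound H]
     @ map (\<lambda>i. (sp_mult G (sp_smult (a gchoose i) ((sp_dx ^^ i) (sp_sigma H))), a - of_nat i + w, True)) [0..<sp_bound H]"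
    by (simp add: pt_comp_def E_pass_def E_mul_def sp_smult_def)
  then show ?thesis by (simp add: coef_at_passing[OF assms le(1)] coef_at_passing[OF assms le(2)])
qed

text \<open>Two factors \<open>Dbar\<close> merge into \<open>- d_x\<close>. This lifts the exponent
  by one, hence the drop \<open>d + 1\<close> and the minus sign in the part without
  \<open>Dbar\<close>.\<close>

lemma coef_at_pt_comp_Dbar_Dbar:
  assumes "W = a + w - of_int d"
  shows "coef_at W Q (pt_comp (G, a, True) (H, w, True))
    = (if Q then sp_smult (gb a d) (sp_mult G ((sp_dx ^^ nat d) (sp_Dbar H)))
       else sp_smult (- gb a (d + 1)) (sp_mult G ((sp_dx ^^ nat (d + 1)) (sp_sigma H))))"
proof -
  have le: "sp_bound (sp_sigma H) \<le> sp_bound H" "sp_bound (sp_Dbar H) \<le> sp_bound H"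
    using degree_pderiv[of "fst H"] by (auto simp: sp_bound_def sp_sigma_def sp_Dbar_def)
  have sm: "sp_smult (-1) (sp_mult G K) = sp_mult (sp_smult (-1) G) K" for K
    by (simp add: sp_smult_def sp_mult_def algebra_simps)
  have "pt_comp (G, a, True) (H, w, True) =
     map (\<lambda>i. (sp_mult G (sp_smult (a gchoose i) ((sp_dx ^^ i) (sp_Dbar H))), a - of_nat i + w, True)) [0..<sp_bound H]
     @ map (\<lambda>i. (sp_mult (sp_smult (-1) G) (sp_smult (a gchoose i) ((sp_dx ^^ i) (sp_sigma H))), a - of_nat i + (w + 1), False)) [0..<sp_bound H]"
    by (simp add: pt_comp_def E_pass_def E_mul_def sp_smult_def sp_mult_def algebra_simps)
  moreover have "W = a + (w + 1) - of_int (d + 1)" using assms by simp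
  note p = coef_at_passing[OF assms le(2)] coef_at_passing[OF this le(1)]
  ultimately show ?thesis
    by (simp only: coef_at_append p) (simp add: sm[symmetric])
qed

text \<open>The Lie derivative \<open>L_\<nu>(X_F)\<close> in components, with
  \<open>F = f + xi g\<close> and argument \<open>a + xi b\<close>.\<close>

definition sp_density :: "complex \<Rightarrow> spoly \<Rightarrow> spoly \<Rightarrow> spoly" where
  "sp_density \<nu> F v = (case F of (f, g) \<Rightarrow> case v of (a, b) \<Rightarrow>
     (f * pderiv a + smult \<nu> (pderiv f * a) + smult (1/2) (g * b),
      f * pderiv b + smult (\<nu> + 1/2) (pderiv f * b) + smult (1/2) (g * pderiv a) + smult \<nu> (pderiv g * a)))"

text \<open>Multiplication by \<open>D^(N + 2) F\<close>, where \<open>D^2 = d_x\<close>; for odd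
  \<open>N\<close> the odd component of \<open>v\<close> changes sign first. The argument
  \<open>v\<close> itself is never differentiated.\<close>

definition sp_couple :: "nat \<Rightarrow> spoly \<Rightarrow> spoly \<Rightarrow> spoly" where
  "sp_couple N F v = (case F of (f, g) \<Rightarrow> case v of (a, b) \<Rightarrow>
     let m = Suc (N div 2) in
     if even N then ((pderiv ^^ m) f * a, (pderiv ^^ m) f * b + (pderiv ^^ m) g * a)
     else ((pderiv ^^ m) g * a, (pderiv ^^ Suc m) f * a - (pderiv ^^ m) g * b))"

section \<open>The supercommutator with a single monomial\<close>

lemma L_act_single:
  "coef_at W Q (L_act lam mu F [(c, w, q)]) =
   (let X = \<lambda>F. coef_at W Q (pt_comp (F, 1, False) (c, w, q)) +
            (coef_at W Q (pt_comp (sp_smult (1/2) (sp_D F), 0, True) (c, w, q)) +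
             coef_at W Q (pt_comp (sp_smult mu (sp_dx F), 0, False) (c, w, q)));
        Y = \<lambda>F c. coef_at W Q (pt_comp (c, w, q) (F, 1, False)) +
            (coef_at W Q (pt_comp (c, w, q) (sp_smult (1/2) (sp_D F), 0, True)) +
             coef_at W Q (pt_comp (c, w, q) (sp_smult lam (sp_dx F), 0, False)));
        e = if q then sp_odd c else sp_even c; d = if q then sp_even c else sp_odd c
    in X (sp_even F) + (sp_smult (-1) (Y (sp_even F) e) + sp_smult (-1) (Y (sp_even F) d)) +
       (X (sp_odd F) + (sp_smult (-1) (Y (sp_odd F) e) + Y (sp_odd F) d)))"
proof -
  have "sp_smult 1 F = F" for F by (simp add: sp_smult_def)
  then show ?thesis
    by (simp add: L_act_def L_hom_def coef_at_comp Lop_def pt_even_def pt_odd_def Let_def)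
qed

lemmas sp_unfolds = sp_even_def sp_odd_def sp_mult_def sp_smult_def sp_dx_funpow sp_D_def sp_Dbar_def sp_sigma_def sp_dx_def

lemma pderiv_funpow_smult: "(pderiv ^^ i) (smult c p) = smult c ((pderiv ^^ i) p)"
  by (induction i) (simp_all add: pderiv_smult)
lemma pderiv_funpow_minus: "(pderiv ^^ i) (- p) = - (pderiv ^^ i) (p :: complex poly)"
  by (induction i) (simp_all add: pderiv_minus)

lemma cpoly_eq_iff: "p = q \<longleftrightarrow> (\<forall>x. poly p x = poly q x)" for p q :: "complex poly"
  by (simp add: poly_eq_poly_eq_iff[symmetric] fun_eq_iff)

lemmas sp_eval = sp_unfolds sp_density_def sp_couple_def pderiv_funpow_smult pderiv_funpow_minus
  funpow_swap1 pderiv_smult pderiv_minus zero_prod_def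

text \<open>Terms above the leading order cancel in the supercommutator, the leading order gives the
  density action, and below it only the Leibniz tail of the product \<open>T L_\<lambda>(X)\<close>
  contributes. The three other parity types follow the same pattern.\<close>

lemma coef_at_L_act_dx_dx:
  "coef_at (w - of_int d) False (L_act lam mu F [(c, w, False)]) =
    (if d < 0 then 0 else if d = 0 then sp_density (mu - lam - w) F c
     else sp_smult (- (w gchoose Suc (nat d)) - lam * (w gchoose nat d)) (sp_couple (2 * nat d) F c))"
proof -
  have W: "w - of_int d = 1 + w - of_int (d + 1)" "w - of_int d = 0 + w - of_int d"
    "w - of_int d = w + 1 - of_int (d + 1)" "w - of_int d = w + 0 - of_int d" by simp_all
  have gbw: "gb w d = (if d < 0 then 0 else w gchoose nat d)"
    "gb w (d + 1) = (if d < -1 then 0 else if d = -1 then 1 else w gchoose Suc (nat d))"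
    by (simp_all add: gb_def nat_add_distrib)
  obtain f g a b where Fc: "F = (f, g)" "c = (a, b)" by (cases F, cases c)
  have "d < -1 \<or> d = -1 \<or> d = 0 \<or> d > 0" by linarith
  then show ?thesis
    unfolding L_act_single coef_at_pt_comp_dx[OF W(1)] coef_at_pt_comp_dx[OF W(2)]
      coef_at_pt_comp_dx[OF W(3)] coef_at_pt_comp_dx[OF W(4)] coef_at_pt_comp_Dbar[OF W(2)] gbw
    by (elim disjE)
       (auto simp: Let_def gb_1 gb_0 nat_add_distrib Fc sp_eval cpoly_eq_iff field_simps)
qed

lemma coef_at_L_act_dx_Dbar:
  "coef_at (w - of_int d) True (L_act lam mu F [(c, w, False)]) =
    (if d \<le> 0 then 0
     else sp_smult (- (w gchoose nat d) / 2) (sp_couple (2 * nat (d - 1) + 1) F c))"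
proof -
  have W: "w - of_int d = 1 + w - of_int (d + 1)" "w - of_int d = 0 + w - of_int d"
    "w - of_int d = w + 1 - of_int (d + 1)" "w - of_int d = w + 0 - of_int d" by simp_all
  have gbw: "gb w d = (if d < 0 then 0 else w gchoose nat d)"
    by (simp_all add: gb_def)
  obtain f g a b where Fc: "F = (f, g)" "c = (a, b)" by (cases F, cases c)
  have "d < 0 \<or> d = 0 \<or> (\<exists>m. d = int (Suc m))"
    by (metis linorder_cases zero_less_imp_eq_int gr0_conv_Suc)
  then show ?thesis
    unfolding L_act_single coef_at_pt_comp_dx[OF W(1)] coef_at_pt_comp_dx[OF W(2)]
      coef_at_pt_comp_dx[OF W(3)] coef_at_pt_comp_dx[OF W(4)] coef_at_pt_comp_Dbar[OF W(2)]
      coef_at_pt_comp_Dbar[OF W(4)] gbw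
    by (elim disjE exE)
       (auto simp: Let_def gb_1 gb_0 nat_add_distrib Fc sp_eval cpoly_eq_iff field_simps)
qed

lemma coef_at_L_act_Dbar_dx:
  "coef_at (w - of_int d) False (L_act lam mu F [(c, w, True)]) =
    (if d < 0 then 0
     else sp_smult ((w gchoose Suc (nat d)) / 2 + lam * (w gchoose nat d)) (sp_couple (2 * nat d + 1) F c))"
proof -
  have W: "w - of_int d = 1 + w - of_int (d + 1)" "w - of_int d = 0 + w - of_int d"
    "w - of_int d = w + 1 - of_int (d + 1)" "w - of_int d = w + 0 - of_int d" by simp_all
  have gbw: "gb w d = (if d < 0 then 0 else w gchoose nat d)"
    "gb w (d + 1) = (if d < -1 then 0 else if d = -1 then 1 else w gchoose Suc (nat d))"
    by (simp_all add: gb_def nat_add_distrib)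
  obtain f g a b where Fc: "F = (f, g)" "c = (a, b)" by (cases F, cases c)
  have "d < -1 \<or> d = -1 \<or> d \<ge> 0" by linarith
  then show ?thesis
    unfolding L_act_single coef_at_pt_comp_dx[OF W(1)] coef_at_pt_comp_dx[OF W(2)]
      coef_at_pt_comp_Dbar[OF W(3)] coef_at_pt_comp_Dbar[OF W(4)]
      coef_at_pt_comp_Dbar_Dbar[OF W(2)] coef_at_pt_comp_Dbar_Dbar[OF W(4)] gbw
    by (elim disjE exE)
       (auto simp: Let_def gb_1 gb_0 nat_add_distrib Fc sp_eval cpoly_eq_iff field_simps)
qed

lemma coef_at_L_act_Dbar_Dbar:
  "coef_at (w - of_int d) True (L_act lam mu F [(c, w, True)]) =
    (if d < 0 then 0 else if d = 0 then sp_density (mu - lam - w - 1/2) F c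
     else sp_smult (- (w gchoose Suc (nat d)) - (lam + 1/2) * (w gchoose nat d)) (sp_couple (2 * nat d) F c))"
proof -
  have W: "w - of_int d = 1 + w - of_int (d + 1)" "w - of_int d = 0 + w - of_int d"
    "w - of_int d = w + 1 - of_int (d + 1)" "w - of_int d = w + 0 - of_int d" by simp_all
  have gbw: "gb w d = (if d < 0 then 0 else w gchoose nat d)"
    "gb w (d + 1) = (if d < -1 then 0 else if d = -1 then 1 else w gchoose Suc (nat d))"
    by (simp_all add: gb_def nat_add_distrib)
  obtain f g a b where Fc: "F = (f, g)" "c = (a, b)" by (cases F, cases c)
  have "d < -1 \<or> d = -1 \<or> d = 0 \<or> d > 0" by linarith
  then show ?thesis
    unfolding L_act_single coef_at_pt_comp_dx[OF W(1)] coef_at_pt_comp_dx[OF W(2)]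
      coef_at_pt_comp_Dbar[OF W(3)] coef_at_pt_comp_Dbar[OF W(4)]
      coef_at_pt_comp_Dbar_Dbar[OF W(2)] coef_at_pt_comp_Dbar_Dbar[OF W(4)] gbw
    by (elim disjE exE)
       (auto simp: Let_def gb_1 gb_0 nat_add_distrib Fc sp_eval cpoly_eq_iff field_simps)
qed

text \<open>For parity 0 the operator \<open>Dbar^(2k - j)\<close> is a phase times
  \<open>d_x^(k - ceil(j/2)) Dbar^(j mod 2)\<close>. The family of order \<open>k - 1/2\<close> and
  parity 1 has the same exponents with \<open>j\<close> shifted by 1, so one indexing by vertices
  serves both parities.\<close>

definition vertex_exp :: "complex \<Rightarrow> nat \<Rightarrow> complex" where
  "vertex_exp k j = k - of_nat ((j + 1) div 2)"

definition vertex_phase :: "complex \<Rightarrow> nat \<Rightarrow> complex" where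
  "vertex_phase k j = exp (\<i> * of_real pi * vertex_exp k j)"

text \<open>The sign \<open>(-1) ^ m\<close> is what the quotient of the phases at \<open>j\<close>
  and \<open>i\<close> leaves after it is combined with the signs of the four coefficient
  formulas.\<close>

definition sq_coef :: "complex \<Rightarrow> complex \<Rightarrow> nat \<Rightarrow> nat \<Rightarrow> complex" where
  "sq_coef lam k i j = (let m = (i - j) div 2; w = vertex_exp k j in (-1) ^ m *
    (if even (i - j) then - (w gchoose Suc m) - (if even j then lam else lam + 1/2) * (w gchoose m)
     else (w gchoose Suc m) / 2 + (if even j then 0 else lam) * (w gchoose m)))"

definition sq_ker :: "complex \<Rightarrow> complex \<Rightarrow> complex \<Rightarrow> nat \<Rightarrow> nat \<Rightarrow> spoly \<Rightarrow> spoly \<Rightarrow> spoly" where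
  "sq_ker lam mu n i j F v =
    (if i < j then 0 else if i = j then sp_density (n + of_nat j / 2) F v
     else sp_smult (sq_coef lam (mu - lam - n) i j) (sp_couple (i - j) F v))"

lemma Dbar_sym_vertex:
  "Dbar_sym (2 * k - of_nat j) (odd j) = (vertex_phase k j, vertex_exp k j, odd j)"
  "Dbar_sym (2 * (k - 1/2) - of_nat j) (even j) = (vertex_phase k (Suc j), vertex_exp k (Suc j), even j)"
proof -
  have "(2 * k - of_nat j - 1) / 2 = vertex_exp k j" if "odd j"
    using that by (auto simp: vertex_exp_def field_simps elim!: oddE)
  moreover have "(2 * k - of_nat j) / 2 = vertex_exp k j" if "even j"
    using that by (auto simp: vertex_exp_def field_simps elim!: evenE)
  moreover have "(2 * (k - 1/2) - of_nat j - 1) / 2 = vertex_exp k (Suc j)" if "even j"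
    using that by (auto simp: vertex_exp_def field_simps elim!: evenE)
  moreover have "(2 * (k - 1/2) - of_nat j) / 2 = vertex_exp k (Suc j)" if "odd j"
    using that by (auto simp: vertex_exp_def field_simps elim!: oddE)
  ultimately show "Dbar_sym (2 * k - of_nat j) (odd j) = (vertex_phase k j, vertex_exp k j, odd j)"
    "Dbar_sym (2 * (k - 1/2) - of_nat j) (even j) = (vertex_phase k (Suc j), vertex_exp k (Suc j), even j)"
    unfolding Dbar_sym_def vertex_phase_def times_divide_eq_right[symmetric] by auto
qed

lemma vertex_phase_eq: "vertex_phase k j = exp (\<i> * of_real pi * k) * (-1) ^ ((j + 1) div 2)"
  by (simp add: vertex_phase_def vertex_exp_def ring_distribs exp_diff exp_of_nat2_mult mult.commute[of _ "of_nat _"]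
      exp_of_nat_mult power_divide divide_inverse flip: power_inverse)

lemma sp_couple_smult: "sp_couple N F (sp_smult c v) = sp_smult c (sp_couple N F v)"
  by (cases F; cases v) (simp add: sp_couple_def sp_smult_def Let_def smult_add_right smult_diff_right)
lemma sp_density_smult: "sp_density \<nu> F (sp_smult c v) = sp_smult c (sp_density \<nu> F v)"
  by (cases F; cases v) (simp add: sp_density_def sp_smult_def pderiv_smult smult_add_right mult.commute)

text \<open>The phases of source and target differ by the sign \<open>(-1) ^ d\<close> alone. The
  factor \<open>exp (i pi k)\<close> cancels, which leaves a kernel that is polynomial in
  \<open>k\<close>.\<close>

lemma coef_at_L_act_vertex:
  "sp_smult (inverse (vertex_phase k i)) (coef_at (vertex_exp k i) (odd i)
      (L_act lam mu F [(sp_smult (vertex_phase k j) v, vertex_exp k j, odd j)]))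
    = sq_ker lam mu (mu - lam - k) i j F v"
proof -
  define d where "d = int ((i + 1) div 2) - int ((j + 1) div 2)"
  have e: "vertex_exp k i = vertex_exp k j - of_int d"
    by (simp add: vertex_exp_def d_def)
  define P where "P = exp (\<i> * of_real pi * k)"
  have P: "vertex_phase k (2 * h) = P * (-1) ^ h" "vertex_phase k (2 * h + 1) = - (P * (-1) ^ h)" "P \<noteq> 0" for h
    by (simp_all add: vertex_phase_eq P_def)
  have dv: "x / (-1) ^ m = (-1) ^ m * x" "x / (2 * (-1) ^ m) = (-1) ^ m * x / 2" for x :: complex and m
    by (simp_all add: minus_one_power_iff)
  have P': "vertex_phase k (Suc (Suc (m * 2 + h * 2))) = - (P * (-1) ^ m * (-1) ^ h)"
    "vertex_phase k (Suc (m * 2 + h * 2)) = - (P * (-1) ^ m * (-1) ^ h)"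
    "vertex_phase k (m * 2 + h * 2) = P * (-1) ^ m * (-1) ^ h"
    "vertex_phase k (Suc (Suc (Suc (m * 2 + h * 2)))) = P * (-1) ^ m * (-1) ^ h" for h m
    using P(1)[of "Suc (m + h)"] P(2)[of "m + h"] P(2)[of "Suc (m + h)"] P(1)[of "m + h"] by (simp_all add: power_add algebra_simps)
  have nu: "vertex_exp k (2 * h) = k - of_nat h" "vertex_exp k (2 * h + 1) = k - of_nat h - 1"
     "vertex_exp k (h * 2) = k - of_nat h" "vertex_exp k (Suc (h * 2)) = k - of_nat h - 1" for h
    by (simp_all add: vertex_exp_def)
  show ?thesis
  proof (cases "even j"; cases "even i")
    assume par: "even j" "even i"
    then obtain h h' where hh: "j = 2 * h" "i = 2 * h'" by (elim evenE)
    then have d: "d = int h' - int h" by (simp add: d_def)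
    have c: "coef_at (vertex_exp k i) False (L_act lam mu F [(sp_smult p v, vertex_exp k j, False)]) = 
      coef_at (vertex_exp k j - of_int d) False (L_act lam mu F [(sp_smult p v, vertex_exp k j, False)])" for p
      by (simp only: e)
    have lin: "coef_at (vertex_exp k j - of_int d) False (L_act lam mu F [(sp_smult p v, vertex_exp k j, False)])
      = sp_smult p (coef_at (vertex_exp k j - of_int d) False (L_act lam mu F [(v, vertex_exp k j, False)]))" for p
      by (simp add: coef_at_L_act_dx_dx sp_couple_smult sp_density_smult mult.commute)
    have "h' < h \<or> h' = h \<or> (\<exists>m. h' = h + Suc m)"
      by (metis less_imp_Suc_add linorder_cases add_Suc_right)
    moreover have "sp_smult (inverse (vertex_phase k i)) (coef_at (vertex_exp k i) False
      (L_act lam mu F [(sp_smult (vertex_phase k j) v, vertex_exp k j, False)]))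
      = sq_ker lam mu (mu - lam - k) i j F v"
      unfolding c lin sp_smult_smult unfolding coef_at_L_act_dx_dx using calculation
      by (elim disjE exE)
         (simp_all add: sq_ker_def sq_coef_def d hh Let_def P P[simplified]
            nat_add_distrib Suc_double_not_eq_double,
          simp_all add: field_simps power_add nu P P[simplified] P',
          (simp add: dv algebra_simps)?)
    ultimately show ?thesis using par by simp
  next
    assume par: "even j" "odd i"
    then obtain h h' where hh: "j = 2 * h" "i = 2 * h' + 1" by (elim evenE oddE)
    then have d: "d = int h' + 1 - int h" by (simp add: d_def)
    have c: "coef_at (vertex_exp k i) True (L_act lam mu F [(sp_smult p v, vertex_exp k j, False)]) = 
      coef_at (vertex_exp k j - of_int d) True (L_act lam mu F [(sp_smult p v, vertex_exp k j, False)])" for p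
      by (simp only: e)
    have lin: "coef_at (vertex_exp k j - of_int d) True (L_act lam mu F [(sp_smult p v, vertex_exp k j, False)])
      = sp_smult p (coef_at (vertex_exp k j - of_int d) True (L_act lam mu F [(v, vertex_exp k j, False)]))" for p
      by (simp add: coef_at_L_act_dx_Dbar sp_couple_smult sp_density_smult mult.commute)
    have "h' < h \<or> (\<exists>m. h' = h + m)"
      by (metis le_iff_add not_le)
    moreover have "sp_smult (inverse (vertex_phase k i)) (coef_at (vertex_exp k i) True
      (L_act lam mu F [(sp_smult (vertex_phase k j) v, vertex_exp k j, False)]))
      = sq_ker lam mu (mu - lam - k) i j F v"
      unfolding c lin sp_smult_smult unfolding coef_at_L_act_dx_Dbar using calculation
      by (elim disjE exE)
         (simp_all add: sq_ker_def sq_coef_def d hh Let_def P P[simplified]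
            nat_add_distrib Suc_double_not_eq_double,
          simp_all add: field_simps power_add nu P P[simplified] P',
          (simp add: dv algebra_simps)?)
    ultimately show ?thesis using par by simp
  next
    assume par: "odd j" "even i"
    then obtain h h' where hh: "j = 2 * h + 1" "i = 2 * h'" by (elim evenE oddE)
    then have d: "d = int h' - (int h + 1)" by (simp add: d_def)
    have c: "coef_at (vertex_exp k i) False (L_act lam mu F [(sp_smult p v, vertex_exp k j, True)]) = 
      coef_at (vertex_exp k j - of_int d) False (L_act lam mu F [(sp_smult p v, vertex_exp k j, True)])" for p
      by (simp only: e)
    have lin: "coef_at (vertex_exp k j - of_int d) False (L_act lam mu F [(sp_smult p v, vertex_exp k j, True)])
      = sp_smult p (coef_at (vertex_exp k j - of_int d) False (L_act lam mu F [(v, vertex_exp k j, True)]))" for p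
      by (simp add: coef_at_L_act_Dbar_dx sp_couple_smult sp_density_smult mult.commute)
    have "h' < Suc h \<or> (\<exists>m. h' = Suc h + m)"
      by (metis le_iff_add not_le)
    moreover have "sp_smult (inverse (vertex_phase k i)) (coef_at (vertex_exp k i) False
      (L_act lam mu F [(sp_smult (vertex_phase k j) v, vertex_exp k j, True)]))
      = sq_ker lam mu (mu - lam - k) i j F v"
      unfolding c lin sp_smult_smult unfolding coef_at_L_act_Dbar_dx using calculation
      by (elim disjE exE)
         (simp_all add: sq_ker_def sq_coef_def d hh Let_def P P[simplified]
            nat_add_distrib Suc_double_not_eq_double,
          simp_all add: field_simps power_add nu P P[simplified] P',
          (simp add: dv algebra_simps)?)
    ultimately show ?thesis using par by simp
  next
    assume par: "odd j" "odd i"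
    then obtain h h' where hh: "j = 2 * h + 1" "i = 2 * h' + 1" by (elim oddE)
    then have d: "d = int h' - int h" by (simp add: d_def)
    have c: "coef_at (vertex_exp k i) True (L_act lam mu F [(sp_smult p v, vertex_exp k j, True)]) = 
      coef_at (vertex_exp k j - of_int d) True (L_act lam mu F [(sp_smult p v, vertex_exp k j, True)])" for p
      by (simp only: e)
    have lin: "coef_at (vertex_exp k j - of_int d) True (L_act lam mu F [(sp_smult p v, vertex_exp k j, True)])
      = sp_smult p (coef_at (vertex_exp k j - of_int d) True (L_act lam mu F [(v, vertex_exp k j, True)]))" for p
      by (simp add: coef_at_L_act_Dbar_Dbar sp_couple_smult sp_density_smult mult.commute)
    have "h' < h \<or> h' = h \<or> (\<exists>m. h' = h + Suc m)"
      by (metis less_imp_Suc_add linorder_cases add_Suc_right)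
    moreover have "sp_smult (inverse (vertex_phase k i)) (coef_at (vertex_exp k i) True
      (L_act lam mu F [(sp_smult (vertex_phase k j) v, vertex_exp k j, True)]))
      = sq_ker lam mu (mu - lam - k) i j F v"
      unfolding c lin sp_smult_smult unfolding coef_at_L_act_Dbar_Dbar using calculation
      by (elim disjE exE)
         (simp_all add: sq_ker_def sq_coef_def d hh Let_def P P[simplified]
            nat_add_distrib Suc_double_not_eq_double,
          simp_all add: field_simps power_add nu P P[simplified] P',
          (simp add: dv algebra_simps)?)
    ultimately show ?thesis using par by simp
  qed
qed

lemma SQ_act_even:
  "SQ_act lam mu k False l F T =
    (\<lambda>i. if i < l then \<Sum>j<l. sq_ker lam mu (mu - lam - k) i j F (T j) else 0)"
  by (simp add: SQ_act_def psi_coeff_eq psi_ops_def Dbar_sym_vertex coef_at_L_act_map sp_smult_sum_list sp_smult_sum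
      o_def coef_at_L_act_vertex sp_zero_eq sum_list_distinct_conv_sum_set lessThan_atLeast0 cong: if_cong)

lemma SQ_act_odd:
  "SQ_act lam mu (k - 1/2) True l F T =
    (\<lambda>i. if i < l then \<Sum>j<l. sq_ker lam mu (mu - lam - k) (Suc i) (Suc j) F (T j) else 0)"
  by (simp add: SQ_act_def psi_coeff_eq psi_ops_def Dbar_sym_vertex(2)[simplified] coef_at_L_act_map sp_smult_sum_list sp_smult_sum
      o_def coef_at_L_act_vertex[of k "Suc i" for i, simplified] coef_at_L_act_vertex[of _ "Suc _" lam mu F "Suc _", simplified]
      sp_zero_eq sum_list_distinct_conv_sum_set lessThan_atLeast0 cong: if_cong)

section \<open>Triangular kernels\<close>

lemma sp_D_add: "sp_D (F + G) = sp_D F + sp_D G"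
  by (simp add: sp_D_def pderiv_add)
lemma sp_D_0 [simp]: "sp_D 0 = 0"
  by (simp add: sp_D_def zero_prod_def)
lemma sp_D_smult: "sp_D (sp_smult c F) = sp_smult c (sp_D F)"
  by (simp add: sp_D_def sp_smult_def pderiv_smult)
lemma sp_D_sum: "sp_D (\<Sum>x\<in>A. f x) = (\<Sum>x\<in>A. sp_D (f x))"
  by (induction A rule: infinite_finite_induct) (simp_all add: sp_D_add)

definition sp_linear :: "(spoly \<Rightarrow> spoly) \<Rightarrow> bool" where
  "sp_linear f \<longleftrightarrow> (\<forall>u v. f (u + v) = f u + f v) \<and> (\<forall>c v. f (sp_smult c v) = sp_smult c (f v))"

lemma sp_smult_zero_left [simp]: "sp_smult 0 v = 0"
  by (simp add: sp_smult_def zero_prod_def)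

lemma sp_linearD: "sp_linear f \<Longrightarrow> f (u + v) = f u + f v" "sp_linear f \<Longrightarrow> f (sp_smult c v) = sp_smult c (f v)"
  unfolding sp_linear_def by blast+

lemma sp_linear_0: "sp_linear f \<Longrightarrow> f 0 = 0"
  unfolding sp_linear_def by (metis sp_smult_zero_left)
lemma sp_linear_sum: "sp_linear f \<Longrightarrow> f (\<Sum>x\<in>A. g x) = (\<Sum>x\<in>A. f (g x))"
  by (induction A rule: infinite_finite_induct) (simp_all add: sp_linear_0 sp_linearD)

lemma sp_linear_funpow_D: "sp_linear (sp_D ^^ m)"
  by (induction m) (simp_all add: sp_linear_def sp_D_add sp_D_smult)
lemma sp_linear_density: "sp_linear (sp_density \<nu> F)"
  unfolding sp_linear_def sp_density_smult
  by (cases F) (auto simp: sp_density_def pderiv_add algebra_simps smult_add_right)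
lemma sp_linear_couple: "sp_linear (sp_couple N F)"
  unfolding sp_linear_def sp_couple_smult
  by (cases F) (auto simp: sp_couple_def Let_def algebra_simps)
lemma sp_linear_smult: "sp_linear f \<Longrightarrow> sp_linear (\<lambda>v. sp_smult c (f v))"
  by (simp add: sp_linear_def sp_smult_add mult.commute)
lemma sp_linear_zero: "sp_linear (\<lambda>v. 0)"
  by (simp add: sp_linear_def)
type_synonym kernel = "nat \<Rightarrow> nat \<Rightarrow> spoly \<Rightarrow> spoly"

definition triangular :: "kernel \<Rightarrow> bool" where
  "triangular K \<longleftrightarrow> (\<forall>i j. sp_linear (K i j)) \<and> (\<forall>i j v. i < j \<longrightarrow> K i j v = 0)"

lemma triangularD: "triangular K \<Longrightarrow> sp_linear (K i j)" "triangular K \<Longrightarrow> i < j \<Longrightarrow> K i j v = 0"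
  unfolding triangular_def by blast+

definition ker_act :: "kernel \<Rightarrow> (nat \<Rightarrow> spoly) \<Rightarrow> nat \<Rightarrow> spoly" where
  "ker_act K T i = (if i < 7 then \<Sum>j<7. K i j (T j) else 0)"

text \<open>\<open>r = 0\<close> is the whole subquotient of length 7. \<open>r = 1\<close> drops
  the leading symbol and carries the subquotient of length 6 and parity 1 of condition (ii).\<close>

definition tail_space :: "nat \<Rightarrow> (nat \<Rightarrow> spoly) set" where
  "tail_space r = {T. \<forall>j. j < r \<or> 7 \<le> j \<longrightarrow> T j = 0}"

definition linear_on :: "nat \<Rightarrow> ((nat \<Rightarrow> spoly) \<Rightarrow> nat \<Rightarrow> spoly) \<Rightarrow> bool" where
  "linear_on r \<Phi> \<longleftrightarrow>
     (\<forall>T\<in>tail_space r. \<forall>U\<in>tail_space r. \<Phi> (\<lambda>j. T j + U j) = (\<lambda>j. \<Phi> T j + \<Phi> U j)) \<and>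
     (\<forall>c. \<forall>T\<in>tail_space r. \<Phi> (\<lambda>j. sp_smult c (T j)) = (\<lambda>j. sp_smult c (\<Phi> T j)))"

lemma tail_space_add: "T \<in> tail_space r \<Longrightarrow> U \<in> tail_space r \<Longrightarrow> (\<lambda>j. T j + U j) \<in> tail_space r"
  by (simp add: tail_space_def)
lemma tail_space_smult: "T \<in> tail_space r \<Longrightarrow> (\<lambda>j. sp_smult c (T j)) \<in> tail_space r"
  by (simp add: tail_space_def)
lemma tail_space_D: "T \<in> tail_space r \<Longrightarrow> (\<lambda>j. sp_D (T j)) \<in> tail_space r"
  by (simp add: tail_space_def)

lemma ker_act_tail_space:
  assumes "triangular K" "T \<in> tail_space r"
  shows "ker_act K T \<in> tail_space r"
proof -
  have "K i j (T j) = 0" if "i < r" for i j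
    using assms(2) that triangularD[OF assms(1)] by (cases "i < j") (auto simp: tail_space_def sp_linear_0)
  then show ?thesis by (simp add: tail_space_def ker_act_def)
qed

lemma ker_act_linear: "triangular K \<Longrightarrow> linear_on r (ker_act K)"
  by (auto simp: linear_on_def ker_act_def fun_eq_iff sp_linearD triangularD(1) sum.distrib sp_smult_sum)

lemma ker_act_compose:
  assumes "triangular K"
  shows "ker_act K (ker_act L T) = ker_act (\<lambda>i j v. \<Sum>m<7. K i m (L m j v)) T"
proof
  fix i
  have "(\<Sum>m<7. K i m (ker_act L T m)) = (\<Sum>m<7. \<Sum>j<7. K i m (L m j (T j)))"
    using assms by (intro sum.cong) (simp_all add: ker_act_def triangular_def sp_linear_sum)
  also have "\<dots> = (\<Sum>j<7. \<Sum>m<7. K i m (L m j (T j)))" by (rule sum.swap)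
  finally show "ker_act K (ker_act L T) i = ker_act (\<lambda>i j v. \<Sum>m<7. K i m (L m j v)) T i"
    by (simp add: ker_act_def)
qed

text \<open>Forward substitution: with identities on the diagonal, each component of a preimage is
  determined by those of smaller index.\<close>

lemma ker_act_unitriangular_bij:
  assumes tri: "triangular K" and unit: "\<And>i v. K i i v = v"
  shows "bij_betw (ker_act K) (tail_space r) (tail_space r)"
proof -
  have split: "ker_act K T i = T i + (\<Sum>j<i. K i j (T j))" if "i < 7" for T i
  proof -
    have "(\<Sum>j<7. K i j (T j)) = (\<Sum>j<Suc i. K i j (T j))"
      using that tri by (intro sum.mono_neutral_right) (auto simp: triangularD(2))
    then show ?thesis using that by (simp add: ker_act_def unit add.commute)
  qed
  have "T = U" if TU: "T \<in> tail_space r" "U \<in> tail_space r" "ker_act K T = ker_act K U" for T U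
  proof
    fix i
    show "T i = U i"
    proof (induction i rule: less_induct)
      case (less i)
      have "(\<Sum>j<i. K i j (T j)) = (\<Sum>j<i. K i j (U j))" by (simp add: less)
      with TU split[of i T] split[of i U] show ?case
        by (cases "i < 7") (simp_all add: tail_space_def)
    qed
  qed
  then have inj: "inj_on (ker_act K) (tail_space r)" by (auto intro: inj_onI)
  have "\<exists>T\<in>tail_space r. ker_act K T = U" if U: "U \<in> tail_space r" for U
  proof -
    have "\<exists>T\<in>tail_space r. \<forall>i<m. ker_act K T i = U i" if "m \<le> 7" for m
      using that
    proof (induction m)
      case (Suc m)
      then obtain T where T: "T \<in> tail_space r" "\<And>i. i < m \<Longrightarrow> ker_act K T i = U i" by auto
      \<comment> \<open>Correcting entry \<open>m\<close> does not disturb the equations with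
        smaller index, since the kernel is triangular.\<close>
      define T' where "T' = T(m := U m - (\<Sum>j<m. K m j (T j)))"
      have "K m j (T j) = 0" if "m < r" "j < m" for j
        using that T sp_linear_0[OF triangularD(1)[OF tri]] by (auto simp: tail_space_def)
      then have "T' \<in> tail_space r" using T(1) U Suc.prems by (auto simp: T'_def tail_space_def)
      moreover have "ker_act K T' i = U i" if "i < Suc m" for i
      proof (cases "i = m")
        case True
        then show ?thesis using Suc.prems by (simp add: split T'_def)
      next
        case False
        then have "ker_act K T' i = ker_act K T i" using that Suc.prems by (simp add: split T'_def)
        then show ?thesis using False that T(2) by simp
      qed
      ultimately show ?case by blast
    qed (auto simp: tail_space_def intro: bexI[of _ "\<lambda>_. 0"])
    from this[of 7] obtain T where T: "T \<in> tail_space r" "\<And>i. i < 7 \<Longrightarrow> ker_act K T i = U i" by auto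
    moreover have "ker_act K T i = U i" if "i \<ge> 7" for i
      using that U by (simp add: ker_act_def tail_space_def)
    ultimately show ?thesis by (metis ext not_le)
  qed
  then have "tail_space r \<subseteq> ker_act K ` tail_space r" by blast
  moreover have "ker_act K ` tail_space r \<subseteq> tail_space r" using ker_act_tail_space[OF tri] by auto
  ultimately show ?thesis using inj by (auto simp: bij_betw_def)
qed

text \<open>Equivariance is asked for \<open>D\<close> and for the kernels of the odd fields. For
  \<open>sq_odd\<close> this is full equivariance by \<open>intertwines_iff_super\<close>, and the
  normal forms, which are defined for odd fields only, can be compared in the same terms.\<close>

definition intertwines :: "nat \<Rightarrow> (complex poly \<Rightarrow> kernel) \<Rightarrow> (complex poly \<Rightarrow> kernel)
    \<Rightarrow> ((nat \<Rightarrow> spoly) \<Rightarrow> nat \<Rightarrow> spoly) \<Rightarrow> bool" where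
  "intertwines r K K' \<Phi> \<longleftrightarrow> linear_on r \<Phi> \<and> bij_betw \<Phi> (tail_space r) (tail_space r) \<and>
     (\<forall>T\<in>tail_space r. \<Phi> (\<lambda>j. sp_D (T j)) = (\<lambda>j. sp_D (\<Phi> T j)) \<and>
        (\<forall>g. \<Phi> (ker_act (K g) T) = ker_act (K' g) (\<Phi> T)))"

lemma intertwines_comp:
  assumes "intertwines r K K' \<Phi>" "intertwines r K' K'' \<Psi>"
  shows "intertwines r K K'' (\<Psi> \<circ> \<Phi>)"
proof -
  have *: "\<Phi> T \<in> tail_space r" if "T \<in> tail_space r" for T
    using assms that by (auto simp: intertwines_def bij_betw_def)
  with assms show ?thesis
    by (auto simp: intertwines_def linear_on_def intro: bij_betw_trans)
qed

lemma intertwines_inv: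
  assumes \<Phi>: "intertwines r K K' \<Phi>" and tri: "\<And>g. triangular (K g)"
  shows "intertwines r K' K (inv_into (tail_space r) \<Phi>)"
proof -
  let ?V = "tail_space r" and ?\<Psi> = "inv_into (tail_space r) \<Phi>"
  have bij: "bij_betw \<Phi> ?V ?V" using \<Phi> by (simp add: intertwines_def)
  have \<Psi>: "?\<Psi> T \<in> ?V" "\<Phi> (?\<Psi> T) = T" if "T \<in> ?V" for T
    using that bij by (simp_all add: bij_betw_def inv_into_into f_inv_into_f)
  have eq: "?\<Psi> T = S" if "S \<in> ?V" "\<Phi> S = T" for S T
    using that bij by (auto simp: bij_betw_def)
  note sp = tail_space_add tail_space_smult tail_space_D ker_act_tail_space[OF tri] \<Psi>
  show ?thesis
    unfolding intertwines_def linear_on_def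
  proof (intro conjI ballI allI)
    show "bij_betw ?\<Psi> ?V ?V" by (rule bij_betw_inv_into[OF bij])
  qed (rule eq; use \<Phi> in \<open>simp add: sp intertwines_def linear_on_def\<close>)+
qed

section \<open>Reduction to odd fields\<close>

definition sq_odd :: "complex \<Rightarrow> complex \<Rightarrow> complex \<Rightarrow> complex poly \<Rightarrow> kernel" where
  "sq_odd lam mu n g i j = sq_ker lam mu n i j (0, g)"

lemma triangular_sq_odd: "triangular (sq_odd lam mu n g)"
proof -
  have "sp_linear (sq_odd lam mu n g i j)" for i j
    unfolding sq_odd_def sq_ker_def
    by (cases "i < j"; cases "i = j")
      (simp_all add: sp_linear_zero sp_linear_density sp_linear_couple sp_linear_smult)
  then show ?thesis by (auto simp: triangular_def sq_odd_def sq_ker_def)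
qed

text \<open>An even contact field is a bracket of two odd ones: \<open>f\<close> acts as the
  anticommutator of \<open>D\<close>, which is the action of \<open>2 xi\<close>, with the action of
  \<open>xi f\<close>.\<close>

definition super_act :: "(complex poly \<Rightarrow> kernel) \<Rightarrow> spoly \<Rightarrow> (nat \<Rightarrow> spoly) \<Rightarrow> nat \<Rightarrow> spoly" where
  "super_act K F T i = sp_D (ker_act (K (fst F)) T i) + ker_act (K (fst F)) (\<lambda>j. sp_D (T j)) i
     + ker_act (K (snd F)) T i"

text \<open>For the couplings this is the Leibniz rule for the odd derivation \<open>D\<close> with
  \<open>f = D (xi f)\<close>: the second summand cancels the terms in which \<open>D\<close> hits
  \<open>v\<close>.\<close>

lemma sq_ker_super:
  "sq_ker lam mu n i j F v = sp_D (sq_odd lam mu n (fst F) i j v) + sq_odd lam mu n (fst F) i j (sp_D v)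
     + sq_odd lam mu n (snd F) i j v"
proof -
  obtain f g a b where eq: "F = (f, g)" "v = (a, b)" by (cases F, cases v)
  have "sp_density \<nu> F v = sp_D (sp_density \<nu> (0, f) v) + sp_density \<nu> (0, f) (sp_D v) + sp_density \<nu> (0, g) v" for \<nu>
    by (simp add: eq sp_density_def sp_D_def cpoly_eq_iff pderiv_add pderiv_smult pderiv_mult field_simps)
  moreover have "sp_couple N F v = sp_D (sp_couple N (0, f) v) + sp_couple N (0, f) (sp_D v) + sp_couple N (0, g) v" for N
    by (simp add: eq sp_couple_def sp_D_def Let_def cpoly_eq_iff pderiv_add pderiv_mult pderiv_minus field_simps)
  ultimately show ?thesis
    by (simp add: sq_odd_def sq_ker_def eq sp_D_smult sp_smult_add)
qed

lemma SQ_act_super: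
  "SQ_act lam mu (mu - lam - n) False 7 F T = super_act (sq_odd lam mu n) F T"
  by (auto simp: SQ_act_even super_act_def ker_act_def fun_eq_iff sp_D_sum sum.distrib[symmetric]
      sq_ker_super[of lam mu n _ _ F])

lemma SQ_equiv_even_iff_super:
  "SQ_equiv lam mu (mu - lam - n) False lam' mu' (mu' - lam' - n) False 7 \<longleftrightarrow>
    (\<exists>\<Phi>. linear_on 0 \<Phi> \<and> bij_betw \<Phi> (tail_space 0) (tail_space 0) \<and>
      (\<forall>F. \<forall>T\<in>tail_space 0. \<Phi> (super_act (sq_odd lam mu n) F T) = super_act (sq_odd lam' mu' n) F (\<Phi> T)))"
proof -
  have "SQ_space 7 = tail_space 0" by (simp add: SQ_space_def tail_space_def sp_zero_eq)
  moreover have "SQ_linear 7 \<Phi> = linear_on 0 \<Phi>" for \<Phi>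
    unfolding SQ_linear_def linear_on_def calculation sp_add_eq by blast
  ultimately show ?thesis by (simp add: SQ_equiv_def SQ_act_super)
qed

definition raise_family :: "(nat \<Rightarrow> spoly) \<Rightarrow> nat \<Rightarrow> spoly" where
  "raise_family T j = (case j of 0 \<Rightarrow> 0 | Suc j \<Rightarrow> T j)"

definition lower_family :: "(nat \<Rightarrow> spoly) \<Rightarrow> nat \<Rightarrow> spoly" where
  "lower_family T j = T (Suc j)"

lemma lower_raise [simp]: "lower_family (raise_family T) = T"
  by (simp add: lower_family_def raise_family_def fun_eq_iff)
lemma raise_lower [simp]: "T \<in> tail_space 1 \<Longrightarrow> raise_family (lower_family T) = T"
  by (auto simp: lower_family_def raise_family_def tail_space_def fun_eq_iff split: nat.splits)

lemma raise_family_mem: "T \<in> SQ_space 6 \<Longrightarrow> raise_family T \<in> tail_space 1"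
  by (auto simp: SQ_space_def tail_space_def raise_family_def sp_zero_eq split: nat.splits)
lemma lower_family_mem: "T \<in> tail_space 1 \<Longrightarrow> lower_family T \<in> SQ_space 6"
  by (auto simp: SQ_space_def tail_space_def lower_family_def sp_zero_eq)

text \<open>Families with vanishing leading symbol form a submodule, and the shift of the index
  identifies it with the subquotient of opposite parity and order lower by 1/2.\<close>

lemma SQ_act_lower:
  "SQ_act lam mu (mu - lam - n - 1/2) True 6 F T =
     lower_family (super_act (sq_odd lam mu n) F (raise_family T))"
proof -
  have "{..<7} = insert 0 (Suc ` {..<6})" by (simp flip: lessThan_Suc_eq_insert_0)
  then have sum7: "sum h {..<7} = h 0 + (\<Sum>j<6. h (Suc j))" for h :: "nat \<Rightarrow> spoly"
    by (simp add: sum.reindex)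
  have K0: "sq_ker lam mu n i 0 F 0 = 0" for i
    by (simp add: sq_ker_super sp_linear_0[OF triangularD(1)[OF triangular_sq_odd]])
  have "super_act (sq_odd lam mu n) F U i = (if i < 7 then \<Sum>j<7. sq_ker lam mu n i j F (U j) else 0)" for U i
    by (simp add: SQ_act_super[symmetric] SQ_act_even)
  then show ?thesis
    using SQ_act_odd[of lam mu "mu - lam - n" 6 F T]
    by (auto simp: lower_family_def raise_family_def sum7 K0 fun_eq_iff)
qed

lemma super_act_mem:
  assumes "\<And>g. triangular (K g)" "T \<in> tail_space r"
  shows "super_act K F T \<in> tail_space r"
  using ker_act_tail_space[OF assms(1) assms(2)] ker_act_tail_space[OF assms(1) tail_space_D[OF assms(2)]]
  by (simp add: super_act_def tail_space_def)

lemma raise_add: "raise_family (\<lambda>j. T j + U j) = (\<lambda>j. raise_family T j + raise_family U j)"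
  and raise_smult: "raise_family (\<lambda>j. sp_smult c (T j)) = (\<lambda>j. sp_smult c (raise_family T j))"
  by (auto simp: raise_family_def fun_eq_iff split: nat.splits)

lemma lower_add: "lower_family (\<lambda>j. T j + U j) = (\<lambda>j. lower_family T j + lower_family U j)"
  and lower_smult: "lower_family (\<lambda>j. sp_smult c (T j)) = (\<lambda>j. sp_smult c (lower_family T j))"
  by (auto simp: lower_family_def fun_eq_iff)

lemma SQ_space_closed:
  "T \<in> SQ_space l \<Longrightarrow> U \<in> SQ_space l \<Longrightarrow> (\<lambda>j. T j + U j) \<in> SQ_space l"
  "T \<in> SQ_space l \<Longrightarrow> (\<lambda>j. sp_smult c (T j)) \<in> SQ_space l"
  by (simp_all add: SQ_space_def sp_zero_eq)

lemma SQ_equiv_odd_iff_super: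
  "SQ_equiv lam mu (mu - lam - n - 1/2) True lam' mu' (mu' - lam' - n - 1/2) True 6 \<longleftrightarrow>
    (\<exists>\<Phi>. linear_on 1 \<Phi> \<and> bij_betw \<Phi> (tail_space 1) (tail_space 1) \<and>
      (\<forall>F. \<forall>T\<in>tail_space 1. \<Phi> (super_act (sq_odd lam mu n) F T) = super_act (sq_odd lam' mu' n) F (\<Phi> T)))"
    (is "?L \<longleftrightarrow> ?R")
proof
  have up: "bij_betw raise_family (SQ_space 6) (tail_space 1)"
    by (rule bij_betw_byWitness[of _ lower_family]) (auto intro: raise_family_mem lower_family_mem simp del: One_nat_def)
  have down: "bij_betw lower_family (tail_space 1) (SQ_space 6)"
    by (rule bij_betw_byWitness[of _ raise_family]) (auto intro: raise_family_mem lower_family_mem simp del: One_nat_def)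
  note mem = raise_family_mem lower_family_mem super_act_mem[OF triangular_sq_odd] tail_space_add tail_space_smult SQ_space_closed
  {
    assume ?L
    then obtain \<Phi> where \<Phi>: "SQ_linear 6 \<Phi>" "bij_betw \<Phi> (SQ_space 6) (SQ_space 6)"
      "\<And>F T. T \<in> SQ_space 6 \<Longrightarrow> \<Phi> (lower_family (super_act (sq_odd lam mu n) F (raise_family T)))
         = lower_family (super_act (sq_odd lam' mu' n) F (raise_family (\<Phi> T)))"
      unfolding SQ_equiv_def SQ_act_lower by blast
    have mem': "\<Phi> T \<in> SQ_space 6" if "T \<in> SQ_space 6" for T
      using \<Phi>(2) that by (auto simp: bij_betw_def)
    have "bij_betw (raise_family \<circ> \<Phi> \<circ> lower_family) (tail_space 1) (tail_space 1)"
      by (rule bij_betw_trans[OF down bij_betw_trans[OF \<Phi>(2) up]])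
    moreover have "linear_on 1 (raise_family \<circ> \<Phi> \<circ> lower_family)"
      using \<Phi>(1) by (simp add: linear_on_def SQ_linear_def sp_add_eq lower_add lower_smult mem raise_add raise_smult del: One_nat_def)
    moreover have "(raise_family \<circ> \<Phi> \<circ> lower_family) (super_act (sq_odd lam mu n) F T)
      = super_act (sq_odd lam' mu' n) F ((raise_family \<circ> \<Phi> \<circ> lower_family) T)" if "T \<in> tail_space 1" for F T
      using \<Phi>(3)[OF lower_family_mem[OF that]] that by (simp add: mem mem' del: One_nat_def)
    ultimately show ?R by blast
  }
  {
    assume ?R
    then obtain \<Phi> where \<Phi>: "linear_on 1 \<Phi>" "bij_betw \<Phi> (tail_space 1) (tail_space 1)"
      "\<And>F T. T \<in> tail_space 1 \<Longrightarrow> \<Phi> (super_act (sq_odd lam mu n) F T) = super_act (sq_odd lam' mu' n) F (\<Phi> T)"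
      by blast
    have mem': "\<Phi> T \<in> tail_space 1" if "T \<in> tail_space 1" for T
      using \<Phi>(2) that by (auto simp: bij_betw_def)
    have "bij_betw (lower_family \<circ> \<Phi> \<circ> raise_family) (SQ_space 6) (SQ_space 6)"
      by (rule bij_betw_trans[OF up bij_betw_trans[OF \<Phi>(2) down]])
    moreover have "SQ_linear 6 (lower_family \<circ> \<Phi> \<circ> raise_family)"
      using \<Phi>(1) by (simp add: linear_on_def SQ_linear_def sp_add_eq lower_add lower_smult mem raise_add raise_smult del: One_nat_def)
    moreover have "(lower_family \<circ> \<Phi> \<circ> raise_family) (SQ_act lam mu (mu - lam - n - 1/2) True 6 F T)
      = SQ_act lam' mu' (mu' - lam' - n - 1/2) True 6 F ((lower_family \<circ> \<Phi> \<circ> raise_family) T)" if "T \<in> SQ_space 6" for F T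
      unfolding SQ_act_lower using \<Phi>(3)[OF raise_family_mem[OF that]] that by (simp add: mem mem' del: One_nat_def)
    ultimately show ?L unfolding SQ_equiv_def by blast
  }
qed

text \<open>The factor 1/2 in \<open>X_F\<close> is the reason for the constant 2. The couplings
  vanish because each of them contains at least one derivative of \<open>g\<close>.\<close>

lemma sq_odd_const: "sq_odd lam mu n 0 i j v = 0"
  "sq_odd lam mu n [:2:] i j v = (if i = j then sp_D v else 0)"
proof -
  have "(pderiv ^^ Suc m) [:2:] = (0 :: complex poly)" for m by (induction m) (simp_all add: pderiv_pCons)
  then have "(pderiv ^^ m) (pderiv [:2:]) = (0 :: complex poly)" for m by (simp flip: funpow_swap1)
  then show "sq_odd lam mu n 0 i j v = 0" "sq_odd lam mu n [:2:] i j v = (if i = j then sp_D v else 0)"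
    by (cases v; simp add: sq_odd_def sq_ker_def sp_density_def sp_couple_def sp_D_def Let_def zero_prod_def
        funpow_swap1 pderiv_pCons sp_smult_def)+
qed

lemma super_act_const:
  "super_act (sq_odd lam mu n) (0, [:2:]) T = (\<lambda>i. if i < 7 then sp_D (T i) else 0)"
  "super_act (sq_odd lam mu n) (0, g) T = ker_act (sq_odd lam mu n g) T"
  by (auto simp: super_act_def ker_act_def sq_odd_const fun_eq_iff)

text \<open>Forwards, linearity distributes over the three summands of \<open>super_act\<close>;
  backwards, the fields \<open>2 xi\<close> and \<open>xi g\<close> are special cases.\<close>

lemma intertwines_iff_super:
  "intertwines r (sq_odd lam mu n) (sq_odd lam' mu' n) \<Phi> \<longleftrightarrow>
    linear_on r \<Phi> \<and> bij_betw \<Phi> (tail_space r) (tail_space r) \<and>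
      (\<forall>F. \<forall>T\<in>tail_space r. \<Phi> (super_act (sq_odd lam mu n) F T) = super_act (sq_odd lam' mu' n) F (\<Phi> T))"
    (is "?L \<longleftrightarrow> ?R")
proof
  note mem = tail_space_add tail_space_D ker_act_tail_space[OF triangular_sq_odd]
  have D: "super_act (sq_odd lam mu n) (0, [:2:]) T = (\<lambda>i. sp_D (T i))" if "T \<in> tail_space r" for T lam mu
    unfolding super_act_const(1) using that by (auto simp: tail_space_def fun_eq_iff)
  {
    assume L: ?L
    then have \<Phi>: "\<Phi> T \<in> tail_space r" if "T \<in> tail_space r" for T
      using that by (auto simp: intertwines_def bij_betw_def)
    have lin: "\<Phi> (\<lambda>j. T j + U j) = (\<lambda>j. \<Phi> T j + \<Phi> U j)" if "T \<in> tail_space r" "U \<in> tail_space r" for T U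
      using that L by (simp add: intertwines_def linear_on_def)
    have "\<Phi> (super_act (sq_odd lam mu n) F T) = super_act (sq_odd lam' mu' n) F (\<Phi> T)" if T: "T \<in> tail_space r" for F T
    proof -
      have "\<Phi> (super_act (sq_odd lam mu n) F T) = (\<lambda>i. \<Phi> (\<lambda>i. sp_D (ker_act (sq_odd lam mu n (fst F)) T i)) i
          + \<Phi> (ker_act (sq_odd lam mu n (fst F)) (\<lambda>j. sp_D (T j))) i + \<Phi> (ker_act (sq_odd lam mu n (snd F)) T) i)"
        unfolding super_act_def using T by (simp add: lin mem)
      also have "\<dots> = super_act (sq_odd lam' mu' n) F (\<Phi> T)"
      proof
        have h: "\<Phi> (\<lambda>i. sp_D (U i)) = (\<lambda>i. sp_D (\<Phi> U i))"
          "\<Phi> (ker_act (sq_odd lam mu n g) U) = ker_act (sq_odd lam' mu' n g) (\<Phi> U)" if "U \<in> tail_space r" for U g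
          using L that by (auto simp only: intertwines_def)
        fix i
        show "\<Phi> (\<lambda>i. sp_D (ker_act (sq_odd lam mu n (fst F)) T i)) i
          + \<Phi> (ker_act (sq_odd lam mu n (fst F)) (\<lambda>j. sp_D (T j))) i + \<Phi> (ker_act (sq_odd lam mu n (snd F)) T) i
          = super_act (sq_odd lam' mu' n) F (\<Phi> T) i"
          using T by (simp add: h mem super_act_def)
      qed
      finally show ?thesis .
    qed
    with L show ?R by (simp add: intertwines_def)
  }
  {
    assume R: ?R
    then have \<Phi>: "\<Phi> T \<in> tail_space r" if "T \<in> tail_space r" for T
      using that by (auto simp: bij_betw_def)
    have "\<Phi> (\<lambda>i. sp_D (T i)) = (\<lambda>i. sp_D (\<Phi> T i))" if "T \<in> tail_space r" for T
      using R that D[OF that] D[OF \<Phi>[OF that]] by metis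
    moreover have "\<Phi> (ker_act (sq_odd lam mu n g) T) = ker_act (sq_odd lam' mu' n g) (\<Phi> T)" if "T \<in> tail_space r" for T g
      using R that by (simp flip: super_act_const(2))
    ultimately show ?L using R by (simp add: intertwines_def)
  }
qed

theorem SQ_equiv_even_iff:
  "SQ_equiv lam mu (mu - lam - n) False lam' mu' (mu' - lam' - n) False 7 \<longleftrightarrow>
    (\<exists>\<Phi>. intertwines 0 (sq_odd lam mu n) (sq_odd lam' mu' n) \<Phi>)"
  by (simp add: SQ_equiv_even_iff_super intertwines_iff_super)

theorem SQ_equiv_odd_iff:
  "SQ_equiv lam mu (mu - lam - n - 1/2) True lam' mu' (mu' - lam' - n - 1/2) True 6 \<longleftrightarrow>
    (\<exists>\<Phi>. intertwines 1 (sq_odd lam mu n) (sq_odd lam' mu' n) \<Phi>)"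
  by (simp only: SQ_equiv_odd_iff_super intertwines_iff_super)

section \<open>The lift to normal form\<close>

text \<open>Origin of the divisors: commuting \<open>D^(N + 1)\<close> past the field
  \<open>xi x\<close> leaves \<open>D^N\<close>, up to a parity sign, times
  \<open>(N + 1) / 4\<close> for odd \<open>N\<close> and times
  \<open>(2 n + j + N div 2) / 2\<close> for even \<open>N\<close>. Equivariance under
  \<open>xi x\<close> equates this multiple of the new coefficient with the old coefficient times
  the first subdiagonal entry of the action.\<close>

definition lift_step :: "complex \<Rightarrow> complex \<Rightarrow> complex \<Rightarrow> nat \<Rightarrow> nat \<Rightarrow> complex" where
  "lift_step lam mu n j N = sq_coef lam (mu - lam - n) (j + Suc N) (j + N) *
     (if odd N then 4 / of_nat (Suc N) else 2 / (2 * n + of_nat (j + N div 2)))"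

fun lift_coef :: "complex \<Rightarrow> complex \<Rightarrow> complex \<Rightarrow> nat \<Rightarrow> nat \<Rightarrow> complex" where
  "lift_coef lam mu n j 0 = 1"
| "lift_coef lam mu n j (Suc N) = lift_coef lam mu n j N * lift_step lam mu n j N"

declare lift_coef.simps(2) [simp del]

text \<open>With \<open>\<gamma>^{1/2} = \<surd>3 x\<close>, these are the symbols \<open>B\<close> with the irrational factor removed from the odd powers of \<open>\<gamma>^{1/2}\<close>.\<close>

definition red_B :: "nat \<Rightarrow> nat \<Rightarrow> complex \<Rightarrow> complex \<Rightarrow> complex \<Rightarrow> complex" where
  "red_B q N m lam mu = (let x = lam + mu - 1/2; d = mu - lam in
     if N = 3 then (if even q then x else 3 * x^2 - 3 * (m + 1/2) * d - 3/4)
     else if N = 4 then (if even q then 3 * x^2 - (m + 3/2) * (2 * d + m + 1/2) else 3 * x^2 - m * (2 * d + m + 1))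
     else if N = 5 then (if even q then 3 * x^2 - (m + 1) * d - 3/4
                           else 3 * x^3 - x * (4 * (m + 1) * d - (m + 1)^2 + 3))
     else 0)"

definition red_S :: "complex \<Rightarrow> complex \<Rightarrow> complex \<Rightarrow> nat \<Rightarrow> nat \<Rightarrow> complex" where
  "red_S lam mu n i j = ffall (mu - lam - n - of_nat ((j + 1) div 2)) ((i + 1) div 2 - (j + 1) div 2)
     * red_B (j mod 2) (i - j) (n + of_nat j / 2) lam mu"

text \<open>With the leading coefficients of \<open>transvect\<close> normalised to 1 or -1, these
  factors are dictated by the comparison of coefficients in the \<open>lift_chain\<close> lemmas.
  The 1/6 for odd \<open>j\<close> offsets a common factor 3 in \<open>red_B 1 3\<close>. For
  vertices up to 6 the denominators are values \<open>2 n + r\<close> with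
  \<open>r \<le> 5\<close>.\<close>

definition nf_coef :: "complex \<Rightarrow> complex \<Rightarrow> complex \<Rightarrow> nat \<Rightarrow> nat \<Rightarrow> complex" where
  "nf_coef lam mu n i j = (let v = 2 * n + of_nat j in
     if i - j = 3 then (if even j then - 1/2 else - 1/6) * red_S lam mu n i j / (v + 1)
     else if i - j = 4 then - 1/4 * red_S lam mu n i j / (v * (v + 3))
     else if i - j = 5 then - 1/2 * red_S lam mu n i j / (v * (v + 2) * (v + 4))
     else if i - j = 6 then - 2/3 * red_S lam mu n i (j + 3) * red_S lam mu n (j + 3) j / (v * (v + 1) * (v + 4) * (v + 5))
     else 0)"

lemma gchoose_table:
  fixes a :: complex
  shows "a gchoose 2 = a * (a - 1) / 2" "a gchoose Suc (Suc 0) = a * (a - 1) / 2" "a gchoose 3 = a * (a - 1) * (a - 2) / 6"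
    "a gchoose 4 = a * (a - 1) * (a - 2) * (a - 3) / 24"
  by (simp_all add: gbinomial_prod_rev numeral_eq_Suc)

lemma lift_coef_numeral:
  "lift_coef lam mu n j (numeral r) = lift_coef lam mu n j (pred_numeral r) * lift_step lam mu n j (pred_numeral r)"
  by (simp add: numeral_eq_Suc lift_coef.simps(2))

lemma ffall_table: "ffall x 0 = 1" "ffall x (Suc 0) = x" "ffall x 2 = x * (x - 1)" "ffall x 3 = x * (x - 1) * (x - 2)"
  by (simp_all add: ffall_def numeral_eq_Suc lessThan_Suc)

lemma lift_coef_unfold:
  "lift_coef lam mu n j 1 = lift_step lam mu n j 0"
  "lift_coef lam mu n j 2 = lift_step lam mu n j 0 * lift_step lam mu n j 1"
  "lift_coef lam mu n j 3 = lift_step lam mu n j 0 * lift_step lam mu n j 1 * lift_step lam mu n j 2"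
  "lift_coef lam mu n j 4 = lift_step lam mu n j 0 * lift_step lam mu n j 1 * lift_step lam mu n j 2 * lift_step lam mu n j 3"
  "lift_coef lam mu n j 5 = lift_step lam mu n j 0 * lift_step lam mu n j 1 * lift_step lam mu n j 2 * lift_step lam mu n j 3
     * lift_step lam mu n j 4"
  "lift_coef lam mu n j 6 = lift_step lam mu n j 0 * lift_step lam mu n j 1 * lift_step lam mu n j 2 * lift_step lam mu n j 3
     * lift_step lam mu n j 4 * lift_step lam mu n j 5"
  by (simp_all add: lift_coef_numeral lift_coef.simps(2))

lemma lift_step_even:
  assumes "even N" "2 * n + of_nat (j + N div 2) \<noteq> 0"
  shows "lift_step lam mu n j N * (2 * n + of_nat (j + N div 2)) = 2 * sq_coef lam (mu - lam - n) (j + Suc N) (j + N)"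
  using assms by (simp add: lift_step_def)

lemma lift_step_odd:
  assumes "odd N"
  shows "of_nat (Suc N) * lift_step lam mu n j N = 2 * (2 * sq_coef lam (mu - lam - n) (j + Suc N) (j + N))"
  using assms by (simp add: lift_step_def del: of_nat_Suc)

text \<open>The supertransvectants of \<open>\<xi> g\<close> with a density of weight \<open>t/2\<close>, written in components; they vanish for the affine \<open>g\<close>,
  which is what makes the normal form \<open>osp(1|2)\<close>-equivariant.\<close>

definition transvect :: "nat \<Rightarrow> complex \<Rightarrow> complex poly \<Rightarrow> spoly \<Rightarrow> spoly" where
  "transvect N t g v = (case v of (a, b) \<Rightarrow>
     let g2 = pderiv (pderiv g); g3 = pderiv g2; g4 = pderiv g3 in
     if N = 3 then (g2 * a, - (g2 * b))
     else if N = 4 then (g2 * b, smult (t / 3) (g3 * a) - g2 * pderiv a)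
     else if N = 5 then (g2 * pderiv a - smult (t / 3) (g3 * a), smult ((t + 1) / 3) (g3 * b) - g2 * pderiv b)
     else if N = 6 then (g2 * pderiv b - smult ((t + 1) / 3) (g3 * b),
       smult (2 / 3 * (t + 1)) (g3 * pderiv a) - g2 * pderiv (pderiv a) - smult (t * (t + 1) / 12) (g4 * a))
     else (0, 0))"

definition nf_odd :: "(nat \<Rightarrow> nat \<Rightarrow> complex) \<Rightarrow> complex \<Rightarrow> complex poly \<Rightarrow> kernel" where
  "nf_odd s n g i j v = (if i < j then 0 else if i = j then sp_density (n + of_nat j / 2) (0, g) v
     else sp_smult (s i j) (transvect (i - j) (2 * n + of_nat j) g v))"

definition lift_ker :: "complex \<Rightarrow> complex \<Rightarrow> complex \<Rightarrow> kernel" where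
  "lift_ker lam mu n i j v = (if i < j then 0 else sp_smult (lift_coef lam mu n j (i - j)) ((sp_D ^^ (i - j)) v))"

text \<open>Entry \<open>(j + N, j)\<close> of the equation by which the lift carries the normal
  form to the action. The length \<open>N\<close> stands in for the target index so that translating
  \<open>j\<close> keeps the form of the equation.\<close>

definition lift_chain :: "complex \<Rightarrow> complex \<Rightarrow> complex \<Rightarrow> complex poly \<Rightarrow> nat \<Rightarrow> nat \<Rightarrow> spoly \<Rightarrow> bool" where
  "lift_chain lam mu n g j N v \<longleftrightarrow>
     (\<Sum>M\<le>N. lift_ker lam mu n (j + N) (j + M) (nf_odd (nf_coef lam mu n) n g (j + M) j v)) =
     (\<Sum>M\<le>N. sq_odd lam mu n g (j + N) (j + M) (lift_ker lam mu n (j + M) j v))"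

section \<open>Comparison of coefficients for the lift, source vertex 0\<close>

lemma funpow_numeral_apply: "(f ^^ numeral r) x = f ((f ^^ pred_numeral r) x)"
  by (simp add: numeral_eq_Suc)

lemma nf_coef_small: "i - j < 3 \<Longrightarrow> nf_coef lam mu n i j = 0"
  by (simp add: nf_coef_def Let_def)

lemmas chain_unfold = atMost_nat_numeral lift_ker_def nf_odd_def sq_odd_def sq_ker_def sp_density_def sp_couple_def
  transvect_def Let_def funpow_numeral_apply sp_D_def sp_smult_def nf_coef_small zero_prod_def
  pderiv_mult pderiv_add pderiv_diff pderiv_minus pderiv_smult

text \<open>This is the coefficient of \<open>g'\<close> in the lift equation, that is, equivariance
  under \<open>xi x\<close>; \<open>lift_step\<close> is built to satisfy it.\<close>

lemma lift_coef_step_even: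
  assumes "even N" "2 * n + of_nat (j + N div 2) \<noteq> 0"
  shows "sq_coef lam (mu - lam - n) (j + Suc N) (j + N) * lift_coef lam mu n j N
    = lift_coef lam mu n j (Suc N) * (2 * n + of_nat (j + N div 2)) / 2"
  using lift_step_even[OF assms, of lam mu] by (simp add: lift_coef.simps(2) mult.assoc)

lemma lift_coef_step_odd:
  assumes "odd N"
  shows "sq_coef lam (mu - lam - n) (j + Suc N) (j + N) * lift_coef lam mu n j N
    = of_nat (Suc N) * lift_coef lam mu n j (Suc N) / 4"
  using lift_step_odd[OF assms, of lam mu n j] by (simp add: lift_coef.simps(2) mult.left_commute del: of_nat_Suc)

text \<open>Each case is a comparison of the coefficients of the derivatives of \<open>g\<close>. The resulting identities between rational functions are
  multiplied by a common denominator and rescaled to integer coefficients, for which Groebner bases are fast.\<close>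

lemma clear_denominator: "x * d = e \<Longrightarrow> e = 0 \<Longrightarrow> d \<noteq> 0 \<Longrightarrow> x = (0 :: complex)"
  by simp

text \<open>Notation here and below: \<open>k = \<delta> - n\<close>,
  \<open>y = \<lambda> + \<mu> - n\<close>, \<open>t = 2 n + j\<close> for the source vertex
  \<open>j\<close>; \<open>p0\<close>, \<open>p1\<close>, \<open>p2\<close> are factors of the
  falling factorials, and a name such as \<open>R30\<close> stands for a \<open>red_B\<close> scaled
  to integer coefficients. \<open>coeff_a3\<close> is the coefficient of the third derivative of
  \<open>g\<close> in the terms with the even component \<open>a\<close> of the argument,
  \<open>coeff_b2\<close> that of the second derivative in the terms with the odd component
  \<open>b\<close>. Each \<open>prod_m\<close> solves for the product of \<open>sq_coef\<close> and
  \<open>lift_coef\<close> that meet at vertex \<open>j + m\<close>.\<close>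

lemma lift_chain_0_1:
  assumes nonres: "\<And>r. r < 1 \<Longrightarrow> 2 * n + of_nat (0 + r) \<noteq> 0"
  shows "lift_chain lam mu n g 0 1 v"
proof -
  define k where "k = mu - lam - n"
  define y where "y = k + 2 * lam"
  define t where t: "t = 2 * n"
  define p0 where "p0 = k"
  have k: "mu - lam - n = k" and mu: "mu = lam + n + k" and n: "2 * n = t"
    by (simp_all add: k_def t)
  have nz: "t \<noteq> 0"
    using nonres[of 0] by (simp_all add: t add.assoc)
  let ?C = "lift_coef lam mu n" and ?q = "sq_coef lam k"
  note defs = y_def p0_def
  have sq_step:
    "2 * ?q 1 0 = p0"
    by (simp_all add: defs sq_coef_def vertex_exp_def Let_def field_simps)
  have step:
    "lift_step lam mu n 0 0 * t = p0"
    using nz lift_step_even[of 0 n 0 lam mu]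
    by (simp_all add: k n sq_step sq_step[simplified] add.commute[of _ t]
      flip: numeral_2_eq_2 distrib_left_numeral right_diff_distrib_numeral)
  have lift_10: "?C 0 1 * (t) = p0"
    unfolding lift_coef_unfold step[symmetric] by (rule refl | algebra)
  note lift = lift_10
  \<comment> \<open>The last intermediate vertex carries the coefficient of \<open>g'\<close>, so
    this product comes from the recursion.\<close>
  have prod_0: "?q 1 0 = ?C 0 1 * t / 2"
    using nz lift_coef_step_even[of 0 n 0 lam mu]
    by (simp add: k n add.commute[of _ t] flip: numeral_2_eq_2)
  obtain a b where v: "v = (a, b)" by (cases v)
  note prods = prod_0
  show ?thesis
    unfolding lift_chain_def v
    by (simp add: chain_unfold k cpoly_eq_iff prods[unfolded One_nat_def] flip: numeral_2_eq_2)
      (simp add: t field_simps)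
qed

lemma lift_chain_0_2:
  assumes nonres: "\<And>r. r < 2 \<Longrightarrow> 2 * n + of_nat (0 + r) \<noteq> 0"
  shows "lift_chain lam mu n g 0 2 v"
proof -
  define k where "k = mu - lam - n"
  define y where "y = k + 2 * lam"
  define t where t: "t = 2 * n"
  define p0 where "p0 = k"
  have k: "mu - lam - n = k" and mu: "mu = lam + n + k" and n: "2 * n = t"
    by (simp_all add: k_def t)
  have nz: "t \<noteq> 0" "(t + 1) \<noteq> 0"
    using nonres[of 0] nonres[of 1] by (simp_all add: t add.assoc)
  let ?C = "lift_coef lam mu n" and ?q = "sq_coef lam k"
  note defs = y_def p0_def
  have sq_step:
    "2 * ?q 1 0 = p0"
    "2 * ?q 2 1 = y - 1"
    by (simp_all add: defs sq_coef_def vertex_exp_def Let_def field_simps)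
  have step:
    "lift_step lam mu n 0 0 * t = p0"
    "lift_step lam mu n 0 1 = y - 1"
    using nz lift_step_even[of 0 n 0 lam mu] lift_step_odd[of 1 lam mu n 0]
    by (simp_all add: k n sq_step sq_step[simplified] add.commute[of _ t]
      flip: numeral_2_eq_2 distrib_left_numeral right_diff_distrib_numeral)
  have sq:
    "2 * ?q 2 0 = p0 * (y - 1)"
    by (simp_all add: defs sq_coef_def vertex_exp_def Let_def gchoose_table field_simps)
  have lift_20: "?C 0 2 * (t) = p0 * (y - 1)"
    unfolding lift_coef_unfold step(1,2)[symmetric] by (rule refl | algebra)
  note lift = lift_20
  have coeff_a2: "- 2 * ?q 2 0 + ?C 0 2 * t = 0" (is "?lhs = 0")
  proof (rule clear_denominator)
    \<comment> \<open>The multiplier is a common denominator times an integer. First each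
      denominator is moved to the coefficient that it clears, then the cleared coefficients are
      replaced by polynomials with integer coefficients.\<close>
    show "?lhs * (1 * (t)) = - (2 * ?q 2 0) * (t) + (?C 0 2 * (t)) * t"
      by algebra
    show "\<dots> = 0"
      unfolding sq lift by algebra
    show "(1 * (t)) \<noteq> 0" using nz by simp
  qed
  have prod_0: "?q 2 0 = (?C 0 2 * t) / 2"
    by (rule eq_divide_imp, simp, use coeff_a2 in algebra)
  have prod_1: "?q 2 1 * ?C 0 1 = 2 * ?C 0 2 / 4"
    using nz lift_coef_step_odd[of 1 lam mu n 0]
    by (simp add: k n add.commute[of _ t] flip: numeral_2_eq_2)
  obtain a b where v: "v = (a, b)" by (cases v)
  note prods = prod_0 prod_1
  show ?thesis
    unfolding lift_chain_def v
    by (simp add: chain_unfold k cpoly_eq_iff prods[unfolded One_nat_def] flip: numeral_2_eq_2)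
      (simp add: t field_simps)
qed

text \<open>The first appearance of a transvectant: in general the lift alone does not balance the
  coefficients of \<open>g''\<close>, and the single correction \<open>?f 3 0\<close> balances both
  of them.\<close>

lemma lift_chain_0_3:
  assumes nonres: "\<And>r. r < 3 \<Longrightarrow> 2 * n + of_nat (0 + r) \<noteq> 0"
  shows "lift_chain lam mu n g 0 3 v"
proof -
  define k where "k = mu - lam - n"
  define y where "y = k + 2 * lam"
  define t where t: "t = 2 * n"
  define p0 where "p0 = k"
  define p1 where "p1 = k - 1"
  define R30 where "R30 = 2 * y + t - 1"
  have k: "mu - lam - n = k" and mu: "mu = lam + n + k" and n: "2 * n = t"
    by (simp_all add: k_def t)
  have nz: "t \<noteq> 0" "(t + 1) \<noteq> 0" "(t + 2) \<noteq> 0"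
    using nonres[of 0] nonres[of 1] nonres[of 2] by (simp_all add: t add.assoc)
  let ?C = "lift_coef lam mu n" and ?q = "sq_coef lam k" and ?f = "nf_coef lam mu n"
  note defs = y_def p0_def p1_def
  note R = R30_def
  have red_B:
    "2 * red_B 0 3 n lam mu = R30"
    by (simp_all add: red_B_def Let_def R t mu y_def field_simps power2_eq_square power3_eq_cube)
  have red_S:
    "red_S lam mu n 3 0 = p0 * p1 * R30 / 2"
    by (simp_all add: red_S_def ffall_table ffall_table[simplified] k defs flip: red_B)
  have sq_step:
    "2 * ?q 1 0 = p0"
    "2 * ?q 2 1 = y - 1"
    "2 * ?q 3 2 = p1"
    by (simp_all add: defs sq_coef_def vertex_exp_def Let_def field_simps)
  have step:
    "lift_step lam mu n 0 0 * t = p0"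
    "lift_step lam mu n 0 1 = y - 1"
    "lift_step lam mu n 0 2 * (t + 1) = p1"
    using nz lift_step_even[of 0 n 0 lam mu] lift_step_odd[of 1 lam mu n 0] lift_step_even[of 2 n 0 lam mu]
    by (simp_all add: k n sq_step sq_step[simplified] add.commute[of _ t]
      flip: numeral_2_eq_2 distrib_left_numeral right_diff_distrib_numeral)
  have sq:
    "4 * ?q 3 0 = - p0 * p1"
    "2 * ?q 3 1 = p1 * (y - 1)"
    by (simp_all add: defs sq_coef_def vertex_exp_def Let_def gchoose_table field_simps)
  have lift_10: "?C 0 1 * (t) = p0"
    unfolding lift_coef_unfold step(1)[symmetric] by (rule refl | algebra)
  have lift_30: "?C 0 3 * (t * (t + 1)) = p0 * (y - 1) * p1"
    unfolding lift_coef_unfold step(1,2,3)[symmetric] by (rule refl | algebra)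
  note lift = lift_10 lift_30
  have nf:
    "4 * (?f 3 0 * ((t + 1))) = - p0 * p1 * R30"
    using nz by (simp_all add: nf_coef_def Let_def red_S n del: One_nat_def
      flip: distrib_left_numeral right_diff_distrib_numeral)
  have coeff_a2: "- 2 * ?q 3 0 + 2 * ?f 3 0 + ?C 0 3 * t = 0" (is "?lhs = 0")
  proof (rule clear_denominator)
    show "?lhs * (2 * (t * (t + 1))) = - (4 * ?q 3 0) * (t * (t + 1)) + (4 * (?f 3 0 * ((t + 1)))) * (t)
        + 2 * (?C 0 3 * (t * (t + 1))) * t"
      by algebra
    show "\<dots> = 0"
      unfolding sq lift nf R by algebra
    show "(2 * (t * (t + 1))) \<noteq> 0" using nz by simp
  qed
  have prod_0: "?q 3 0 = (2 * ?f 3 0 + ?C 0 3 * t) / 2"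
    by (rule eq_divide_imp, simp, use coeff_a2 in algebra)
  have coeff_b2: "2 * ?q 3 0 - 2 * ?q 3 1 * ?C 0 1 - 2 * ?f 3 0 + ?C 0 3 = 0" (is "?lhs = 0")
  proof (rule clear_denominator)
    show "?lhs * (2 * (t * (t + 1))) = (4 * ?q 3 0) * (t * (t + 1)) - 2 * (2 * ?q 3 1) * (?C 0 1 * (t)) * ((t + 1))
        - (4 * (?f 3 0 * ((t + 1)))) * (t) + 2 * (?C 0 3 * (t * (t + 1)))"
      by algebra
    show "\<dots> = 0"
      unfolding sq lift nf R by algebra
    show "(2 * (t * (t + 1))) \<noteq> 0" using nz by simp
  qed
  have prod_1: "?q 3 1 * ?C 0 1 = (2 * ?q 3 0 - 2 * ?f 3 0 + ?C 0 3) / 2"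
    by (rule eq_divide_imp, simp, use coeff_b2 in algebra)
  have prod_2: "?q 3 2 * ?C 0 2 = ?C 0 3 * (t + 1) / 2"
    using nz lift_coef_step_even[of 2 n 0 lam mu]
    by (simp add: k n add.commute[of _ t] flip: numeral_2_eq_2)
  obtain a b where v: "v = (a, b)" by (cases v)
  note prods = prod_0 prod_1 prod_2
  show ?thesis
    unfolding lift_chain_def v
    by (simp add: chain_unfold k cpoly_eq_iff prods[unfolded One_nat_def] flip: numeral_2_eq_2)
      (simp add: t field_simps)
qed

text \<open>From here on composite terms occur, such as \<open>?f 3 0 * ?C 3 1\<close>: the weight
  at distance 3 followed by a further step of the lift.\<close>

lemma lift_chain_0_4:
  assumes nonres: "\<And>r. r < 4 \<Longrightarrow> 2 * n + of_nat (0 + r) \<noteq> 0"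
  shows "lift_chain lam mu n g 0 4 v"
proof -
  define k where "k = mu - lam - n"
  define y where "y = k + 2 * lam"
  define t where t: "t = 2 * n"
  define p0 where "p0 = k"
  define p1 where "p1 = k - 1"
  define R30 where "R30 = 2 * y + t - 1"
  define R40 where "R40 = 3 * (2 * y + t - 1)^2 - (t + 3) * (2 * (2 * k + t) + (t + 1))"
  have k: "mu - lam - n = k" and mu: "mu = lam + n + k" and n: "2 * n = t"
    by (simp_all add: k_def t)
  have nz: "t \<noteq> 0" "(t + 1) \<noteq> 0" "(t + 2) \<noteq> 0" "(t + 3) \<noteq> 0"
    using nonres[of 0] nonres[of 1] nonres[of 2] nonres[of 3] by (simp_all add: t add.assoc)
  let ?C = "lift_coef lam mu n" and ?q = "sq_coef lam k" and ?f = "nf_coef lam mu n"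
  note defs = y_def p0_def p1_def
  note R = R30_def R40_def
  have red_B:
    "2 * red_B 0 3 n lam mu = R30"
    "4 * red_B 0 4 n lam mu = R40"
    by (simp_all add: red_B_def Let_def R t mu y_def field_simps power2_eq_square power3_eq_cube)
  have red_S:
    "red_S lam mu n 3 0 = p0 * p1 * R30 / 2"
    "red_S lam mu n 4 0 = p0 * p1 * R40 / 4"
    by (simp_all add: red_S_def ffall_table ffall_table[simplified] k defs flip: red_B)
  have sq_step:
    "2 * ?q 1 0 = p0"
    "2 * ?q 2 1 = y - 1"
    "2 * ?q 3 2 = p1"
    "2 * ?q 4 3 = y - 2"
    by (simp_all add: defs sq_coef_def vertex_exp_def Let_def field_simps)
  have step:
    "lift_step lam mu n 0 0 * t = p0"
    "lift_step lam mu n 0 1 = y - 1"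
    "lift_step lam mu n 0 2 * (t + 1) = p1"
    "2 * lift_step lam mu n 0 3 = y - 2"
    "lift_step lam mu n 3 0 * (t + 3) = y - 2"
    using nz lift_step_even[of 0 n 0 lam mu] lift_step_odd[of 1 lam mu n 0] lift_step_even[of 2 n 0 lam mu]
      lift_step_odd[of 3 lam mu n 0] lift_step_even[of 0 n 3 lam mu]
    by (simp_all add: k n sq_step sq_step[simplified] add.commute[of _ t]
      flip: numeral_2_eq_2 distrib_left_numeral right_diff_distrib_numeral)
  have sq:
    "12 * ?q 4 0 = - p0 * p1 * (3 * y - k - 4)"
    "4 * ?q 4 1 = - p1 * (2 * y - k - 2)"
    "2 * ?q 4 2 = p1 * (y - 2)"
    by (simp_all add: defs sq_coef_def vertex_exp_def Let_def gchoose_table field_simps)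
  have lift_10: "?C 0 1 * (t) = p0"
    unfolding lift_coef_unfold step(1)[symmetric] by (rule refl | algebra)
  have lift_20: "?C 0 2 * (t) = p0 * (y - 1)"
    unfolding lift_coef_unfold step(1,2)[symmetric] by (rule refl | algebra)
  have lift_40: "2 * (?C 0 4 * (t * (t + 1))) = p0 * (y - 1) * p1 * (y - 2)"
    unfolding lift_coef_unfold step(1,2,3,4)[symmetric] by (rule refl | algebra)
  have lift_43: "?C 3 1 * ((t + 3)) = (y - 2)"
    unfolding lift_coef_unfold step(5)[symmetric] by (rule refl | algebra)
  note lift = lift_10 lift_20 lift_40 lift_43
  have nf:
    "4 * (?f 3 0 * ((t + 1))) = - p0 * p1 * R30"
    "16 * (?f 4 0 * (t * (t + 3))) = - p0 * p1 * R40"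
    using nz by (simp_all add: nf_coef_def Let_def red_S n del: One_nat_def
      flip: distrib_left_numeral right_diff_distrib_numeral)
  have coeff_b2: "- 2 * ?q 4 1 * ?C 0 1 - 2 * ?f 3 0 * ?C 3 1 + 2 * ?f 4 0 + ?C 0 4 = 0" (is "?lhs = 0")
  proof (rule clear_denominator)
    show "?lhs * (8 * (t * (t + 1) * (t + 3))) = - 4 * (4 * ?q 4 1) * (?C 0 1 * (t)) * ((t + 1) * (t + 3))
        - 4 * (4 * (?f 3 0 * ((t + 1)))) * (?C 3 1 * ((t + 3))) * (t) + (16 * (?f 4 0 * (t * (t + 3)))) * ((t + 1))
        + 4 * (2 * (?C 0 4 * (t * (t + 1)))) * ((t + 3))"
      by algebra
    show "\<dots> = 0"
      unfolding sq lift nf R by algebra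
    show "(8 * (t * (t + 1) * (t + 3))) \<noteq> 0" using nz by simp
  qed
  have prod_1: "?q 4 1 * ?C 0 1 = (- 2 * ?f 3 0 * ?C 3 1 + 2 * ?f 4 0 + ?C 0 4) / 2"
    by (rule eq_divide_imp, simp, use coeff_b2 in algebra)
  have coeff_a2: "2 * ?q 4 1 * ?C 0 1 - 2 * ?q 4 2 * ?C 0 2 + 2 * ?f 3 0 * ?C 3 1 - 2 * ?f 4 0 + ?C 0 4 + 2 * ?C 0 4 * t
        = 0" (is "?lhs = 0")
  proof (rule clear_denominator)
    show "?lhs * (8 * (t * (t + 1) * (t + 3))) = 4 * (4 * ?q 4 1) * (?C 0 1 * (t)) * ((t + 1) * (t + 3))
        - 8 * (2 * ?q 4 2) * (?C 0 2 * (t)) * ((t + 1) * (t + 3)) + 4 * (4 * (?f 3 0 * ((t + 1)))) * (?C 3 1 * ((t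
        + 3))) * (t) - (16 * (?f 4 0 * (t * (t + 3)))) * ((t + 1)) + 4 * (2 * (?C 0 4 * (t * (t + 1)))) * ((t + 3))
        + 8 * (2 * (?C 0 4 * (t * (t + 1)))) * t * ((t + 3))"
      by algebra
    show "\<dots> = 0"
      unfolding sq lift nf R by algebra
    show "(8 * (t * (t + 1) * (t + 3))) \<noteq> 0" using nz by simp
  qed
  \<comment> \<open>The right-hand side still contains the product at vertex 1. It is left as a
    product so that \<open>prod_1\<close> rewrites it.\<close>
  have prod_2: "?q 4 2 * ?C 0 2 = (2 * (?q 4 1 * ?C 0 1) + 2 * ?f 3 0 * ?C 3 1 - 2 * ?f 4 0 + ?C 0 4 + 2 * ?C 0 4 * t) / 2"
    by (rule eq_divide_imp, simp, use coeff_a2 in algebra)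
  have coeff_a3: "- 6 * ?q 4 0 + 6 * ?f 3 0 * ?C 3 1 + 2 * ?f 4 0 * t + 3 * ?C 0 4 * t = 0" (is "?lhs = 0")
  proof (rule clear_denominator)
    show "?lhs * (8 * (t * (t + 1) * (t + 3))) = - 4 * (12 * ?q 4 0) * (t * (t + 1) * (t + 3)) + 12 * (4 * (?f 3 0 * ((t
        + 1)))) * (?C 3 1 * ((t + 3))) * (t) + (16 * (?f 4 0 * (t * (t + 3)))) * t * ((t + 1))
        + 12 * (2 * (?C 0 4 * (t * (t + 1)))) * t * ((t + 3))"
      by algebra
    show "\<dots> = 0"
      unfolding sq lift nf R by algebra
    show "(8 * (t * (t + 1) * (t + 3))) \<noteq> 0" using nz by simp
  qed
  have prod_0: "?q 4 0 = (6 * ?f 3 0 * ?C 3 1 + 2 * ?f 4 0 * t + 3 * ?C 0 4 * t) / 6"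
    by (rule eq_divide_imp, simp, use coeff_a3 in algebra)
  have prod_3: "?q 4 3 * ?C 0 3 = 4 * ?C 0 4 / 4"
    using nz lift_coef_step_odd[of 3 lam mu n 0]
    by (simp add: k n add.commute[of _ t] flip: numeral_2_eq_2)
  obtain a b where v: "v = (a, b)" by (cases v)
  note prods = prod_1 prod_2 prod_0 prod_3
  show ?thesis
    unfolding lift_chain_def v
    by (simp add: chain_unfold k cpoly_eq_iff prods[unfolded One_nat_def] flip: numeral_2_eq_2)
      (simp add: t field_simps)
qed

lemma lift_chain_0_5:
  assumes nonres: "\<And>r. r < 5 \<Longrightarrow> 2 * n + of_nat (0 + r) \<noteq> 0"
  shows "lift_chain lam mu n g 0 5 v"
proof -
  define k where "k = mu - lam - n"
  define y where "y = k + 2 * lam"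
  define t where t: "t = 2 * n"
  define p0 where "p0 = k"
  define p1 where "p1 = k - 1"
  define p2 where "p2 = k - 2"
  define R30 where "R30 = 2 * y + t - 1"
  define R40 where "R40 = 3 * (2 * y + t - 1)^2 - (t + 3) * (2 * (2 * k + t) + (t + 1))"
  define R50 where "R50 = 3 * (2 * y + t - 1)^2 - (t + 2) * (2 * k + t) - 3"
  have k: "mu - lam - n = k" and mu: "mu = lam + n + k" and n: "2 * n = t"
    by (simp_all add: k_def t)
  have nz: "t \<noteq> 0" "(t + 1) \<noteq> 0" "(t + 2) \<noteq> 0" "(t + 3) \<noteq> 0" "(t + 4) \<noteq> 0"
    using nonres[of 0] nonres[of 1] nonres[of 2] nonres[of 3] nonres[of 4] by (simp_all add: t add.assoc)
  let ?C = "lift_coef lam mu n" and ?q = "sq_coef lam k" and ?f = "nf_coef lam mu n"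
  note defs = y_def p0_def p1_def p2_def
  note R = R30_def R40_def R50_def
  have red_B:
    "2 * red_B 0 3 n lam mu = R30"
    "4 * red_B 0 4 n lam mu = R40"
    "4 * red_B 0 5 n lam mu = R50"
    by (simp_all add: red_B_def Let_def R t mu y_def field_simps power2_eq_square power3_eq_cube)
  have red_S:
    "red_S lam mu n 3 0 = p0 * p1 * R30 / 2"
    "red_S lam mu n 4 0 = p0 * p1 * R40 / 4"
    "red_S lam mu n 5 0 = p0 * p1 * p2 * R50 / 4"
    by (simp_all add: red_S_def ffall_table ffall_table[simplified] k defs flip: red_B)
  have sq_step:
    "2 * ?q 1 0 = p0"
    "2 * ?q 2 1 = y - 1"
    "2 * ?q 3 2 = p1"
    "2 * ?q 4 3 = y - 2"
    "2 * ?q 5 4 = p2"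
    by (simp_all add: defs sq_coef_def vertex_exp_def Let_def field_simps)
  have step:
    "lift_step lam mu n 0 0 * t = p0"
    "lift_step lam mu n 0 1 = y - 1"
    "lift_step lam mu n 0 2 * (t + 1) = p1"
    "2 * lift_step lam mu n 0 3 = y - 2"
    "lift_step lam mu n 0 4 * (t + 2) = p2"
    "lift_step lam mu n 3 0 * (t + 3) = y - 2"
    "lift_step lam mu n 3 1 = p2"
    "lift_step lam mu n 4 0 * (t + 4) = p2"
    using nz lift_step_even[of 0 n 0 lam mu] lift_step_odd[of 1 lam mu n 0] lift_step_even[of 2 n 0 lam mu]
      lift_step_odd[of 3 lam mu n 0] lift_step_even[of 4 n 0 lam mu] lift_step_even[of 0 n 3 lam mu]
      lift_step_odd[of 1 lam mu n 3] lift_step_even[of 0 n 4 lam mu]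
    by (simp_all add: k n sq_step sq_step[simplified] add.commute[of _ t]
      flip: numeral_2_eq_2 distrib_left_numeral right_diff_distrib_numeral)
  have sq:
    "12 * ?q 5 0 = p0 * p1 * p2"
    "12 * ?q 5 1 = - p1 * p2 * (3 * y - k - 3)"
    "4 * ?q 5 2 = - p1 * p2"
    "2 * ?q 5 3 = p2 * (y - 2)"
    by (simp_all add: defs sq_coef_def vertex_exp_def Let_def gchoose_table field_simps)
  have lift_10: "?C 0 1 * (t) = p0"
    unfolding lift_coef_unfold step(1)[symmetric] by (rule refl | algebra)
  have lift_20: "?C 0 2 * (t) = p0 * (y - 1)"
    unfolding lift_coef_unfold step(1,2)[symmetric] by (rule refl | algebra)
  have lift_30: "?C 0 3 * (t * (t + 1)) = p0 * (y - 1) * p1"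
    unfolding lift_coef_unfold step(1,2,3)[symmetric] by (rule refl | algebra)
  have lift_50: "2 * (?C 0 5 * (t * (t + 1) * (t + 2))) = p0 * (y - 1) * p1 * (y - 2) * p2"
    unfolding lift_coef_unfold step(1,2,3,4,5)[symmetric] by (rule refl | algebra)
  have lift_53: "?C 3 2 * ((t + 3)) = (y - 2) * p2"
    unfolding lift_coef_unfold step(6,7)[symmetric] by (rule refl | algebra)
  have lift_54: "?C 4 1 * ((t + 4)) = p2"
    unfolding lift_coef_unfold step(8)[symmetric] by (rule refl | algebra)
  note lift = lift_10 lift_20 lift_30 lift_50 lift_53 lift_54
  have nf:
    "4 * (?f 3 0 * ((t + 1))) = - p0 * p1 * R30"
    "16 * (?f 4 0 * (t * (t + 3))) = - p0 * p1 * R40"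
    "8 * (?f 5 0 * (t * (t + 2) * (t + 4))) = - p0 * p1 * p2 * R50"
    using nz by (simp_all add: nf_coef_def Let_def red_S n del: One_nat_def
      flip: distrib_left_numeral right_diff_distrib_numeral)
  have coeff_a2: "- 2 * ?q 5 2 * ?C 0 2 + 2 * ?f 3 0 * ?C 3 2 - 2 * ?f 4 0 * ?C 4 1 + 2 * ?f 5 0 + ?C 0 5 + 2 * ?C 0 5 * t
        = 0" (is "?lhs = 0")
  proof (rule clear_denominator)
    show "?lhs * (8 * (t * (t + 1) * (t + 2) * (t + 3) * (t + 4))) = - 4 * (4 * ?q 5 2) * (?C 0 2 * (t)) * ((t + 1) * (t
        + 2) * (t + 3) * (t + 4)) + 4 * (4 * (?f 3 0 * ((t + 1)))) * (?C 3 2 * ((t + 3))) * (t * (t + 2) * (t + 4))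
        - (16 * (?f 4 0 * (t * (t + 3)))) * (?C 4 1 * ((t + 4))) * ((t + 1) * (t + 2)) + 2 * (8 * (?f 5 0 * (t * (t
        + 2) * (t + 4)))) * ((t + 1) * (t + 3)) + 4 * (2 * (?C 0 5 * (t * (t + 1) * (t + 2)))) * ((t + 3) * (t + 4))
        + 8 * (2 * (?C 0 5 * (t * (t + 1) * (t + 2)))) * t * ((t + 3) * (t + 4))"
      by algebra
    show "\<dots> = 0"
      unfolding sq lift nf R by algebra
    show "(8 * (t * (t + 1) * (t + 2) * (t + 3) * (t + 4))) \<noteq> 0" using nz by simp
  qed
  have prod_2: "?q 5 2 * ?C 0 2 = (2 * ?f 3 0 * ?C 3 2 - 2 * ?f 4 0 * ?C 4 1 + 2 * ?f 5 0 + ?C 0 5 + 2 * ?C 0 5 * t) / 2"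
    by (rule eq_divide_imp, simp, use coeff_a2 in algebra)
  have coeff_a3: "- 6 * ?q 5 0 + 6 * ?f 3 0 * ?C 3 2 + 2 * ?f 4 0 * ?C 4 1 * t - 2 * ?f 5 0 * t + 3 * ?C 0 5 * t = 0" (is "?lhs = 0")
  proof (rule clear_denominator)
    show "?lhs * (8 * (t * (t + 1) * (t + 2) * (t + 3) * (t + 4))) = - 4 * (12 * ?q 5 0) * (t * (t + 1) * (t + 2) * (t
        + 3) * (t + 4)) + 12 * (4 * (?f 3 0 * ((t + 1)))) * (?C 3 2 * ((t + 3))) * (t * (t + 2) * (t + 4))
        + (16 * (?f 4 0 * (t * (t + 3)))) * (?C 4 1 * ((t + 4))) * t * ((t + 1) * (t + 2)) - 2 * (8 * (?f 5 0 * (t * (t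
        + 2) * (t + 4)))) * t * ((t + 1) * (t + 3)) + 12 * (2 * (?C 0 5 * (t * (t + 1) * (t + 2)))) * t * ((t + 3) * (t + 4))"
      by algebra
    show "\<dots> = 0"
      unfolding sq lift nf R by algebra
    show "(8 * (t * (t + 1) * (t + 2) * (t + 3) * (t + 4))) \<noteq> 0" using nz by simp
  qed
  have prod_0: "?q 5 0 = (6 * ?f 3 0 * ?C 3 2 + 2 * ?f 4 0 * ?C 4 1 * t - 2 * ?f 5 0 * t + 3 * ?C 0 5 * t) / 6"
    by (rule eq_divide_imp, simp, use coeff_a3 in algebra)
  have coeff_b2: "2 * ?q 5 2 * ?C 0 2 - 2 * ?q 5 3 * ?C 0 3 - 2 * ?f 3 0 * ?C 3 2 + 2 * ?f 4 0 * ?C 4 1 - 2 * ?f 5 0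
        + 3 * ?C 0 5 = 0" (is "?lhs = 0")
  proof (rule clear_denominator)
    show "?lhs * (8 * (t * (t + 1) * (t + 2) * (t + 3) * (t + 4))) = 4 * (4 * ?q 5 2) * (?C 0 2 * (t)) * ((t + 1) * (t
        + 2) * (t + 3) * (t + 4)) - 8 * (2 * ?q 5 3) * (?C 0 3 * (t * (t + 1))) * ((t + 2) * (t + 3) * (t + 4))
        - 4 * (4 * (?f 3 0 * ((t + 1)))) * (?C 3 2 * ((t + 3))) * (t * (t + 2) * (t + 4)) + (16 * (?f 4 0 * (t * (t
        + 3)))) * (?C 4 1 * ((t + 4))) * ((t + 1) * (t + 2)) - 2 * (8 * (?f 5 0 * (t * (t + 2) * (t + 4)))) * ((t
        + 1) * (t + 3)) + 12 * (2 * (?C 0 5 * (t * (t + 1) * (t + 2)))) * ((t + 3) * (t + 4))"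
      by algebra
    show "\<dots> = 0"
      unfolding sq lift nf R by algebra
    show "(8 * (t * (t + 1) * (t + 2) * (t + 3) * (t + 4))) \<noteq> 0" using nz by simp
  qed
  have prod_3: "?q 5 3 * ?C 0 3 = (2 * (?q 5 2 * ?C 0 2) - 2 * ?f 3 0 * ?C 3 2 + 2 * ?f 4 0 * ?C 4 1 - 2 * ?f 5 0 + 3 * ?C 0 5) / 2"
    by (rule eq_divide_imp, simp, use coeff_b2 in algebra)
  have coeff_b3: "6 * ?q 5 0 - 6 * ?q 5 1 * ?C 0 1 - 6 * ?f 3 0 * ?C 3 2 + 6 * ?f 4 0 * ?C 4 1 + 2 * ?f 5 0
        + 2 * ?f 5 0 * t + 3 * ?C 0 5 = 0" (is "?lhs = 0")
  proof (rule clear_denominator)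
    show "?lhs * (8 * (t * (t + 1) * (t + 2) * (t + 3) * (t + 4))) = 4 * (12 * ?q 5 0) * (t * (t + 1) * (t + 2) * (t
        + 3) * (t + 4)) - 4 * (12 * ?q 5 1) * (?C 0 1 * (t)) * ((t + 1) * (t + 2) * (t + 3) * (t + 4))
        - 12 * (4 * (?f 3 0 * ((t + 1)))) * (?C 3 2 * ((t + 3))) * (t * (t + 2) * (t + 4)) + 3 * (16 * (?f 4 0 * (t * (t
        + 3)))) * (?C 4 1 * ((t + 4))) * ((t + 1) * (t + 2)) + 2 * (8 * (?f 5 0 * (t * (t + 2) * (t + 4)))) * ((t
        + 1) * (t + 3)) + 2 * (8 * (?f 5 0 * (t * (t + 2) * (t + 4)))) * t * ((t + 1) * (t + 3))
        + 12 * (2 * (?C 0 5 * (t * (t + 1) * (t + 2)))) * ((t + 3) * (t + 4))"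
      by algebra
    show "\<dots> = 0"
      unfolding sq lift nf R by algebra
    show "(8 * (t * (t + 1) * (t + 2) * (t + 3) * (t + 4))) \<noteq> 0" using nz by simp
  qed
  have prod_1: "?q 5 1 * ?C 0 1 = (6 * ?q 5 0 - 6 * ?f 3 0 * ?C 3 2 + 6 * ?f 4 0 * ?C 4 1 + 2 * ?f 5 0 + 2 * ?f 5 0 * t
        + 3 * ?C 0 5) / 6"
    by (rule eq_divide_imp, simp, use coeff_b3 in algebra)
  have prod_4: "?q 5 4 * ?C 0 4 = ?C 0 5 * (t + 2) / 2"
    using nz lift_coef_step_even[of 4 n 0 lam mu]
    by (simp add: k n add.commute[of _ t] flip: numeral_2_eq_2)
  obtain a b where v: "v = (a, b)" by (cases v)
  note prods = prod_2 prod_0 prod_3 prod_1 prod_4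
  show ?thesis
    unfolding lift_chain_def v
    by (simp add: chain_unfold k cpoly_eq_iff prods[unfolded One_nat_def] flip: numeral_2_eq_2)
      (simp add: t field_simps)
qed

text \<open>The only entry of length 6. The single number \<open>?f 6 0\<close> has to satisfy five
  coefficient equations, and the product of the weights at \<open>(6, 3)\<close> and
  \<open>(3, 0)\<close> does so; hence the factors \<open>R33\<close> and
  \<open>R30\<close>.\<close>

lemma lift_chain_0_6:
  assumes nonres: "\<And>r. r < 6 \<Longrightarrow> 2 * n + of_nat (0 + r) \<noteq> 0"
  shows "lift_chain lam mu n g 0 6 v"
proof -
  define k where "k = mu - lam - n"
  define y where "y = k + 2 * lam"
  define t where t: "t = 2 * n"
  define p0 where "p0 = k"
  define p1 where "p1 = k - 1"
  define p2 where "p2 = k - 2"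
  define R30 where "R30 = 2 * y + t - 1"
  define R33 where "R33 = 3 * (2 * y + t - 1)^2 - 3 * (t + 4) * (2 * k + t) - 3"
  define R40 where "R40 = 3 * (2 * y + t - 1)^2 - (t + 3) * (2 * (2 * k + t) + (t + 1))"
  define R50 where "R50 = 3 * (2 * y + t - 1)^2 - (t + 2) * (2 * k + t) - 3"
  have k: "mu - lam - n = k" and mu: "mu = lam + n + k" and n: "2 * n = t"
    by (simp_all add: k_def t)
  have nz: "t \<noteq> 0" "(t + 1) \<noteq> 0" "(t + 2) \<noteq> 0" "(t + 3) \<noteq> 0" "(t + 4) \<noteq> 0" "(t + 5) \<noteq> 0"
    using nonres[of 0] nonres[of 1] nonres[of 2] nonres[of 3] nonres[of 4] nonres[of 5] by (simp_all add: t add.assoc)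
  let ?C = "lift_coef lam mu n" and ?q = "sq_coef lam k" and ?f = "nf_coef lam mu n"
  note defs = y_def p0_def p1_def p2_def
  note R = R30_def R33_def R40_def R50_def
  have red_B:
    "2 * red_B 0 3 n lam mu = R30"
    "4 * red_B 1 3 (n + 3 / 2) lam mu = R33"
    "4 * red_B 0 4 n lam mu = R40"
    "4 * red_B 0 5 n lam mu = R50"
    by (simp_all add: red_B_def Let_def R t mu y_def field_simps power2_eq_square power3_eq_cube)
  have red_S:
    "red_S lam mu n 3 0 = p0 * p1 * R30 / 2"
    "red_S lam mu n 6 3 = p2 * R33 / 4"
    "red_S lam mu n 4 0 = p0 * p1 * R40 / 4"
    "red_S lam mu n 5 0 = p0 * p1 * p2 * R50 / 4"
    by (simp_all add: red_S_def ffall_table ffall_table[simplified] k defs flip: red_B)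
  have sq_step:
    "2 * ?q 1 0 = p0"
    "2 * ?q 2 1 = y - 1"
    "2 * ?q 3 2 = p1"
    "2 * ?q 4 3 = y - 2"
    "2 * ?q 5 4 = p2"
    "2 * ?q 6 5 = y - 3"
    by (simp_all add: defs sq_coef_def vertex_exp_def Let_def field_simps)
  have step:
    "lift_step lam mu n 0 0 * t = p0"
    "lift_step lam mu n 0 1 = y - 1"
    "lift_step lam mu n 0 2 * (t + 1) = p1"
    "2 * lift_step lam mu n 0 3 = y - 2"
    "lift_step lam mu n 0 4 * (t + 2) = p2"
    "3 * lift_step lam mu n 0 5 = y - 3"
    "lift_step lam mu n 3 0 * (t + 3) = y - 2"
    "lift_step lam mu n 3 1 = p2"
    "lift_step lam mu n 3 2 * (t + 4) = y - 3"
    "lift_step lam mu n 4 0 * (t + 4) = p2"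
    "lift_step lam mu n 4 1 = y - 3"
    "lift_step lam mu n 5 0 * (t + 5) = y - 3"
    using nz lift_step_even[of 0 n 0 lam mu] lift_step_odd[of 1 lam mu n 0] lift_step_even[of 2 n 0 lam mu]
      lift_step_odd[of 3 lam mu n 0] lift_step_even[of 4 n 0 lam mu] lift_step_odd[of 5 lam mu n 0]
      lift_step_even[of 0 n 3 lam mu] lift_step_odd[of 1 lam mu n 3] lift_step_even[of 2 n 3 lam mu]
      lift_step_even[of 0 n 4 lam mu] lift_step_odd[of 1 lam mu n 4] lift_step_even[of 0 n 5 lam mu]
    by (simp_all add: k n sq_step sq_step[simplified] add.commute[of _ t]
      flip: numeral_2_eq_2 distrib_left_numeral right_diff_distrib_numeral)
  have sq:
    "24 * ?q 6 0 = p0 * p1 * p2 * (2 * y - k - 3)"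
    "12 * ?q 6 1 = p1 * p2 * (3 * y - 2 * k - 3)"
    "12 * ?q 6 2 = - p1 * p2 * (3 * y - k - 6)"
    "4 * ?q 6 3 = - p2 * (2 * y - k - 3)"
    "2 * ?q 6 4 = p2 * (y - 3)"
    by (simp_all add: defs sq_coef_def vertex_exp_def Let_def gchoose_table field_simps)
  have lift_10: "?C 0 1 * (t) = p0"
    unfolding lift_coef_unfold step(1)[symmetric] by (rule refl | algebra)
  have lift_20: "?C 0 2 * (t) = p0 * (y - 1)"
    unfolding lift_coef_unfold step(1,2)[symmetric] by (rule refl | algebra)
  have lift_30: "?C 0 3 * (t * (t + 1)) = p0 * (y - 1) * p1"
    unfolding lift_coef_unfold step(1,2,3)[symmetric] by (rule refl | algebra)
  have lift_40: "2 * (?C 0 4 * (t * (t + 1))) = p0 * (y - 1) * p1 * (y - 2)"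
    unfolding lift_coef_unfold step(1,2,3,4)[symmetric] by (rule refl | algebra)
  have lift_60: "6 * (?C 0 6 * (t * (t + 1) * (t + 2))) = p0 * (y - 1) * p1 * (y - 2) * p2 * (y - 3)"
    unfolding lift_coef_unfold step(1,2,3,4,5,6)[symmetric] by (rule refl | algebra)
  have lift_63: "?C 3 3 * ((t + 3) * (t + 4)) = (y - 2) * p2 * (y - 3)"
    unfolding lift_coef_unfold step(7,8,9)[symmetric] by (rule refl | algebra)
  have lift_64: "?C 4 2 * ((t + 4)) = p2 * (y - 3)"
    unfolding lift_coef_unfold step(10,11)[symmetric] by (rule refl | algebra)
  have lift_65: "?C 5 1 * ((t + 5)) = (y - 3)"
    unfolding lift_coef_unfold step(12)[symmetric] by (rule refl | algebra)
  note lift = lift_10 lift_20 lift_30 lift_40 lift_60 lift_63 lift_64 lift_65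
  have nf:
    "4 * (?f 3 0 * ((t + 1))) = - p0 * p1 * R30"
    "16 * (?f 4 0 * (t * (t + 3))) = - p0 * p1 * R40"
    "8 * (?f 5 0 * (t * (t + 2) * (t + 4))) = - p0 * p1 * p2 * R50"
    "12 * (?f 6 0 * (t * (t + 1) * (t + 4) * (t + 5))) = - p2 * R33 * p0 * p1 * R30"
    using nz by (simp_all add: nf_coef_def Let_def red_S n del: One_nat_def
      flip: distrib_left_numeral right_diff_distrib_numeral)
  have coeff_b2: "- 2 * ?q 6 3 * ?C 0 3 - 2 * ?f 3 0 * ?C 3 3 + 2 * ?f 4 0 * ?C 4 2 - 2 * ?f 5 0 * ?C 5 1 + 2 * ?f 6 0
        + 3 * ?C 0 6 = 0" (is "?lhs = 0")
  proof (rule clear_denominator)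
    show "?lhs * (24 * (t * (t + 1) * (t + 2) * (t + 3) * (t + 4) * (t + 5))) = - 12 * (4 * ?q 6 3) * (?C 0 3 * (t * (t
        + 1))) * ((t + 2) * (t + 3) * (t + 4) * (t + 5)) - 12 * (4 * (?f 3 0 * ((t + 1)))) * (?C 3 3 * ((t + 3) * (t
        + 4))) * (t * (t + 2) * (t + 5)) + 3 * (16 * (?f 4 0 * (t * (t + 3)))) * (?C 4 2 * ((t + 4))) * ((t + 1) * (t
        + 2) * (t + 5)) - 6 * (8 * (?f 5 0 * (t * (t + 2) * (t + 4)))) * (?C 5 1 * ((t + 5))) * ((t + 1) * (t + 3))
        + 4 * (12 * (?f 6 0 * (t * (t + 1) * (t + 4) * (t + 5)))) * ((t + 2) * (t + 3)) + 12 * (6 * (?C 0 6 * (t * (t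
        + 1) * (t + 2)))) * ((t + 3) * (t + 4) * (t + 5))"
      by algebra
    show "\<dots> = 0"
      unfolding sq lift nf R by algebra
    show "(24 * (t * (t + 1) * (t + 2) * (t + 3) * (t + 4) * (t + 5))) \<noteq> 0" using nz by simp
  qed
  have prod_3: "?q 6 3 * ?C 0 3 = (- 2 * ?f 3 0 * ?C 3 3 + 2 * ?f 4 0 * ?C 4 2 - 2 * ?f 5 0 * ?C 5 1 + 2 * ?f 6 0 + 3 * ?C 0 6) / 2"
    by (rule eq_divide_imp, simp, use coeff_b2 in algebra)
  have coeff_b3: "- 6 * ?q 6 1 * ?C 0 1 - 6 * ?f 3 0 * ?C 3 3 + 6 * ?f 4 0 * ?C 4 2 + 2 * ?f 5 0 * ?C 5 1
        + 2 * ?f 5 0 * ?C 5 1 * t - 2 * ?f 6 0 - 2 * ?f 6 0 * t + 3 * ?C 0 6 = 0" (is "?lhs = 0")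
  proof (rule clear_denominator)
    show "?lhs * (24 * (t * (t + 1) * (t + 2) * (t + 3) * (t + 4) * (t + 5))) =
        - 12 * (12 * ?q 6 1) * (?C 0 1 * (t)) * ((t + 1) * (t + 2) * (t + 3) * (t + 4) * (t + 5))
        - 36 * (4 * (?f 3 0 * ((t + 1)))) * (?C 3 3 * ((t + 3) * (t + 4))) * (t * (t + 2) * (t + 5))
        + 9 * (16 * (?f 4 0 * (t * (t + 3)))) * (?C 4 2 * ((t + 4))) * ((t + 1) * (t + 2) * (t + 5))
        + 6 * (8 * (?f 5 0 * (t * (t + 2) * (t + 4)))) * (?C 5 1 * ((t + 5))) * ((t + 1) * (t + 3))
        + 6 * (8 * (?f 5 0 * (t * (t + 2) * (t + 4)))) * (?C 5 1 * ((t + 5))) * t * ((t + 1) * (t + 3))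
        - 4 * (12 * (?f 6 0 * (t * (t + 1) * (t + 4) * (t + 5)))) * ((t + 2) * (t + 3)) - 4 * (12 * (?f 6 0 * (t * (t
        + 1) * (t + 4) * (t + 5)))) * t * ((t + 2) * (t + 3)) + 12 * (6 * (?C 0 6 * (t * (t + 1) * (t + 2)))) * ((t
        + 3) * (t + 4) * (t + 5))"
      by algebra
    show "\<dots> = 0"
      unfolding sq lift nf R by algebra
    show "(24 * (t * (t + 1) * (t + 2) * (t + 3) * (t + 4) * (t + 5))) \<noteq> 0" using nz by simp
  qed
  have prod_1: "?q 6 1 * ?C 0 1 = (- 6 * ?f 3 0 * ?C 3 3 + 6 * ?f 4 0 * ?C 4 2 + 2 * ?f 5 0 * ?C 5 1
        + 2 * ?f 5 0 * ?C 5 1 * t - 2 * ?f 6 0 - 2 * ?f 6 0 * t + 3 * ?C 0 6) / 6"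
    by (rule eq_divide_imp, simp, use coeff_b3 in algebra)
  have coeff_a2: "2 * ?q 6 3 * ?C 0 3 - 2 * ?q 6 4 * ?C 0 4 + 2 * ?f 3 0 * ?C 3 3 - 2 * ?f 4 0 * ?C 4 2
        + 2 * ?f 5 0 * ?C 5 1 - 2 * ?f 6 0 + 3 * ?C 0 6 + 3 * ?C 0 6 * t = 0" (is "?lhs = 0")
  proof (rule clear_denominator)
    show "?lhs * (24 * (t * (t + 1) * (t + 2) * (t + 3) * (t + 4) * (t + 5))) = 12 * (4 * ?q 6 3) * (?C 0 3 * (t * (t
        + 1))) * ((t + 2) * (t + 3) * (t + 4) * (t + 5)) - 12 * (2 * ?q 6 4) * (2 * (?C 0 4 * (t * (t + 1)))) * ((t
        + 2) * (t + 3) * (t + 4) * (t + 5)) + 12 * (4 * (?f 3 0 * ((t + 1)))) * (?C 3 3 * ((t + 3) * (t + 4))) * (t * (t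
        + 2) * (t + 5)) - 3 * (16 * (?f 4 0 * (t * (t + 3)))) * (?C 4 2 * ((t + 4))) * ((t + 1) * (t + 2) * (t + 5))
        + 6 * (8 * (?f 5 0 * (t * (t + 2) * (t + 4)))) * (?C 5 1 * ((t + 5))) * ((t + 1) * (t + 3))
        - 4 * (12 * (?f 6 0 * (t * (t + 1) * (t + 4) * (t + 5)))) * ((t + 2) * (t + 3)) + 12 * (6 * (?C 0 6 * (t * (t
        + 1) * (t + 2)))) * ((t + 3) * (t + 4) * (t + 5)) + 12 * (6 * (?C 0 6 * (t * (t + 1) * (t + 2)))) * t * ((t
        + 3) * (t + 4) * (t + 5))"
      by algebra
    show "\<dots> = 0"
      unfolding sq lift nf R by algebra
    show "(24 * (t * (t + 1) * (t + 2) * (t + 3) * (t + 4) * (t + 5))) \<noteq> 0" using nz by simp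
  qed
  have prod_4: "?q 6 4 * ?C 0 4 = (2 * (?q 6 3 * ?C 0 3) + 2 * ?f 3 0 * ?C 3 3 - 2 * ?f 4 0 * ?C 4 2 + 2 * ?f 5 0 * ?C 5 1
        - 2 * ?f 6 0 + 3 * ?C 0 6 + 3 * ?C 0 6 * t) / 2"
    by (rule eq_divide_imp, simp, use coeff_a2 in algebra)
  have coeff_a3: "6 * ?q 6 1 * ?C 0 1 - 6 * ?q 6 2 * ?C 0 2 + 12 * ?f 3 0 * ?C 3 3 - 6 * ?f 4 0 * ?C 4 2
        + 2 * ?f 4 0 * ?C 4 2 * t + 6 * ?f 5 0 * ?C 5 1 - 2 * ?f 5 0 * ?C 5 1 * t + 4 * ?f 6 0 + 4 * ?f 6 0 * t
        + 3 * ?C 0 6 + 9 * ?C 0 6 * t = 0" (is "?lhs = 0")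
  proof (rule clear_denominator)
    show "?lhs * (24 * (t * (t + 1) * (t + 2) * (t + 3) * (t + 4) * (t + 5))) = 12 * (12 * ?q 6 1) * (?C 0 1 * (t)) * ((t
        + 1) * (t + 2) * (t + 3) * (t + 4) * (t + 5)) - 12 * (12 * ?q 6 2) * (?C 0 2 * (t)) * ((t + 1) * (t + 2) * (t
        + 3) * (t + 4) * (t + 5)) + 72 * (4 * (?f 3 0 * ((t + 1)))) * (?C 3 3 * ((t + 3) * (t + 4))) * (t * (t + 2) * (t
        + 5)) - 9 * (16 * (?f 4 0 * (t * (t + 3)))) * (?C 4 2 * ((t + 4))) * ((t + 1) * (t + 2) * (t + 5))
        + 3 * (16 * (?f 4 0 * (t * (t + 3)))) * (?C 4 2 * ((t + 4))) * t * ((t + 1) * (t + 2) * (t + 5))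
        + 18 * (8 * (?f 5 0 * (t * (t + 2) * (t + 4)))) * (?C 5 1 * ((t + 5))) * ((t + 1) * (t + 3))
        - 6 * (8 * (?f 5 0 * (t * (t + 2) * (t + 4)))) * (?C 5 1 * ((t + 5))) * t * ((t + 1) * (t + 3))
        + 8 * (12 * (?f 6 0 * (t * (t + 1) * (t + 4) * (t + 5)))) * ((t + 2) * (t + 3)) + 8 * (12 * (?f 6 0 * (t * (t
        + 1) * (t + 4) * (t + 5)))) * t * ((t + 2) * (t + 3)) + 12 * (6 * (?C 0 6 * (t * (t + 1) * (t + 2)))) * ((t
        + 3) * (t + 4) * (t + 5)) + 36 * (6 * (?C 0 6 * (t * (t + 1) * (t + 2)))) * t * ((t + 3) * (t + 4) * (t + 5))"
      by algebra
    show "\<dots> = 0"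
      unfolding sq lift nf R by algebra
    show "(24 * (t * (t + 1) * (t + 2) * (t + 3) * (t + 4) * (t + 5))) \<noteq> 0" using nz by simp
  qed
  have prod_2: "?q 6 2 * ?C 0 2 = (6 * (?q 6 1 * ?C 0 1) + 12 * ?f 3 0 * ?C 3 3 - 6 * ?f 4 0 * ?C 4 2
        + 2 * ?f 4 0 * ?C 4 2 * t + 6 * ?f 5 0 * ?C 5 1 - 2 * ?f 5 0 * ?C 5 1 * t + 4 * ?f 6 0 + 4 * ?f 6 0 * t
        + 3 * ?C 0 6 + 9 * ?C 0 6 * t) / 6"
    by (rule eq_divide_imp, simp, use coeff_a3 in algebra)
  have coeff_a4: "- 12 * ?q 6 0 + 12 * ?f 3 0 * ?C 3 3 + 4 * ?f 4 0 * ?C 4 2 * t - 4 * ?f 5 0 * ?C 5 1 * t - ?f 6 0 * t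
        - ?f 6 0 * t * t + 6 * ?C 0 6 * t = 0" (is "?lhs = 0")
  proof (rule clear_denominator)
    show "?lhs * (12 * (t * (t + 1) * (t + 2) * (t + 3) * (t + 4) * (t + 5))) = - 6 * (24 * ?q 6 0) * (t * (t + 1) * (t
        + 2) * (t + 3) * (t + 4) * (t + 5)) + 36 * (4 * (?f 3 0 * ((t + 1)))) * (?C 3 3 * ((t + 3) * (t + 4))) * (t * (t
        + 2) * (t + 5)) + 3 * (16 * (?f 4 0 * (t * (t + 3)))) * (?C 4 2 * ((t + 4))) * t * ((t + 1) * (t + 2) * (t + 5))
        - 6 * (8 * (?f 5 0 * (t * (t + 2) * (t + 4)))) * (?C 5 1 * ((t + 5))) * t * ((t + 1) * (t + 3))
        - (12 * (?f 6 0 * (t * (t + 1) * (t + 4) * (t + 5)))) * t * ((t + 2) * (t + 3)) - (12 * (?f 6 0 * (t * (t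
        + 1) * (t + 4) * (t + 5)))) * t * t * ((t + 2) * (t + 3)) + 12 * (6 * (?C 0 6 * (t * (t + 1) * (t
        + 2)))) * t * ((t + 3) * (t + 4) * (t + 5))"
      by algebra
    show "\<dots> = 0"
      unfolding sq lift nf R by algebra
    show "(12 * (t * (t + 1) * (t + 2) * (t + 3) * (t + 4) * (t + 5))) \<noteq> 0" using nz by simp
  qed
  have prod_0: "?q 6 0 = (12 * ?f 3 0 * ?C 3 3 + 4 * ?f 4 0 * ?C 4 2 * t - 4 * ?f 5 0 * ?C 5 1 * t - ?f 6 0 * t
        - ?f 6 0 * t * t + 6 * ?C 0 6 * t) / 12"
    by (rule eq_divide_imp, simp, use coeff_a4 in algebra)
  have prod_5: "?q 6 5 * ?C 0 5 = 6 * ?C 0 6 / 4"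
    using nz lift_coef_step_odd[of 5 lam mu n 0]
    by (simp add: k n add.commute[of _ t] flip: numeral_2_eq_2)
  obtain a b where v: "v = (a, b)" by (cases v)
  note prods = prod_3 prod_1 prod_4 prod_2 prod_0 prod_5
  show ?thesis
    unfolding lift_chain_def v
    by (simp add: chain_unfold k cpoly_eq_iff prods[unfolded One_nat_def] flip: numeral_2_eq_2)
      (simp add: t field_simps)
qed

section \<open>Comparison of coefficients for the lift, source vertex 1\<close>

lemma lift_chain_1_1:
  assumes nonres: "\<And>r. r < 1 \<Longrightarrow> 2 * n + of_nat (1 + r) \<noteq> 0"
  shows "lift_chain lam mu n g 1 1 v"
proof -
  define k where "k = mu - lam - n"
  define y where "y = k + 2 * lam"
  define t where t: "t = 2 * n + 1"
  have k: "mu - lam - n = k" and mu: "mu = lam + n + k" and n: "2 * n = t - 1"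
    by (simp_all add: k_def t)
  have nz: "t \<noteq> 0"
    using nonres[of 0] by (simp_all add: t add.assoc)
  let ?C = "lift_coef lam mu n" and ?q = "sq_coef lam k"
  note defs = y_def 
  have sq_step:
    "2 * ?q 2 1 = y - 1"
    by (simp_all add: defs sq_coef_def vertex_exp_def Let_def field_simps)
  have step:
    "lift_step lam mu n 1 0 * t = y - 1"
    using nz lift_step_even[of 0 n 1 lam mu]
    by (simp_all add: k n sq_step sq_step[simplified] add.commute[of _ t]
      flip: numeral_2_eq_2 distrib_left_numeral right_diff_distrib_numeral)
  have lift_10: "?C 1 1 * (t) = (y - 1)"
    unfolding lift_coef_unfold step[symmetric] by (rule refl | algebra)
  note lift = lift_10
  have prod_0: "?q 2 1 = ?C 1 1 * t / 2"
    using nz lift_coef_step_even[of 0 n 1 lam mu]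
    by (simp add: k n add.commute[of _ t] flip: numeral_2_eq_2)
  obtain a b where v: "v = (a, b)" by (cases v)
  note prods = prod_0
  show ?thesis
    unfolding lift_chain_def v
    by (simp add: chain_unfold k cpoly_eq_iff prods[unfolded One_nat_def] flip: numeral_2_eq_2)
      (simp add: t field_simps)
qed

text \<open>An odd source exchanges the two kinds of steps: the factors \<open>y - r\<close> now
  come with the divisors \<open>t + s\<close>, and \<open>p1\<close>, \<open>p2\<close> with
  integers.\<close>

lemma lift_chain_1_2:
  assumes nonres: "\<And>r. r < 2 \<Longrightarrow> 2 * n + of_nat (1 + r) \<noteq> 0"
  shows "lift_chain lam mu n g 1 2 v"
proof -
  define k where "k = mu - lam - n"
  define y where "y = k + 2 * lam"
  define t where t: "t = 2 * n + 1"
  define p1 where "p1 = k - 1"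
  have k: "mu - lam - n = k" and mu: "mu = lam + n + k" and n: "2 * n = t - 1"
    by (simp_all add: k_def t)
  have nz: "t \<noteq> 0" "(t + 1) \<noteq> 0"
    using nonres[of 0] nonres[of 1] by (simp_all add: t add.assoc)
  let ?C = "lift_coef lam mu n" and ?q = "sq_coef lam k"
  note defs = y_def p1_def
  have sq_step:
    "2 * ?q 2 1 = y - 1"
    "2 * ?q 3 2 = p1"
    by (simp_all add: defs sq_coef_def vertex_exp_def Let_def field_simps)
  have step:
    "lift_step lam mu n 1 0 * t = y - 1"
    "lift_step lam mu n 1 1 = p1"
    using nz lift_step_even[of 0 n 1 lam mu] lift_step_odd[of 1 lam mu n 1]
    by (simp_all add: k n sq_step sq_step[simplified] add.commute[of _ t]
      flip: numeral_2_eq_2 distrib_left_numeral right_diff_distrib_numeral)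
  have sq:
    "2 * ?q 3 1 = p1 * (y - 1)"
    by (simp_all add: defs sq_coef_def vertex_exp_def Let_def gchoose_table field_simps)
  have lift_20: "?C 1 2 * (t) = (y - 1) * p1"
    unfolding lift_coef_unfold step(1,2)[symmetric] by (rule refl | algebra)
  note lift = lift_20
  have coeff_a2: "- 2 * ?q 3 1 + ?C 1 2 * t = 0" (is "?lhs = 0")
  proof (rule clear_denominator)
    show "?lhs * (1 * (t)) = - (2 * ?q 3 1) * (t) + (?C 1 2 * (t)) * t"
      by algebra
    show "\<dots> = 0"
      unfolding sq lift by algebra
    show "(1 * (t)) \<noteq> 0" using nz by simp
  qed
  have prod_0: "?q 3 1 = (?C 1 2 * t) / 2"
    by (rule eq_divide_imp, simp, use coeff_a2 in algebra)
  have prod_1: "?q 3 2 * ?C 1 1 = 2 * ?C 1 2 / 4"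
    using nz lift_coef_step_odd[of 1 lam mu n 1]
    by (simp add: k n add.commute[of _ t] flip: numeral_2_eq_2)
  obtain a b where v: "v = (a, b)" by (cases v)
  note prods = prod_0 prod_1
  show ?thesis
    unfolding lift_chain_def v
    by (simp add: chain_unfold k cpoly_eq_iff prods[unfolded One_nat_def] flip: numeral_2_eq_2)
      (simp add: t field_simps)
qed

lemma lift_chain_1_3:
  assumes nonres: "\<And>r. r < 3 \<Longrightarrow> 2 * n + of_nat (1 + r) \<noteq> 0"
  shows "lift_chain lam mu n g 1 3 v"
proof -
  define k where "k = mu - lam - n"
  define y where "y = k + 2 * lam"
  define t where t: "t = 2 * n + 1"
  define p1 where "p1 = k - 1"
  define R31 where "R31 = 3 * (2 * y + t - 2)^2 - 3 * (t + 1) * (2 * k + t - 1) - 3"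
  have k: "mu - lam - n = k" and mu: "mu = lam + n + k" and n: "2 * n = t - 1"
    by (simp_all add: k_def t)
  have nz: "t \<noteq> 0" "(t + 1) \<noteq> 0" "(t + 2) \<noteq> 0"
    using nonres[of 0] nonres[of 1] nonres[of 2] by (simp_all add: t add.assoc)
  let ?C = "lift_coef lam mu n" and ?q = "sq_coef lam k" and ?f = "nf_coef lam mu n"
  note defs = y_def p1_def
  note R = R31_def
  have red_B:
    "4 * red_B 1 3 (n + 1 / 2) lam mu = R31"
    by (simp_all add: red_B_def Let_def R t mu y_def field_simps power2_eq_square power3_eq_cube)
  have red_S:
    "red_S lam mu n 4 1 = p1 * R31 / 4"
    by (simp_all add: red_S_def ffall_table ffall_table[simplified] k defs flip: red_B)
  have sq_step:
    "2 * ?q 2 1 = y - 1"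
    "2 * ?q 3 2 = p1"
    "2 * ?q 4 3 = y - 2"
    by (simp_all add: defs sq_coef_def vertex_exp_def Let_def field_simps)
  have step:
    "lift_step lam mu n 1 0 * t = y - 1"
    "lift_step lam mu n 1 1 = p1"
    "lift_step lam mu n 1 2 * (t + 1) = y - 2"
    using nz lift_step_even[of 0 n 1 lam mu] lift_step_odd[of 1 lam mu n 1] lift_step_even[of 2 n 1 lam mu]
    by (simp_all add: k n sq_step sq_step[simplified] add.commute[of _ t]
      flip: numeral_2_eq_2 distrib_left_numeral right_diff_distrib_numeral)
  have sq:
    "4 * ?q 4 1 = - p1 * (2 * y - k - 2)"
    "2 * ?q 4 2 = p1 * (y - 2)"
    by (simp_all add: defs sq_coef_def vertex_exp_def Let_def gchoose_table field_simps)
  have lift_10: "?C 1 1 * (t) = (y - 1)"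
    unfolding lift_coef_unfold step(1)[symmetric] by (rule refl | algebra)
  have lift_30: "?C 1 3 * (t * (t + 1)) = (y - 1) * p1 * (y - 2)"
    unfolding lift_coef_unfold step(1,2,3)[symmetric] by (rule refl | algebra)
  note lift = lift_10 lift_30
  have nf:
    "24 * (?f 4 1 * ((t + 1))) = - p1 * R31"
    using nz by (simp_all add: nf_coef_def Let_def red_S n del: One_nat_def
      flip: distrib_left_numeral right_diff_distrib_numeral)
  have coeff_a2: "- 2 * ?q 4 1 + 2 * ?f 4 1 + ?C 1 3 * t = 0" (is "?lhs = 0")
  proof (rule clear_denominator)
    show "?lhs * (12 * (t * (t + 1))) = - 6 * (4 * ?q 4 1) * (t * (t + 1)) + (24 * (?f 4 1 * ((t + 1)))) * (t)
        + 12 * (?C 1 3 * (t * (t + 1))) * t"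
      by algebra
    show "\<dots> = 0"
      unfolding sq lift nf R by algebra
    show "(12 * (t * (t + 1))) \<noteq> 0" using nz by simp
  qed
  have prod_0: "?q 4 1 = (2 * ?f 4 1 + ?C 1 3 * t) / 2"
    by (rule eq_divide_imp, simp, use coeff_a2 in algebra)
  have coeff_b2: "2 * ?q 4 1 - 2 * ?q 4 2 * ?C 1 1 - 2 * ?f 4 1 + ?C 1 3 = 0" (is "?lhs = 0")
  proof (rule clear_denominator)
    show "?lhs * (12 * (t * (t + 1))) = 6 * (4 * ?q 4 1) * (t * (t + 1)) - 12 * (2 * ?q 4 2) * (?C 1 1 * (t)) * ((t + 1))
        - (24 * (?f 4 1 * ((t + 1)))) * (t) + 12 * (?C 1 3 * (t * (t + 1)))"
      by algebra
    show "\<dots> = 0"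
      unfolding sq lift nf R by algebra
    show "(12 * (t * (t + 1))) \<noteq> 0" using nz by simp
  qed
  have prod_1: "?q 4 2 * ?C 1 1 = (2 * ?q 4 1 - 2 * ?f 4 1 + ?C 1 3) / 2"
    by (rule eq_divide_imp, simp, use coeff_b2 in algebra)
  have prod_2: "?q 4 3 * ?C 1 2 = ?C 1 3 * (t + 1) / 2"
    using nz lift_coef_step_even[of 2 n 1 lam mu]
    by (simp add: k n add.commute[of _ t] flip: numeral_2_eq_2)
  obtain a b where v: "v = (a, b)" by (cases v)
  note prods = prod_0 prod_1 prod_2
  show ?thesis
    unfolding lift_chain_def v
    by (simp add: chain_unfold k cpoly_eq_iff prods[unfolded One_nat_def] flip: numeral_2_eq_2)
      (simp add: t field_simps)
qed

lemma lift_chain_1_4: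
  assumes nonres: "\<And>r. r < 4 \<Longrightarrow> 2 * n + of_nat (1 + r) \<noteq> 0"
  shows "lift_chain lam mu n g 1 4 v"
proof -
  define k where "k = mu - lam - n"
  define y where "y = k + 2 * lam"
  define t where t: "t = 2 * n + 1"
  define p1 where "p1 = k - 1"
  define p2 where "p2 = k - 2"
  define R31 where "R31 = 3 * (2 * y + t - 2)^2 - 3 * (t + 1) * (2 * k + t - 1) - 3"
  define R41 where "R41 = 3 * (2 * y + t - 2)^2 - t * (2 * (2 * k + t - 1) + (t + 2))"
  have k: "mu - lam - n = k" and mu: "mu = lam + n + k" and n: "2 * n = t - 1"
    by (simp_all add: k_def t)
  have nz: "t \<noteq> 0" "(t + 1) \<noteq> 0" "(t + 2) \<noteq> 0" "(t + 3) \<noteq> 0"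
    using nonres[of 0] nonres[of 1] nonres[of 2] nonres[of 3] by (simp_all add: t add.assoc)
  let ?C = "lift_coef lam mu n" and ?q = "sq_coef lam k" and ?f = "nf_coef lam mu n"
  note defs = y_def p1_def p2_def
  note R = R31_def R41_def
  have red_B:
    "4 * red_B 1 3 (n + 1 / 2) lam mu = R31"
    "4 * red_B 1 4 (n + 1 / 2) lam mu = R41"
    by (simp_all add: red_B_def Let_def R t mu y_def field_simps power2_eq_square power3_eq_cube)
  have red_S:
    "red_S lam mu n 4 1 = p1 * R31 / 4"
    "red_S lam mu n 5 1 = p1 * p2 * R41 / 4"
    by (simp_all add: red_S_def ffall_table ffall_table[simplified] k defs flip: red_B)
  have sq_step:
    "2 * ?q 2 1 = y - 1"
    "2 * ?q 3 2 = p1"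
    "2 * ?q 4 3 = y - 2"
    "2 * ?q 5 4 = p2"
    by (simp_all add: defs sq_coef_def vertex_exp_def Let_def field_simps)
  have step:
    "lift_step lam mu n 1 0 * t = y - 1"
    "lift_step lam mu n 1 1 = p1"
    "lift_step lam mu n 1 2 * (t + 1) = y - 2"
    "2 * lift_step lam mu n 1 3 = p2"
    "lift_step lam mu n 4 0 * (t + 3) = p2"
    using nz lift_step_even[of 0 n 1 lam mu] lift_step_odd[of 1 lam mu n 1] lift_step_even[of 2 n 1 lam mu]
      lift_step_odd[of 3 lam mu n 1] lift_step_even[of 0 n 4 lam mu]
    by (simp_all add: k n sq_step sq_step[simplified] add.commute[of _ t]
      flip: numeral_2_eq_2 distrib_left_numeral right_diff_distrib_numeral)
  have sq:
    "12 * ?q 5 1 = - p1 * p2 * (3 * y - k - 3)"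
    "4 * ?q 5 2 = - p1 * p2"
    "2 * ?q 5 3 = p2 * (y - 2)"
    by (simp_all add: defs sq_coef_def vertex_exp_def Let_def gchoose_table field_simps)
  have lift_10: "?C 1 1 * (t) = (y - 1)"
    unfolding lift_coef_unfold step(1)[symmetric] by (rule refl | algebra)
  have lift_20: "?C 1 2 * (t) = (y - 1) * p1"
    unfolding lift_coef_unfold step(1,2)[symmetric] by (rule refl | algebra)
  have lift_40: "2 * (?C 1 4 * (t * (t + 1))) = (y - 1) * p1 * (y - 2) * p2"
    unfolding lift_coef_unfold step(1,2,3,4)[symmetric] by (rule refl | algebra)
  have lift_43: "?C 4 1 * ((t + 3)) = p2"
    unfolding lift_coef_unfold step(5)[symmetric] by (rule refl | algebra)
  note lift = lift_10 lift_20 lift_40 lift_43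
  have nf:
    "24 * (?f 4 1 * ((t + 1))) = - p1 * R31"
    "16 * (?f 5 1 * (t * (t + 3))) = - p1 * p2 * R41"
    using nz by (simp_all add: nf_coef_def Let_def red_S n del: One_nat_def
      flip: distrib_left_numeral right_diff_distrib_numeral)
  have coeff_b2: "- 2 * ?q 5 2 * ?C 1 1 - 2 * ?f 4 1 * ?C 4 1 + 2 * ?f 5 1 + ?C 1 4 = 0" (is "?lhs = 0")
  proof (rule clear_denominator)
    show "?lhs * (24 * (t * (t + 1) * (t + 3))) = - 12 * (4 * ?q 5 2) * (?C 1 1 * (t)) * ((t + 1) * (t + 3))
        - 2 * (24 * (?f 4 1 * ((t + 1)))) * (?C 4 1 * ((t + 3))) * (t) + 3 * (16 * (?f 5 1 * (t * (t + 3)))) * ((t + 1))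
        + 12 * (2 * (?C 1 4 * (t * (t + 1)))) * ((t + 3))"
      by algebra
    show "\<dots> = 0"
      unfolding sq lift nf R by algebra
    show "(24 * (t * (t + 1) * (t + 3))) \<noteq> 0" using nz by simp
  qed
  have prod_1: "?q 5 2 * ?C 1 1 = (- 2 * ?f 4 1 * ?C 4 1 + 2 * ?f 5 1 + ?C 1 4) / 2"
    by (rule eq_divide_imp, simp, use coeff_b2 in algebra)
  have coeff_a2: "2 * ?q 5 2 * ?C 1 1 - 2 * ?q 5 3 * ?C 1 2 + 2 * ?f 4 1 * ?C 4 1 - 2 * ?f 5 1 + ?C 1 4 + 2 * ?C 1 4 * t
        = 0" (is "?lhs = 0")
  proof (rule clear_denominator)
    show "?lhs * (24 * (t * (t + 1) * (t + 3))) = 12 * (4 * ?q 5 2) * (?C 1 1 * (t)) * ((t + 1) * (t + 3))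
        - 24 * (2 * ?q 5 3) * (?C 1 2 * (t)) * ((t + 1) * (t + 3)) + 2 * (24 * (?f 4 1 * ((t + 1)))) * (?C 4 1 * ((t
        + 3))) * (t) - 3 * (16 * (?f 5 1 * (t * (t + 3)))) * ((t + 1)) + 12 * (2 * (?C 1 4 * (t * (t + 1)))) * ((t + 3))
        + 24 * (2 * (?C 1 4 * (t * (t + 1)))) * t * ((t + 3))"
      by algebra
    show "\<dots> = 0"
      unfolding sq lift nf R by algebra
    show "(24 * (t * (t + 1) * (t + 3))) \<noteq> 0" using nz by simp
  qed
  have prod_2: "?q 5 3 * ?C 1 2 = (2 * (?q 5 2 * ?C 1 1) + 2 * ?f 4 1 * ?C 4 1 - 2 * ?f 5 1 + ?C 1 4 + 2 * ?C 1 4 * t) / 2"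
    by (rule eq_divide_imp, simp, use coeff_a2 in algebra)
  have coeff_a3: "- 6 * ?q 5 1 + 6 * ?f 4 1 * ?C 4 1 + 2 * ?f 5 1 * t + 3 * ?C 1 4 * t = 0" (is "?lhs = 0")
  proof (rule clear_denominator)
    show "?lhs * (8 * (t * (t + 1) * (t + 3))) = - 4 * (12 * ?q 5 1) * (t * (t + 1) * (t + 3)) + 2 * (24 * (?f 4 1 * ((t
        + 1)))) * (?C 4 1 * ((t + 3))) * (t) + (16 * (?f 5 1 * (t * (t + 3)))) * t * ((t + 1))
        + 12 * (2 * (?C 1 4 * (t * (t + 1)))) * t * ((t + 3))"
      by algebra
    show "\<dots> = 0"
      unfolding sq lift nf R by algebra
    show "(8 * (t * (t + 1) * (t + 3))) \<noteq> 0" using nz by simp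
  qed
  have prod_0: "?q 5 1 = (6 * ?f 4 1 * ?C 4 1 + 2 * ?f 5 1 * t + 3 * ?C 1 4 * t) / 6"
    by (rule eq_divide_imp, simp, use coeff_a3 in algebra)
  have prod_3: "?q 5 4 * ?C 1 3 = 4 * ?C 1 4 / 4"
    using nz lift_coef_step_odd[of 3 lam mu n 1]
    by (simp add: k n add.commute[of _ t] flip: numeral_2_eq_2)
  obtain a b where v: "v = (a, b)" by (cases v)
  note prods = prod_1 prod_2 prod_0 prod_3
  show ?thesis
    unfolding lift_chain_def v
    by (simp add: chain_unfold k cpoly_eq_iff prods[unfolded One_nat_def] flip: numeral_2_eq_2)
      (simp add: t field_simps)
qed

lemma lift_chain_1_5:
  assumes nonres: "\<And>r. r < 5 \<Longrightarrow> 2 * n + of_nat (1 + r) \<noteq> 0"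
  shows "lift_chain lam mu n g 1 5 v"
proof -
  define k where "k = mu - lam - n"
  define y where "y = k + 2 * lam"
  define t where t: "t = 2 * n + 1"
  define p1 where "p1 = k - 1"
  define p2 where "p2 = k - 2"
  define R31 where "R31 = 3 * (2 * y + t - 2)^2 - 3 * (t + 1) * (2 * k + t - 1) - 3"
  define R41 where "R41 = 3 * (2 * y + t - 2)^2 - t * (2 * (2 * k + t - 1) + (t + 2))"
  define R51 where "R51 = 3 * (2 * y + t - 2)^3 - (2 * y + t - 2) * (4 * (t + 2) * (2 * k + t - 1) - (t + 2)^2 + 12)"
  have k: "mu - lam - n = k" and mu: "mu = lam + n + k" and n: "2 * n = t - 1"
    by (simp_all add: k_def t)
  have nz: "t \<noteq> 0" "(t + 1) \<noteq> 0" "(t + 2) \<noteq> 0" "(t + 3) \<noteq> 0" "(t + 4) \<noteq> 0"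
    using nonres[of 0] nonres[of 1] nonres[of 2] nonres[of 3] nonres[of 4] by (simp_all add: t add.assoc)
  let ?C = "lift_coef lam mu n" and ?q = "sq_coef lam k" and ?f = "nf_coef lam mu n"
  note defs = y_def p1_def p2_def
  note R = R31_def R41_def R51_def
  have red_B:
    "4 * red_B 1 3 (n + 1 / 2) lam mu = R31"
    "4 * red_B 1 4 (n + 1 / 2) lam mu = R41"
    "8 * red_B 1 5 (n + 1 / 2) lam mu = R51"
    by (simp_all add: red_B_def Let_def R t mu y_def field_simps power2_eq_square power3_eq_cube)
  have red_S:
    "red_S lam mu n 4 1 = p1 * R31 / 4"
    "red_S lam mu n 5 1 = p1 * p2 * R41 / 4"
    "red_S lam mu n 6 1 = p1 * p2 * R51 / 8"
    by (simp_all add: red_S_def ffall_table ffall_table[simplified] k defs flip: red_B)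
  have sq_step:
    "2 * ?q 2 1 = y - 1"
    "2 * ?q 3 2 = p1"
    "2 * ?q 4 3 = y - 2"
    "2 * ?q 5 4 = p2"
    "2 * ?q 6 5 = y - 3"
    by (simp_all add: defs sq_coef_def vertex_exp_def Let_def field_simps)
  have step:
    "lift_step lam mu n 1 0 * t = y - 1"
    "lift_step lam mu n 1 1 = p1"
    "lift_step lam mu n 1 2 * (t + 1) = y - 2"
    "2 * lift_step lam mu n 1 3 = p2"
    "lift_step lam mu n 1 4 * (t + 2) = y - 3"
    "lift_step lam mu n 4 0 * (t + 3) = p2"
    "lift_step lam mu n 4 1 = y - 3"
    "lift_step lam mu n 5 0 * (t + 4) = y - 3"
    using nz lift_step_even[of 0 n 1 lam mu] lift_step_odd[of 1 lam mu n 1] lift_step_even[of 2 n 1 lam mu]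
      lift_step_odd[of 3 lam mu n 1] lift_step_even[of 4 n 1 lam mu] lift_step_even[of 0 n 4 lam mu]
      lift_step_odd[of 1 lam mu n 4] lift_step_even[of 0 n 5 lam mu]
    by (simp_all add: k n sq_step sq_step[simplified] add.commute[of _ t]
      flip: numeral_2_eq_2 distrib_left_numeral right_diff_distrib_numeral)
  have sq:
    "12 * ?q 6 1 = p1 * p2 * (3 * y - 2 * k - 3)"
    "12 * ?q 6 2 = - p1 * p2 * (3 * y - k - 6)"
    "4 * ?q 6 3 = - p2 * (2 * y - k - 3)"
    "2 * ?q 6 4 = p2 * (y - 3)"
    by (simp_all add: defs sq_coef_def vertex_exp_def Let_def gchoose_table field_simps)
  have lift_10: "?C 1 1 * (t) = (y - 1)"
    unfolding lift_coef_unfold step(1)[symmetric] by (rule refl | algebra)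
  have lift_20: "?C 1 2 * (t) = (y - 1) * p1"
    unfolding lift_coef_unfold step(1,2)[symmetric] by (rule refl | algebra)
  have lift_30: "?C 1 3 * (t * (t + 1)) = (y - 1) * p1 * (y - 2)"
    unfolding lift_coef_unfold step(1,2,3)[symmetric] by (rule refl | algebra)
  have lift_50: "2 * (?C 1 5 * (t * (t + 1) * (t + 2))) = (y - 1) * p1 * (y - 2) * p2 * (y - 3)"
    unfolding lift_coef_unfold step(1,2,3,4,5)[symmetric] by (rule refl | algebra)
  have lift_53: "?C 4 2 * ((t + 3)) = p2 * (y - 3)"
    unfolding lift_coef_unfold step(6,7)[symmetric] by (rule refl | algebra)
  have lift_54: "?C 5 1 * ((t + 4)) = (y - 3)"
    unfolding lift_coef_unfold step(8)[symmetric] by (rule refl | algebra)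
  note lift = lift_10 lift_20 lift_30 lift_50 lift_53 lift_54
  have nf:
    "24 * (?f 4 1 * ((t + 1))) = - p1 * R31"
    "16 * (?f 5 1 * (t * (t + 3))) = - p1 * p2 * R41"
    "16 * (?f 6 1 * (t * (t + 2) * (t + 4))) = - p1 * p2 * R51"
    using nz by (simp_all add: nf_coef_def Let_def red_S n del: One_nat_def
      flip: distrib_left_numeral right_diff_distrib_numeral)
  have coeff_a2: "- 2 * ?q 6 3 * ?C 1 2 + 2 * ?f 4 1 * ?C 4 2 - 2 * ?f 5 1 * ?C 5 1 + 2 * ?f 6 1 + ?C 1 5 + 2 * ?C 1 5 * t
        = 0" (is "?lhs = 0")
  proof (rule clear_denominator)
    show "?lhs * (24 * (t * (t + 1) * (t + 2) * (t + 3) * (t + 4))) = - 12 * (4 * ?q 6 3) * (?C 1 2 * (t)) * ((t + 1) * (t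
        + 2) * (t + 3) * (t + 4)) + 2 * (24 * (?f 4 1 * ((t + 1)))) * (?C 4 2 * ((t + 3))) * (t * (t + 2) * (t + 4))
        - 3 * (16 * (?f 5 1 * (t * (t + 3)))) * (?C 5 1 * ((t + 4))) * ((t + 1) * (t + 2)) + 3 * (16 * (?f 6 1 * (t * (t
        + 2) * (t + 4)))) * ((t + 1) * (t + 3)) + 12 * (2 * (?C 1 5 * (t * (t + 1) * (t + 2)))) * ((t + 3) * (t + 4))
        + 24 * (2 * (?C 1 5 * (t * (t + 1) * (t + 2)))) * t * ((t + 3) * (t + 4))"
      by algebra
    show "\<dots> = 0"
      unfolding sq lift nf R by algebra
    show "(24 * (t * (t + 1) * (t + 2) * (t + 3) * (t + 4))) \<noteq> 0" using nz by simp
  qed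
  have prod_2: "?q 6 3 * ?C 1 2 = (2 * ?f 4 1 * ?C 4 2 - 2 * ?f 5 1 * ?C 5 1 + 2 * ?f 6 1 + ?C 1 5 + 2 * ?C 1 5 * t) / 2"
    by (rule eq_divide_imp, simp, use coeff_a2 in algebra)
  have coeff_a3: "- 6 * ?q 6 1 + 6 * ?f 4 1 * ?C 4 2 + 2 * ?f 5 1 * ?C 5 1 * t - 2 * ?f 6 1 * t + 3 * ?C 1 5 * t = 0" (is "?lhs = 0")
  proof (rule clear_denominator)
    show "?lhs * (8 * (t * (t + 1) * (t + 2) * (t + 3) * (t + 4))) = - 4 * (12 * ?q 6 1) * (t * (t + 1) * (t + 2) * (t
        + 3) * (t + 4)) + 2 * (24 * (?f 4 1 * ((t + 1)))) * (?C 4 2 * ((t + 3))) * (t * (t + 2) * (t + 4))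
        + (16 * (?f 5 1 * (t * (t + 3)))) * (?C 5 1 * ((t + 4))) * t * ((t + 1) * (t + 2)) - (16 * (?f 6 1 * (t * (t
        + 2) * (t + 4)))) * t * ((t + 1) * (t + 3)) + 12 * (2 * (?C 1 5 * (t * (t + 1) * (t + 2)))) * t * ((t + 3) * (t + 4))"
      by algebra
    show "\<dots> = 0"
      unfolding sq lift nf R by algebra
    show "(8 * (t * (t + 1) * (t + 2) * (t + 3) * (t + 4))) \<noteq> 0" using nz by simp
  qed
  have prod_0: "?q 6 1 = (6 * ?f 4 1 * ?C 4 2 + 2 * ?f 5 1 * ?C 5 1 * t - 2 * ?f 6 1 * t + 3 * ?C 1 5 * t) / 6"
    by (rule eq_divide_imp, simp, use coeff_a3 in algebra)
  have coeff_b2: "2 * ?q 6 3 * ?C 1 2 - 2 * ?q 6 4 * ?C 1 3 - 2 * ?f 4 1 * ?C 4 2 + 2 * ?f 5 1 * ?C 5 1 - 2 * ?f 6 1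
        + 3 * ?C 1 5 = 0" (is "?lhs = 0")
  proof (rule clear_denominator)
    show "?lhs * (24 * (t * (t + 1) * (t + 2) * (t + 3) * (t + 4))) = 12 * (4 * ?q 6 3) * (?C 1 2 * (t)) * ((t + 1) * (t
        + 2) * (t + 3) * (t + 4)) - 24 * (2 * ?q 6 4) * (?C 1 3 * (t * (t + 1))) * ((t + 2) * (t + 3) * (t + 4))
        - 2 * (24 * (?f 4 1 * ((t + 1)))) * (?C 4 2 * ((t + 3))) * (t * (t + 2) * (t + 4)) + 3 * (16 * (?f 5 1 * (t * (t
        + 3)))) * (?C 5 1 * ((t + 4))) * ((t + 1) * (t + 2)) - 3 * (16 * (?f 6 1 * (t * (t + 2) * (t + 4)))) * ((t
        + 1) * (t + 3)) + 36 * (2 * (?C 1 5 * (t * (t + 1) * (t + 2)))) * ((t + 3) * (t + 4))"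
      by algebra
    show "\<dots> = 0"
      unfolding sq lift nf R by algebra
    show "(24 * (t * (t + 1) * (t + 2) * (t + 3) * (t + 4))) \<noteq> 0" using nz by simp
  qed
  have prod_3: "?q 6 4 * ?C 1 3 = (2 * (?q 6 3 * ?C 1 2) - 2 * ?f 4 1 * ?C 4 2 + 2 * ?f 5 1 * ?C 5 1 - 2 * ?f 6 1 + 3 * ?C 1 5) / 2"
    by (rule eq_divide_imp, simp, use coeff_b2 in algebra)
  have coeff_b3: "6 * ?q 6 1 - 6 * ?q 6 2 * ?C 1 1 - 6 * ?f 4 1 * ?C 4 2 + 6 * ?f 5 1 * ?C 5 1 + 2 * ?f 6 1
        + 2 * ?f 6 1 * t + 3 * ?C 1 5 = 0" (is "?lhs = 0")
  proof (rule clear_denominator)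
    show "?lhs * (8 * (t * (t + 1) * (t + 2) * (t + 3) * (t + 4))) = 4 * (12 * ?q 6 1) * (t * (t + 1) * (t + 2) * (t
        + 3) * (t + 4)) - 4 * (12 * ?q 6 2) * (?C 1 1 * (t)) * ((t + 1) * (t + 2) * (t + 3) * (t + 4))
        - 2 * (24 * (?f 4 1 * ((t + 1)))) * (?C 4 2 * ((t + 3))) * (t * (t + 2) * (t + 4)) + 3 * (16 * (?f 5 1 * (t * (t
        + 3)))) * (?C 5 1 * ((t + 4))) * ((t + 1) * (t + 2)) + (16 * (?f 6 1 * (t * (t + 2) * (t + 4)))) * ((t + 1) * (t
        + 3)) + (16 * (?f 6 1 * (t * (t + 2) * (t + 4)))) * t * ((t + 1) * (t + 3)) + 12 * (2 * (?C 1 5 * (t * (t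
        + 1) * (t + 2)))) * ((t + 3) * (t + 4))"
      by algebra
    show "\<dots> = 0"
      unfolding sq lift nf R by algebra
    show "(8 * (t * (t + 1) * (t + 2) * (t + 3) * (t + 4))) \<noteq> 0" using nz by simp
  qed
  have prod_1: "?q 6 2 * ?C 1 1 = (6 * ?q 6 1 - 6 * ?f 4 1 * ?C 4 2 + 6 * ?f 5 1 * ?C 5 1 + 2 * ?f 6 1 + 2 * ?f 6 1 * t
        + 3 * ?C 1 5) / 6"
    by (rule eq_divide_imp, simp, use coeff_b3 in algebra)
  have prod_4: "?q 6 5 * ?C 1 4 = ?C 1 5 * (t + 2) / 2"
    using nz lift_coef_step_even[of 4 n 1 lam mu]
    by (simp add: k n add.commute[of _ t] flip: numeral_2_eq_2)
  obtain a b where v: "v = (a, b)" by (cases v)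
  note prods = prod_2 prod_0 prod_3 prod_1 prod_4
  show ?thesis
    unfolding lift_chain_def v
    by (simp add: chain_unfold k cpoly_eq_iff prods[unfolded One_nat_def] flip: numeral_2_eq_2)
      (simp add: t field_simps)
qed

section \<open>Translation by two vertices\<close>

lemma vertex_exp_shift: "vertex_exp k (Suc (Suc j)) = vertex_exp (k - 1) j"
  by (simp add: vertex_exp_def)

lemma sq_coef_shift: "sq_coef lam k (Suc (Suc i)) (Suc (Suc j)) = sq_coef lam (k - 1) i j"
  by (simp add: sq_coef_def vertex_exp_shift Let_def)

lemma lift_step_shift: "lift_step lam mu n (Suc (Suc j)) N = lift_step lam mu (n + 1) j N"
  using sq_coef_shift[of lam "mu - lam - n" "Suc (j + N)" "j + N"]
  by (simp add: lift_step_def algebra_simps)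

lemma lift_coef_shift: "lift_coef lam mu n (Suc (Suc j)) N = lift_coef lam mu (n + 1) j N"
  by (induction N) (simp_all add: lift_coef.simps(2) lift_step_shift)

lemma red_S_shift: "red_S lam mu n (Suc (Suc i)) (Suc (Suc j)) = red_S lam mu (n + 1) i j"
proof -
  have "mu - lam - n - of_nat ((Suc (Suc j) + 1) div 2) = mu - lam - (n + 1) - of_nat ((j + 1) div 2)"
    "n + of_nat (Suc (Suc j)) / 2 = n + 1 + of_nat j / 2"
    "(Suc (Suc i) + 1) div 2 - (Suc (Suc j) + 1) div 2 = (i + 1) div 2 - (j + 1) div 2" "Suc (Suc j) mod 2 = j mod 2"
    by (simp_all add: field_simps)
  then show ?thesis unfolding red_S_def by (simp only: diff_Suc_Suc)
qed

lemma nf_coef_shift: "nf_coef lam mu n (Suc (Suc i)) (Suc (Suc j)) = nf_coef lam mu (n + 1) i j"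
proof -
  have "2 * n + of_nat (Suc (Suc j)) = 2 * (n + 1) + of_nat j" "Suc (Suc j) + 3 = Suc (Suc (j + 3))"
    by simp_all
  then show ?thesis unfolding nf_coef_def by (simp only: red_S_shift diff_Suc_Suc even_Suc_Suc_iff)
qed

text \<open>Raising both indices by 2 keeps their parities and lowers
  \<open>k = \<delta> - n\<close> by one, which for fixed \<open>\<delta>\<close> is the passage
  from \<open>n\<close> to \<open>n + 1\<close>. Hence the sources 0 and 1 cover all cases.\<close>

lemma lift_chain_shift: "lift_chain lam mu n g (Suc (Suc j)) N v \<longleftrightarrow> lift_chain lam mu (n + 1) g j N v"
proof -
  have "lift_ker lam mu n (Suc (Suc i)) (Suc (Suc j)) v = lift_ker lam mu (n + 1) i j v" for i j v
    by (simp add: lift_ker_def lift_coef_shift)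
  moreover have "nf_odd (nf_coef lam mu n) n g (Suc (Suc i)) (Suc (Suc j)) v = nf_odd (nf_coef lam mu (n + 1)) (n + 1) g i j v" for i j v
  proof -
    have "2 * n + of_nat (Suc (Suc j)) = 2 * (n + 1) + of_nat j" "n + of_nat (Suc (Suc j)) / 2 = n + 1 + of_nat j / 2"
      by (simp_all add: field_simps)
    then show ?thesis unfolding nf_odd_def nf_coef_shift by (simp only: diff_Suc_Suc Suc_less_eq nat.inject)
  qed
  moreover have "sq_odd lam mu n g (Suc (Suc i)) (Suc (Suc j)) v = sq_odd lam mu (n + 1) g i j v" for i j v
  proof -
    have "mu - lam - n - 1 = mu - lam - (n + 1)" "n + of_nat (Suc (Suc j)) / 2 = n + 1 + of_nat j / 2"
      by (simp_all add: field_simps)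
    then show ?thesis
      unfolding sq_odd_def sq_ker_def sq_coef_shift by (simp only: diff_Suc_Suc Suc_less_eq nat.inject)
  qed
  ultimately show ?thesis by (simp add: lift_chain_def)
qed

lemma lift_chain_even_odd:
  assumes "\<And>r. r < N \<Longrightarrow> 2 * n + of_nat (b + r) \<noteq> 0" "b = 0 \<and> N \<le> 6 \<or> b = 1 \<and> N \<le> 5"
  shows "lift_chain lam mu n g b N v"
proof -
  have 0: "lift_chain lam mu n g b 0 v" for b
    by (simp add: lift_chain_def lift_ker_def nf_odd_def sq_odd_def sq_ker_def)
  have "N = 0 \<or> N = 1 \<or> N = 2 \<or> N = 3 \<or> N = 4 \<or> N = 5 \<or> N = 6" using assms(2) by linarith
  then show ?thesis
    using assms 0 lift_chain_0_1[of n] lift_chain_0_2[of n] lift_chain_0_3[of n] lift_chain_0_4[of n] lift_chain_0_5[of n]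
      lift_chain_0_6[of n] lift_chain_1_1[of n] lift_chain_1_2[of n] lift_chain_1_3[of n] lift_chain_1_4[of n] lift_chain_1_5[of n]
    by (elim disjE conjE) (simp_all only: add_0 order.refl simp_thms)
qed

lemma lift_chain_holds:
  assumes "\<And>r. j \<le> r \<Longrightarrow> r < j + N \<Longrightarrow> 2 * n + of_nat r \<noteq> 0" "j + N \<le> 6"
  shows "lift_chain lam mu n g j N v"
  using assms
proof (induction j arbitrary: n rule: induct_nat_012)
  case 0
  show ?case using 0(1)[of "_"] 0(2) by (intro lift_chain_even_odd) auto
next
  case 1
  show ?case using 1(1)[of "Suc _"] 1(2) by (intro lift_chain_even_odd) (auto simp: add.commute)
next
  case (ge2 j)
  have "lift_chain lam mu (n + 1) g j N v"
  proof (rule ge2.IH(1))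
    fix r assume "j \<le> r" "r < j + N"
    then show "2 * (n + 1) + of_nat r \<noteq> 0" using ge2.prems(1)[of "r + 2"] by (simp add: algebra_simps)
  qed (use ge2.prems in simp)
  then show ?case by (simp add: lift_chain_shift)
qed

definition nonresonant :: "complex \<Rightarrow> bool" where
  "nonresonant n \<longleftrightarrow> (\<forall>r<6. 2 * n + of_nat r \<noteq> 0)"

lemma triangular_lift_ker: "triangular (lift_ker lam mu n)"
proof -
  have "sp_linear (lift_ker lam mu n i j)" for i j
    unfolding lift_ker_def by (cases "i < j") (simp_all add: sp_linear_zero sp_linear_smult sp_linear_funpow_D)
  then show ?thesis by (auto simp: triangular_def lift_ker_def)
qed

lemma sp_linear_transvect: "sp_linear (transvect N t g)"
  unfolding sp_linear_def
  by (auto simp: transvect_def Let_def sp_smult_def pderiv_add pderiv_smult smult_add_right smult_diff_right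
      algebra_simps zero_prod_def)

lemma triangular_nf_odd: "triangular (nf_odd s n g)"
proof -
  have "sp_linear (nf_odd s n g i j)" for i j
    unfolding nf_odd_def
    by (cases "i < j"; cases "i = j") (simp_all add: sp_linear_zero sp_linear_density sp_linear_smult sp_linear_transvect)
  then show ?thesis by (auto simp: triangular_def nf_odd_def)
qed

lemma sum_triangular_window:
  fixes f :: "nat \<Rightarrow> spoly"
  assumes "\<And>m. m < j \<Longrightarrow> f m = 0" "\<And>m. i < m \<Longrightarrow> f m = 0" "i < 7"
  shows "(\<Sum>m<7. f m) = (if i < j then 0 else \<Sum>M\<le>i - j. f (j + M))"
proof (cases "i < j")
  case True
  then have "f m = 0" for m using assms(1,2) by (cases "m < j") auto
  then show ?thesis using True by simp
next
  case False
  have "(\<Sum>m<7. f m) = (\<Sum>m\<in>{j..i}. f m)"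
    using assms by (intro sum.mono_neutral_right) (auto simp: not_le)
  also have "\<dots> = (\<Sum>M\<le>i - j. f (j + M))"
    using False by (intro sum.reindex_bij_witness[of _ "\<lambda>M. j + M" "\<lambda>m. m - j"]) auto
  finally show ?thesis using False by simp
qed

lemma lift_ker_chain:
  assumes "nonresonant n" "i < 7" "j < 7"
  shows "(\<Sum>m<7. lift_ker lam mu n i m (nf_odd (nf_coef lam mu n) n g m j v))
    = (\<Sum>m<7. sq_odd lam mu n g i m (lift_ker lam mu n m j v))"
proof -
  have L: "lift_ker lam mu n i m (nf_odd (nf_coef lam mu n) n g m j v) = 0" if "m < j \<or> i < m" for m
    using that by (elim disjE) (simp_all add: triangularD(2)[OF triangular_nf_odd] triangularD(2)[OF triangular_lift_ker]
      sp_linear_0[OF triangularD(1)[OF triangular_lift_ker]])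
  have R: "sq_odd lam mu n g i m (lift_ker lam mu n m j v) = 0" if "m < j \<or> i < m" for m
    using that by (elim disjE) (simp_all add: triangularD(2)[OF triangular_sq_odd] triangularD(2)[OF triangular_lift_ker]
      sp_linear_0[OF triangularD(1)[OF triangular_sq_odd]])
  show ?thesis
  proof (cases "i < j")
    case False
    have "lift_chain lam mu n g j (i - j) v"
      using assms False by (intro lift_chain_holds) (auto simp: nonresonant_def)
    then show ?thesis
      using False assms L R by (simp add: sum_triangular_window[of j _ i] lift_chain_def)
  qed (use assms L R in \<open>simp add: sum_triangular_window[of j _ i]\<close>)
qed

lemma sp_D_lift_ker: "sp_D (lift_ker lam mu n i j v) = lift_ker lam mu n i j (sp_D v)"
  by (simp add: lift_ker_def sp_D_smult funpow_swap1)

lemma lift_intertwines: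
  assumes "nonresonant n"
  shows "intertwines r (nf_odd (nf_coef lam mu n) n) (sq_odd lam mu n) (ker_act (lift_ker lam mu n))"
  unfolding intertwines_def
proof (intro conjI ballI allI)
  show "linear_on r (ker_act (lift_ker lam mu n))" by (rule ker_act_linear[OF triangular_lift_ker])
  show "bij_betw (ker_act (lift_ker lam mu n)) (tail_space r) (tail_space r)"
    by (rule ker_act_unitriangular_bij[OF triangular_lift_ker]) (simp add: lift_ker_def)
next
  fix T assume "T \<in> tail_space r"
  show "ker_act (lift_ker lam mu n) (\<lambda>j. sp_D (T j)) = (\<lambda>j. sp_D (ker_act (lift_ker lam mu n) T j))"
    by (simp add: ker_act_def sp_D_sum sp_D_lift_ker fun_eq_iff)
next
  fix T g assume "T \<in> tail_space r"
  show "ker_act (lift_ker lam mu n) (ker_act (nf_odd (nf_coef lam mu n) n g) T)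
    = ker_act (sq_odd lam mu n g) (ker_act (lift_ker lam mu n) T)"
    unfolding ker_act_compose[OF triangular_lift_ker] ker_act_compose[OF triangular_sq_odd]
    using lift_ker_chain[OF assms] by (auto simp: ker_act_def fun_eq_iff intro!: sum.cong)
qed

lemma intertwines_sq_iff_nf:
  assumes "nonresonant n"
  shows "(\<exists>\<Phi>. intertwines r (sq_odd lam mu n) (sq_odd lam' mu' n) \<Phi>) \<longleftrightarrow>
    (\<exists>\<Phi>. intertwines r (nf_odd (nf_coef lam mu n) n) (nf_odd (nf_coef lam' mu' n) n) \<Phi>)"
  using lift_intertwines[OF assms] intertwines_inv[OF lift_intertwines[OF assms] triangular_nf_odd]
    intertwines_comp by metis


section \<open>Intertwiners of normal forms\<close>

text \<open>Divided powers, alternately even and odd, ordered so that \<open>D\<close> lowers the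
  index by exactly one; index 0 spans the kernel of \<open>D\<close>.\<close>

definition sp_basis :: "nat \<Rightarrow> spoly" where
  "sp_basis p = (if even p then (monom (1 / fact (p div 2)) (p div 2), 0) else (0, monom (1 / fact (p div 2)) (p div 2)))"

abbreviation raising :: "complex \<Rightarrow> spoly \<Rightarrow> spoly" where
  "raising \<nu> \<equiv> sp_density \<nu> (0, [:0, 1:])"

text \<open>A zero occurs only at \<open>p = 2 m\<close> with \<open>\<nu> = - m / 2\<close>; the
  basis vectors up to that index then span a submodule under \<open>D\<close> and
  \<open>raising\<close>.\<close>

definition raising_weight :: "complex \<Rightarrow> nat \<Rightarrow> complex" where
  "raising_weight \<nu> p = (if even p then \<nu> + of_nat (p div 2) / 2 else of_nat (Suc p div 2) / 2)"

lemma sp_D_basis: "sp_D (sp_basis (Suc p)) = sp_basis p" "sp_D (sp_basis 0) = 0"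
  using of_nat_neq_0[of "p div 2", where 'a = complex]
  by (auto simp: sp_basis_def sp_D_def pderiv_monom zero_prod_def one_pCons monom_0 pderiv_pCons elim!: oddE)

lemma raising_basis: "raising \<nu> (sp_basis p) = sp_smult (raising_weight \<nu> p) (sp_basis (Suc p))"
proof (cases "even p")
  case True
  then obtain m where p: "p = 2 * m" by blast
  have "[:0, 1:] * pderiv (monom c m) = monom (of_nat m * c) m" for c :: complex
    by (cases m) (simp_all add: pderiv_monom monom_0 flip: monom_Suc)
  then show ?thesis
    by (simp add: p sp_basis_def sp_density_def raising_weight_def sp_smult_def pderiv_pCons smult_monom add_monom field_simps)
next
  case False
  then obtain m where p: "p = 2 * m + 1" by (blast elim: oddE)
  have "2 * fact m * (1 + complex_of_nat m) \<noteq> 0" using of_nat_neq_0[of m, where 'a = complex] by simp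
  then have "fact m * 2 + fact m * (complex_of_nat m * 2) \<noteq> 0" by (simp add: algebra_simps)
  then show ?thesis
    by (simp add: p sp_basis_def sp_density_def raising_weight_def sp_smult_def smult_monom monom_Suc field_simps)
qed

lemma sp_D_diff: "sp_D (F - G) = sp_D F - sp_D G"
  by (simp add: sp_D_def pderiv_diff)

lemma sp_D_kernel: "sp_D v = 0 \<Longrightarrow> \<exists>c. v = sp_smult c (sp_basis 0)"
  by (cases v) (auto simp: sp_D_def zero_prod_def pderiv_eq_0_iff sp_basis_def sp_smult_def smult_monom monom_0
    elim!: degree_eq_zeroE)

lemma sp_basis_span:
  "\<exists>N c. v = (\<Sum>p<N. sp_smult (c p) (sp_basis p))"
proof -
  obtain a b where v: "v = (a, b)" by (cases v)
  define M where "M = Suc (max (degree a) (degree b))"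
  define c where "c p = fact (p div 2) * (if even p then coeff a (p div 2) else coeff b (p div 2))" for p
  have "(\<Sum>p<2 * K. sp_smult (c p) (sp_basis p)) = (\<Sum>i<K. (monom (coeff a i) i, monom (coeff b i) i))" for K
    by (induction K) (simp_all add: c_def sp_basis_def sp_smult_def smult_monom)
  moreover have "(\<Sum>i<M. monom (coeff a i) i) = a" "(\<Sum>i<M. monom (coeff b i) i) = b"
    unfolding M_def lessThan_Suc_atMost by (simp_all add: poly_as_sum_of_monoms')
  ultimately have "(\<Sum>p<2 * M. sp_smult (c p) (sp_basis p)) = v"
    by (simp add: v prod_eq_iff fst_sum snd_sum)
  then show ?thesis by metis
qed

text \<open>If \<open>P\<close> kills basis vector \<open>q\<close>, it maps the next one to
  \<open>\<alpha>\<close> times \<open>sp_basis 0\<close>. Raising from \<open>q\<close> gives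
  \<open>raising_weight \<nu> q * \<alpha> = 0\<close>, raising from \<open>q + 1\<close> gives
  \<open>raising_weight \<nu> (q + 1) * \<alpha> = \<alpha> * \<nu>'\<close>. A non-zero
  \<open>\<alpha>\<close> would force \<open>q = 2 m\<close>, \<open>\<nu> = - m / 2\<close> and
  \<open>\<nu>' = (m + 1) / 2\<close>, the excluded resonance.\<close>

lemma osp_hom_zero:
  assumes lin: "sp_linear P" and D: "\<And>v. P (sp_D v) = sp_D (P v)"
    and X: "\<And>v. P (raising \<nu> v) = raising \<nu>' (P v)" and P0: "P (sp_basis 0) = 0"
    and nonres: "\<And>m. \<nu> = - of_nat m / 2 \<Longrightarrow> \<nu>' \<noteq> of_nat (Suc m) / 2"
  shows "P v = 0"
proof -
  have "P (sp_basis p) = 0" for p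
  proof (induction p)
    case (Suc q)
    have "sp_D (P (sp_basis (Suc q))) = 0" using D[of "sp_basis (Suc q)"] Suc by (simp add: sp_D_basis)
    then obtain \<alpha> where \<alpha>: "P (sp_basis (Suc q)) = sp_smult \<alpha> (sp_basis 0)" using sp_D_kernel by blast
    \<comment> \<open>The next image is known up to a multiple \<open>\<beta>\<close> of
      \<open>sp_basis 0\<close>; comparing the components along \<open>sp_basis 1\<close> isolates
      \<open>\<alpha>\<close>.\<close>
    have "sp_D (P (sp_basis (Suc (Suc q))) - sp_smult \<alpha> (sp_basis 1)) = 0"
      using \<alpha> sp_D_basis(1)[of 0] by (simp add: sp_D_diff sp_D_smult sp_D_basis(1) flip: D)
    then obtain \<beta> where \<beta>: "P (sp_basis (Suc (Suc q))) = sp_smult \<alpha> (sp_basis 1) + sp_smult \<beta> (sp_basis 0)"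
      using sp_D_kernel by (metis add.commute diff_add_cancel)
    have "sp_smult (raising_weight \<nu> q * \<alpha>) (sp_basis 0) = 0"
      using X[of "sp_basis q"] Suc \<alpha> by (simp add: raising_basis sp_linearD(2)[OF lin] sp_linear_0[OF sp_linear_density])
    then have "raising_weight \<nu> q * \<alpha> = 0"
      by (simp add: sp_basis_def sp_smult_def zero_prod_def monom_0)
    moreover have "sp_smult (raising_weight \<nu> (Suc q)) (sp_smult \<alpha> (sp_basis 1) + sp_smult \<beta> (sp_basis 0))
        = sp_smult (\<alpha> * \<nu>') (sp_basis 1)"
      using X[of "sp_basis (Suc q)"] \<alpha> \<beta>
      by (simp add: raising_basis sp_linearD(2)[OF lin] sp_linearD(2)[OF sp_linear_density])
        (simp add: raising_weight_def)
    then have "raising_weight \<nu> (Suc q) * \<alpha> = \<alpha> * \<nu>'"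
      by (simp add: sp_basis_def sp_smult_def prod_eq_iff monom_0)
    ultimately have "\<alpha> = 0"
      using nonres[of "q div 2"] by (cases "even q") (auto simp: raising_weight_def add_eq_0_iff simp del: of_nat_Suc elim!: oddE)
    then show ?case using \<alpha> by simp
  qed (rule P0)
  then show ?thesis
    using sp_basis_span[of v] by (auto simp: sp_linear_sum[OF lin] sp_linearD(2)[OF lin])
qed

definition single_family :: "nat \<Rightarrow> spoly \<Rightarrow> nat \<Rightarrow> spoly" where
  "single_family j v = (\<lambda>i. if i = j then v else 0)"

lemma single_family_mem: "r \<le> j \<Longrightarrow> j < 7 \<Longrightarrow> single_family j v \<in> tail_space r"
  by (auto simp: single_family_def tail_space_def)

lemma ker_act_single:
  "triangular K \<Longrightarrow> j < 7 \<Longrightarrow> ker_act K (single_family j v) = (\<lambda>i. if i < 7 then K i j v else 0)"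
proof
  fix i assume K: "triangular K" and j: "j < 7"
  have "K i l (single_family j v l) = (if l = j then K i j v else 0)" for l
    by (simp add: single_family_def sp_linear_0[OF triangularD(1)[OF K]])
  then show "ker_act K (single_family j v) i = (if i < 7 then K i j v else 0)" using j by (simp add: ker_act_def)
qed

lemma single_family_linear:
  "single_family j (u + v) = (\<lambda>i. single_family j u i + single_family j v i)"
  "single_family j (sp_smult c v) = (\<lambda>i. sp_smult c (single_family j v i))"
  "single_family j (sp_D v) = (\<lambda>i. sp_D (single_family j v i))"
  by (auto simp: single_family_def fun_eq_iff)

text \<open>The field \<open>xi x\<close> lies in osp(1|2), so every normal form acts on it by its
  diagonal alone.\<close>

lemma transvect_x: "transvect N t [:0, 1:] v = 0"
  by (cases v) (simp add: transvect_def Let_def pderiv_pCons zero_prod_def)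

lemma nf_odd_x: "nf_odd s n [:0, 1:] i j v = (if i = j then raising (n + of_nat j / 2) v else 0)"
  by (simp add: nf_odd_def transvect_x)

lemma ker_act_nf_odd_x:
  "ker_act (nf_odd s n [:0, 1:]) T = (\<lambda>i. if i < 7 then raising (n + of_nat i / 2) (T i) else 0)"
  by (simp add: ker_act_def nf_odd_x fun_eq_iff)

text \<open>Both equations together would give \<open>i - j = 2 m + 1\<close> and
  \<open>2 n = - (m + j)\<close>, and then \<open>m + j < i \<le> 6\<close> makes \<open>n\<close>
  one of the excluded values.\<close>

lemma nonresonant_weights:
  assumes "nonresonant n" "i < 7" "j < 7" "n + of_nat j / 2 = - of_nat m / 2"
  shows "n + of_nat i / 2 \<noteq> of_nat (Suc m) / 2"
proof
  assume i: "n + of_nat i / 2 = of_nat (Suc m) / 2"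
  have 2: "2 * n + of_nat (m + j) = 0" 
  proof -
    have "2 * n + of_nat (m + j) = 2 * (n + of_nat j / 2 + of_nat m / 2)" by (simp add: algebra_simps)
    then show ?thesis by (simp add: assms(4))
  qed
  have "of_nat (2 * m + 1 + j) = (of_nat i :: complex)" 
  proof -
    have "of_nat i = 2 * (n + of_nat i / 2) - 2 * (n + of_nat j / 2) + of_nat j" by (simp add: algebra_simps)
    then show ?thesis by (simp add: i assms(4) del: distrib_left_numeral)
  qed
  then have "2 * m + 1 + j = i" by (simp only: of_nat_eq_iff)
  then have "m + j < 6" using assms(2) by linarith
  with 2 assms(1) show False by (auto simp: nonresonant_def)
qed

lemma intertwiner_diagonal:
  assumes non: "nonresonant n" and \<Phi>: "intertwines r (nf_odd s n) (nf_odd s' n) \<Phi>"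
  obtains c where "\<And>j. r \<le> j \<Longrightarrow> j < 7 \<Longrightarrow> c j \<noteq> 0"
    "\<And>T. T \<in> tail_space r \<Longrightarrow> \<Phi> T = (\<lambda>j. sp_smult (c j) (T j))"
proof -
  let ?S = single_family
  have add: "\<Phi> (\<lambda>j. T j + U j) = (\<lambda>j. \<Phi> T j + \<Phi> U j)" if "T \<in> tail_space r" "U \<in> tail_space r" for T U
    using \<Phi> that by (simp add: intertwines_def linear_on_def)
  have smult: "\<Phi> (\<lambda>j. sp_smult c (T j)) = (\<lambda>j. sp_smult c (\<Phi> T j))" if "T \<in> tail_space r" for T c
    using \<Phi> that by (simp add: intertwines_def linear_on_def)
  have D: "\<Phi> (\<lambda>j. sp_D (T j)) = (\<lambda>j. sp_D (\<Phi> T j))" if "T \<in> tail_space r" for T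
    using \<Phi> that by (simp add: intertwines_def)
  have X: "\<Phi> (ker_act (nf_odd s n g) T) = ker_act (nf_odd s' n g) (\<Phi> T)" if "T \<in> tail_space r" for T g
    using \<Phi> that by (simp add: intertwines_def)
  have mem: "\<Phi> T \<in> tail_space r" if "T \<in> tail_space r" for T
    using \<Phi> that by (auto simp: intertwines_def bij_betw_def)
  have zero: "(\<lambda>_. 0) \<in> tail_space r" by (simp add: tail_space_def)
  have \<Phi>0: "\<Phi> (\<lambda>_. 0) = (\<lambda>_. 0)" using smult[OF zero, of 0] by simp
  have lin: "sp_linear (\<lambda>v. \<Phi> (?S j v) i)" if "r \<le> j" "j < 7" for i j
    unfolding sp_linear_def
  proof (intro conjI allI)
    show "\<Phi> (?S j (u + v)) i = \<Phi> (?S j u) i + \<Phi> (?S j v) i" for u v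
      by (simp add: single_family_linear add single_family_mem that)
    show "\<Phi> (?S j (sp_smult c v)) i = sp_smult c (\<Phi> (?S j v) i)" for c v
      by (simp add: single_family_linear smult single_family_mem that)
  qed
  have DP: "\<Phi> (?S j (sp_D v)) i = sp_D (\<Phi> (?S j v) i)" if "r \<le> j" "j < 7" for i j v
    by (simp add: single_family_linear D single_family_mem that)
  have XP: "\<Phi> (?S j (raising (n + of_nat j / 2) v)) i = raising (n + of_nat i / 2) (\<Phi> (?S j v) i)"
    if "r \<le> j" "j < 7" "i < 7" for i j v
  proof -
    have "ker_act (nf_odd s n [:0, 1:]) (?S j v) = ?S j (raising (n + of_nat j / 2) v)"
      using that by (auto simp: ker_act_nf_odd_x single_family_def fun_eq_iff sp_linear_0[OF sp_linear_density])
    then show ?thesis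
      using fun_cong[OF X[OF single_family_mem[OF that(1,2)], of "[:0, 1:]" v], of i] that
      by (simp add: ker_act_nf_odd_x)
  qed
  have "\<exists>c. \<forall>v. \<Phi> (?S j v) = ?S j (sp_smult c v)" if j: "r \<le> j" "j < 7" for j
  proof -
    have "sp_D (\<Phi> (?S j (sp_basis 0)) i) = 0" for i
      using DP[OF j, of "sp_basis 0" i] sp_linear_0[OF lin[OF j]] by (simp add: sp_D_basis)
    then have "\<forall>i. \<exists>c. \<Phi> (?S j (sp_basis 0)) i = sp_smult c (sp_basis 0)" using sp_D_kernel by blast
    from choice[OF this] obtain \<alpha> where \<alpha>: "\<Phi> (?S j (sp_basis 0)) i = sp_smult (\<alpha> i) (sp_basis 0)" for i
      by blast
    \<comment> \<open>Raising \<open>sp_basis 0\<close> compares the weights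
      \<open>n + j / 2\<close> and \<open>n + i / 2\<close>. They differ, so
      \<open>\<alpha> i = 0\<close>, and \<open>osp_hom_zero\<close> extends this to all
      arguments.\<close>
    have off: "\<Phi> (?S j v) i = 0" if i: "i \<noteq> j" "i < 7" for i v
    proof -
      have "sp_D (\<Phi> (?S j (sp_basis 1)) i - sp_smult (\<alpha> i) (sp_basis 1)) = 0"
        using DP[OF j, of "sp_basis 1" i] \<alpha>[of i] sp_D_basis(1)[of 0] by (simp add: sp_D_diff sp_D_smult)
      then obtain \<beta> where "\<Phi> (?S j (sp_basis 1)) i - sp_smult (\<alpha> i) (sp_basis 1) = sp_smult \<beta> (sp_basis 0)"
        using sp_D_kernel by blast
      then have \<beta>: "\<Phi> (?S j (sp_basis 1)) i = sp_smult (\<alpha> i) (sp_basis 1) + sp_smult \<beta> (sp_basis 0)"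
        by (simp add: diff_eq_eq add.commute)
      have "sp_smult (n + of_nat j / 2) (sp_smult (\<alpha> i) (sp_basis 1) + sp_smult \<beta> (sp_basis 0))
        = sp_smult (\<alpha> i * (n + of_nat i / 2)) (sp_basis 1)"
        using XP[OF j i(2), of "sp_basis 0"] \<alpha>[of i] \<beta> sp_linearD(2)[OF lin[OF j]]
          sp_linearD(2)[OF sp_linear_density, of "n + of_nat i / 2" "(0, [:0, 1:])" "\<alpha> i" "sp_basis 0"]
        by (simp add: raising_basis raising_weight_def)
      then have "(n + of_nat j / 2) * \<alpha> i = \<alpha> i * (n + of_nat i / 2)"
        by (simp add: sp_basis_def sp_smult_def prod_eq_iff monom_0)
      then have "\<alpha> i * (of_nat i - of_nat j) = 0" by (auto simp: algebra_simps)
      then have "\<alpha> i = 0" using i by auto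
      then have "\<Phi> (?S j (sp_basis 0)) i = 0" using \<alpha>[of i] by simp
      then show ?thesis
        by (rule osp_hom_zero[OF lin[OF j] DP[OF j] XP[OF j i(2)] _ nonresonant_weights[OF non i(2) j(2)]])
    qed
    \<comment> \<open>The scalar is read off at \<open>sp_basis 0\<close>; after subtracting it the
      map is still equivariant and kills that vector.\<close>
    have diag: "\<Phi> (?S j v) j - sp_smult (\<alpha> j) v = 0" for v
    proof (rule osp_hom_zero[where P = "\<lambda>v. \<Phi> (?S j v) j - sp_smult (\<alpha> j) v" and \<nu> = "n + of_nat j / 2" and \<nu>' = "n + of_nat j / 2"])
      show "sp_linear (\<lambda>v. \<Phi> (?S j v) j - sp_smult (\<alpha> j) v)"
        using lin[OF j, of j] by (simp add: sp_linear_def sp_smult_add mult.commute)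
          (simp add: sp_smult_def smult_diff_right)
      show "\<Phi> (?S j (sp_D v)) j - sp_smult (\<alpha> j) (sp_D v) = sp_D (\<Phi> (?S j v) j - sp_smult (\<alpha> j) v)" for v
        by (simp add: DP[OF j] sp_D_diff sp_D_smult)
      show "\<Phi> (?S j (raising (n + of_nat j / 2) v)) j - sp_smult (\<alpha> j) (raising (n + of_nat j / 2) v)
        = raising (n + of_nat j / 2) (\<Phi> (?S j v) j - sp_smult (\<alpha> j) v)" for v
      proof -
        have "raising \<nu> (u - w) = raising \<nu> u - raising \<nu> w" for \<nu> u w
          using sp_linearD(1)[OF sp_linear_density, of \<nu> "(0, [:0, 1:])" "u - w" w] by simp
        then show ?thesis by (simp add: XP[OF j j(2)] sp_linearD(2)[OF sp_linear_density])
      qed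
      show "\<Phi> (?S j (sp_basis 0)) j - sp_smult (\<alpha> j) (sp_basis 0) = 0" using \<alpha>[of j] by simp
    qed (rule nonresonant_weights[OF non j(2) j(2)])
    have "\<Phi> (?S j v) i = ?S j (sp_smult (\<alpha> j) v) i" for v i
      using off[of i v] diag[of v] mem[OF single_family_mem[OF j, of v]]
      by (cases "i < 7") (auto simp: single_family_def tail_space_def)
    then show ?thesis by blast
  qed
  then have "\<forall>j. \<exists>c. r \<le> j \<and> j < 7 \<longrightarrow> (\<forall>v. \<Phi> (?S j v) = ?S j (sp_smult c v))" by blast
  from choice[OF this] obtain c where c: "\<Phi> (?S j v) = ?S j (sp_smult (c j) v)" if "r \<le> j" "j < 7" for j v
    by blast
  have "c j \<noteq> 0" if j: "r \<le> j" "j < 7" for j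
  proof
    assume "c j = 0"
    then have "\<Phi> (?S j (sp_basis 0)) = \<Phi> (\<lambda>_. 0)"
      unfolding c[OF j] \<Phi>0 by (simp add: single_family_def fun_eq_iff)
    moreover have "inj_on \<Phi> (tail_space r)" using \<Phi> by (simp add: intertwines_def bij_betw_def)
    ultimately have "?S j (sp_basis 0) = (\<lambda>_. 0)" using inj_onD single_family_mem[OF j] zero by metis
    then show False by (auto simp: single_family_def fun_eq_iff sp_basis_def zero_prod_def monom_0 split: if_splits)
  qed
  moreover have "\<Phi> T = (\<lambda>j. sp_smult (c j) (T j))" if T: "T \<in> tail_space r" for T
  proof -
    \<comment> \<open>A family is the sum of its components; truncation below \<open>m\<close> adds
      them one at a time.\<close>
    have "\<Phi> (\<lambda>j. if j < m then T j else 0) = (\<lambda>j. if j < m then sp_smult (c j) (T j) else 0)" if "m \<le> 7" for m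
      using that
    proof (induction m)
      case (Suc m)
      show ?case
      proof (cases "r \<le> m")
        case True
        have "(\<lambda>j. if j < Suc m then T j else 0) = (\<lambda>j. (if j < m then T j else 0) + ?S m (T m) j)"
          by (auto simp: single_family_def fun_eq_iff less_Suc_eq)
        moreover have "(\<lambda>j. if j < m then T j else 0) \<in> tail_space r" using T by (simp add: tail_space_def)
        ultimately show ?thesis
          using Suc True add[OF _ single_family_mem[of r m "T m"]] c[of m "T m"]
          by (auto simp: single_family_def fun_eq_iff less_Suc_eq)
      next
        case False
        then have "T m = 0" using T by (simp add: tail_space_def)
        then have "(\<lambda>j. if j < Suc m then h j (T j) else 0) = (\<lambda>j. if j < m then h j (T j) else 0)"
          if "\<And>j. h j 0 = 0" for h :: "nat \<Rightarrow> spoly \<Rightarrow> spoly"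
          using that by (auto simp: fun_eq_iff less_Suc_eq)
        from this[of "\<lambda>j v. v"] this[of "\<lambda>j. sp_smult (c j)"] show ?thesis using Suc by simp
      qed
    qed (simp add: \<Phi>0)
    from this[of 7] have "\<Phi> (\<lambda>j. if j < 7 then T j else 0) = (\<lambda>j. if j < 7 then sp_smult (c j) (T j) else 0)" by simp
    moreover have "(\<lambda>j. if j < 7 then h j (T j) else 0) = (\<lambda>j. h j (T j))"
      if "\<And>j. h j 0 = 0" for h :: "nat \<Rightarrow> spoly \<Rightarrow> spoly"
      using that T by (auto simp: fun_eq_iff tail_space_def)
    note this[of "\<lambda>j v. v"] this[of "\<lambda>j. sp_smult (c j)"]
    ultimately show ?thesis by simp
  qed
  ultimately show thesis by (rule that)
qed

text \<open>Conjugation by an invertible diagonal matrix on the vertices from \<open>r\<close> on.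
  Distance 6 is absent because for \<open>nf_coef\<close> its equation follows from those at
  distance 3.\<close>

definition gauge_equiv :: "nat \<Rightarrow> (nat \<Rightarrow> nat \<Rightarrow> complex) \<Rightarrow> (nat \<Rightarrow> nat \<Rightarrow> complex) \<Rightarrow> bool" where
  "gauge_equiv r s s' \<longleftrightarrow> (\<exists>c. (\<forall>i. c i \<noteq> 0) \<and>
     (\<forall>i j. r \<le> j \<longrightarrow> i < 7 \<longrightarrow> i - j \<in> {3, 4, 5} \<longrightarrow> c i * s i j = c j * s' i j))"

lemma nf_gauge_necessary:
  assumes non: "nonresonant n" and \<Phi>: "intertwines r (nf_odd s n) (nf_odd s' n) \<Phi>"
  shows "gauge_equiv r s s'"
proof -
  obtain c where c: "\<And>j. r \<le> j \<Longrightarrow> j < 7 \<Longrightarrow> c j \<noteq> 0"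
    "\<And>T. T \<in> tail_space r \<Longrightarrow> \<Phi> T = (\<lambda>j. sp_smult (c j) (T j))"
    using intertwiner_diagonal[OF non \<Phi>] by blast
  have eq: "sp_smult (c i) (nf_odd s n g i j v) = nf_odd s' n g i j (sp_smult (c j) v)"
    if "r \<le> j" "j < 7" "i < 7" for i j g v
  proof -
    note m = single_family_mem[OF that(1,2), of v]
    have "\<Phi> (ker_act (nf_odd s n g) (single_family j v)) i = ker_act (nf_odd s' n g) (\<Phi> (single_family j v)) i"
      using \<Phi> m by (simp add: intertwines_def)
    moreover have "(\<lambda>l. sp_smult (c l) (single_family j v l)) = single_family j (sp_smult (c j) v)"
      by (auto simp: single_family_def)
    moreover have "\<Phi> (ker_act (nf_odd s n g) (single_family j v))
      = (\<lambda>l. sp_smult (c l) (ker_act (nf_odd s n g) (single_family j v) l))"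
      by (rule c(2)[OF ker_act_tail_space[OF triangular_nf_odd m]])
    ultimately show ?thesis
      using that by (simp add: c(2)[OF m] ker_act_single[OF triangular_nf_odd])
  qed
  have "c i * s i j = c j * s' i j" if "r \<le> j" "i < 7" "i - j \<in> {3, 4, 5}" for i j
  proof -
    have "j < i" "j < 7" using that by auto
    have rel: "sp_smult (c i * s i j) (transvect (i - j) (2 * n + of_nat j) g v)
      = sp_smult (c j * s' i j) (transvect (i - j) (2 * n + of_nat j) g v)" for g v
      using eq[OF that(1) \<open>j < 7\<close> that(2), of g v] \<open>j < i\<close>
      by (simp add: nf_odd_def sp_linearD(2)[OF sp_linear_transvect] mult.commute)
    have "i - j = 3 \<or> i - j = 4 \<or> i - j = 5" using that(3) by simp
    \<comment> \<open>With \<open>g = x^2\<close> the transvectants of distance 3, 4 and 5 have a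
      non-zero even component at the arguments 1, \<open>xi\<close> and \<open>x\<close>
      respectively.\<close>
    then show ?thesis
      using rel[of "[:0, 0, 1:]" "(1, 0)"] rel[of "[:0, 0, 1:]" "(0, 1)"] rel[of "[:0, 0, 1:]" "([:0, 1:], 0)"]
      by (elim disjE) (simp_all add: transvect_def Let_def pderiv_pCons sp_smult_def)
  qed
  \<comment> \<open>\<open>gauge_equiv\<close> asks for non-zero scalars at all indices; outside the
    range of \<open>c\<close> the value 1 is filled in.\<close>
  then show ?thesis
    unfolding gauge_equiv_def using c(1)
    by (intro exI[of _ "\<lambda>i. if r \<le> i \<and> i < 7 then c i else 1"]) auto
qed

lemma nf_gauge_sufficient:
  assumes "\<And>i. c i \<noteq> 0" and rel: "\<And>i j. r \<le> j \<Longrightarrow> i < 7 \<Longrightarrow> i - j \<in> {3, 4, 5, 6} \<Longrightarrow> c i * s i j = c j * s' i j"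
  shows "intertwines r (nf_odd s n) (nf_odd s' n) (\<lambda>T j. sp_smult (c j) (T j))"
  unfolding intertwines_def
proof (intro conjI ballI allI)
  let ?V = "tail_space r" and ?\<Phi> = "\<lambda>c (T :: nat \<Rightarrow> spoly) j. sp_smult (c j) (T j)"
  show "linear_on r (?\<Phi> c)"
    by (simp add: linear_on_def sp_smult_add mult.commute)
  have inv: "?\<Phi> (\<lambda>j. inverse (c j)) (?\<Phi> c T) = T" "?\<Phi> c (?\<Phi> (\<lambda>j. inverse (c j)) T) = T" for T
    using assms(1) by simp_all
  show "bij_betw (?\<Phi> c) ?V ?V"
    using inv by (intro bij_betw_byWitness[of _ "?\<Phi> (\<lambda>j. inverse (c j))"]) (auto simp: tail_space_def)
  fix T g assume T: "T \<in> ?V"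
  show "?\<Phi> c (\<lambda>j. sp_D (T j)) = (\<lambda>j. sp_D (?\<Phi> c T j))" by (simp add: sp_D_smult)
  have "sp_smult (c i) (nf_odd s n g i j (T j)) = nf_odd s' n g i j (sp_smult (c j) (T j))" if "i < 7" for i j
  proof (cases "r \<le> j \<and> j < i")
    case True
    show ?thesis
    proof (cases "i - j \<in> {3, 4, 5, 6}")
      case hit: True
      then show ?thesis
        using rel[OF _ that hit] True
        by (simp add: nf_odd_def sp_linearD(2)[OF sp_linear_transvect] mult.commute)
    next
      case False
      then have "transvect (i - j) t g v = 0" for t v
        by (cases v) (auto simp: transvect_def Let_def zero_prod_def)
      then show ?thesis using True by (simp add: nf_odd_def)
    qed
  next
    case False
    then have "i < j \<or> i = j \<or> T j = 0" using T by (auto simp: tail_space_def)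
    then show ?thesis
      by (auto simp: nf_odd_def sp_density_smult sp_linear_0[OF sp_linear_density] sp_linear_0[OF sp_linear_transvect])
  qed
  then show "?\<Phi> c (ker_act (nf_odd s n g) T) = ker_act (nf_odd s' n g) (?\<Phi> c T)"
    by (simp add: ker_act_def fun_eq_iff sp_smult_sum)
qed


lemma nf_coef_scale:
  assumes non: "nonresonant n" and ij: "i < 7" "i - j \<in> {3, 4, 5}"
  obtains \<rho> where "\<rho> \<noteq> 0" "\<And>lam mu. nf_coef lam mu n i j = \<rho> * red_S lam mu n i j"
proof -
  have nz: "2 * n + of_nat j + of_nat r \<noteq> 0" if "r + j < 6" for r
    using non that by (auto simp: nonresonant_def add.assoc add.commute[of _ j] simp flip: of_nat_add)
  consider "i - j = 3" | "i - j = 4" | "i - j = 5" using ij(2) by auto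
  then show thesis
  proof cases
    case 1
    then show thesis using nz[of 1] ij
      by (intro that[of "(if even j then - 1/2 else - 1/6) / (2 * n + of_nat j + 1)"]) (auto simp: nf_coef_def Let_def)
  next
    case 2
    then show thesis using nz[of 0] nz[of 3] ij
      by (intro that[of "- 1/4 / ((2 * n + of_nat j) * (2 * n + of_nat j + 3))"]) (auto simp: nf_coef_def Let_def)
  next
    case 3
    then show thesis using nz[of 0] nz[of 2] nz[of 4] ij
      by (intro that[of "- 1/2 / ((2 * n + of_nat j) * (2 * n + of_nat j + 2) * (2 * n + of_nat j + 4))"])
        (auto simp: nf_coef_def Let_def)
  qed
qed

lemma gauge_equiv_rescale:
  assumes "\<And>i j. i < 7 \<Longrightarrow> i - j \<in> {3, 4, 5} \<Longrightarrow> \<exists>\<rho>. \<rho> \<noteq> 0 \<and> s i j = \<rho> * u i j \<and> s' i j = \<rho> * u' i j"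
  shows "gauge_equiv r s s' \<longleftrightarrow> gauge_equiv r u u'"
proof -
  have "c i * s i j = c j * s' i j \<longleftrightarrow> c i * u i j = c j * u' i j"
    if e: "i < 7" "i - j \<in> {3, 4, 5}" for i j c
  proof -
    obtain \<rho> where "\<rho> \<noteq> 0" "s i j = \<rho> * u i j" "s' i j = \<rho> * u' i j" using assms[OF e] by blast
    then show ?thesis by (simp add: mult.left_commute)
  qed
  then show ?thesis unfolding gauge_equiv_def by meson
qed

lemma intertwines_sq_iff_gauge:
  assumes non: "nonresonant n"
  shows "(\<exists>\<Phi>. intertwines r (sq_odd lam mu n) (sq_odd lam' mu' n) \<Phi>) \<longleftrightarrow>
    gauge_equiv r (red_S lam mu n) (red_S lam' mu' n)"
proof -
  have scale: "gauge_equiv r (nf_coef lam mu n) (nf_coef lam' mu' n) \<longleftrightarrow>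
      gauge_equiv r (red_S lam mu n) (red_S lam' mu' n)"
  proof (rule gauge_equiv_rescale)
    fix i j :: nat assume "i < 7" "i - j \<in> {3, 4, 5}"
    from nf_coef_scale[OF non this]
    show "\<exists>\<rho>. \<rho> \<noteq> 0 \<and> nf_coef lam mu n i j = \<rho> * red_S lam mu n i j \<and>
        nf_coef lam' mu' n i j = \<rho> * red_S lam' mu' n i j" by metis
  qed
  have "\<exists>\<Phi>. intertwines r (nf_odd (nf_coef lam mu n) n) (nf_odd (nf_coef lam' mu' n) n) \<Phi>"
    if g: "gauge_equiv r (red_S lam mu n) (red_S lam' mu' n)"
  proof -
    from g obtain c where c: "\<And>i. c i \<noteq> 0"
      "\<And>i j. r \<le> j \<Longrightarrow> i < 7 \<Longrightarrow> i - j \<in> {3, 4, 5} \<Longrightarrow> c i * red_S lam mu n i j = c j * red_S lam' mu' n i j"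
      unfolding gauge_equiv_def by blast
    have rel: "c i * nf_coef lam mu n i j = c j * nf_coef lam' mu' n i j"
      if e: "r \<le> j" "i < 7" "i - j \<in> {3, 4, 5, 6}" for i j
    proof (cases "i - j = 6")
      case True
      then have ij: "i = 6" "j = 0" "r = 0" using e by auto
      \<comment> \<open>The product of the equations for \<open>(6, 3)\<close> and
        \<open>(3, 0)\<close>, in which the scalar at vertex 3 drops out.\<close>
      have "c 6 * (red_S lam mu n 6 3 * red_S lam mu n 3 0) = c 0 * (red_S lam' mu' n 6 3 * red_S lam' mu' n 3 0)"
        using c(2)[of 3 6] c(2)[of 0 3] ij by (simp flip: mult.assoc)
      \<comment> \<open>The factor must be the same for both parameter pairs, so it may depend on
        \<open>n\<close> only.\<close>
      moreover obtain K where "nf_coef l m n 6 0 = K * (red_S l m n 6 3 * red_S l m n 3 0)" for l m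
      proof
        show "nf_coef l m n 6 0 = - 2/3 / (2 * n * (2 * n + 1) * (2 * n + 4) * (2 * n + 5)) * (red_S l m n 6 3 * red_S l m n 3 0)" for l m
          by (simp add: nf_coef_def Let_def)
      qed
      ultimately show ?thesis by (metis ij(1,2) mult.left_commute)
    next
      case False
      then have "i - j \<in> {3, 4, 5}" using e by auto
      from nf_coef_scale[OF non e(2) this] c(2)[OF e(1,2) this] show ?thesis by (metis mult.left_commute)
    qed
    with c(1) have "intertwines r (nf_odd (nf_coef lam mu n) n) (nf_odd (nf_coef lam' mu' n) n) (\<lambda>T j. sp_smult (c j) (T j))"
      by (rule nf_gauge_sufficient)
    then show ?thesis by blast
  qed
  then show ?thesis
    unfolding intertwines_sq_iff_nf[OF non] using nf_gauge_necessary[OF non] scale by blast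
qed

section \<open>Weights on a graph\<close>

definition boundary :: "('v \<times> 'v) set \<Rightarrow> ('v \<times> 'v \<Rightarrow> int) \<Rightarrow> 'v \<Rightarrow> int" where
  "boundary E z v = (\<Sum>e\<in>E. z e * (of_bool (fst e = v) - of_bool (snd e = v)))"

text \<open>The multiplicative form of the fact that a cochain trivial on all integral cycles is a
  coboundary. The edge set is arbitrary because the set of edges with non-zero weight varies with
  the parameters.\<close>

lemma potential_exists:
  fixes t :: "'v \<times> 'v \<Rightarrow> complex"
  assumes "finite E" "\<And>e. e \<in> E \<Longrightarrow> t e \<noteq> 0"
    and "\<And>z. (\<And>v. boundary E z v = 0) \<Longrightarrow> (\<Prod>e\<in>E. t e powi z e) = 1"
  shows "\<exists>c. (\<forall>v. c v \<noteq> 0) \<and> (\<forall>e\<in>E. c (fst e) = t e * c (snd e))"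
  using assms
proof (induction E)
  case empty
  show ?case by (intro exI[of _ "\<lambda>_. 1"]) simp
next
  case (insert e E)
  obtain a b where e: "e = (a, b)" by (cases e)
  have bd: "boundary (insert e E) z v = z e * (of_bool (a = v) - of_bool (b = v)) + boundary E z v" for z v
    using insert.hyps by (simp add: boundary_def e)
  have upd: "boundary E (z(e := k)) v = boundary E z v" "(\<Prod>f\<in>E. t f powi (z(e := k)) f) = (\<Prod>f\<in>E. t f powi z f)" for z k v
    using insert.hyps unfolding boundary_def by (auto intro!: sum.cong prod.cong)
  \<comment> \<open>A cycle of \<open>E\<close> extends to the larger edge set with multiplicity 0
    on the new edge.\<close>
  have "(\<Prod>f\<in>E. t f powi z f) = 1" if "\<And>v. boundary E z v = 0" for z
    using insert.prems(2)[of "z(e := 0)"] insert.hyps that by (simp add: bd upd fun_upd_same del: fun_upd_apply)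
  then have "\<exists>c. (\<forall>v. c v \<noteq> 0) \<and> (\<forall>f\<in>E. c (fst f) = t f * c (snd f))"
    by (intro insert.IH insert.prems(1)) blast+
  then obtain c where c: "\<And>v. c v \<noteq> 0" "\<And>f. f \<in> E \<Longrightarrow> c (fst f) = t f * c (snd f)"
    by blast
  \<comment> \<open>\<open>Q v\<close> holds for \<open>v\<close> in the component of \<open>a\<close>. If it contains \<open>b\<close>, the new edge closes a cycle; otherwise \<open>c\<close> can be rescaled there.\<close>
  define Q where "Q v \<longleftrightarrow> (\<exists>z. (\<forall>w. boundary E z w = of_bool (a = w) - of_bool (v = w)) \<and>
      (\<Prod>f\<in>E. t f powi z f) = c a / c v)" for v
  have Qa: "Q a" unfolding Q_def using c(1) by (intro exI[of _ "\<lambda>_. 0"]) (simp add: boundary_def)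
  have Qstep: "Q (snd f) \<longleftrightarrow> Q (fst f)" if f: "f \<in> E" for f
  proof -
    \<comment> \<open>Changing the multiplicity of \<open>f\<close> by 1 or -1 moves the end of the
      chain along \<open>f\<close>, so \<open>Q\<close> is constant on components.\<close>
    have shift: "boundary E (z(f := z f + k)) w = boundary E z w + k * (of_bool (fst f = w) - of_bool (snd f = w))"
      "(\<Prod>h\<in>E. t h powi (z(f := z f + k)) h) = (\<Prod>h\<in>E. t h powi z h) * t f powi k" for z k w
      using f insert.hyps(1) insert.prems(1)
      by (simp_all add: boundary_def sum.remove[of E f] prod.remove[of E f] power_int_add algebra_simps)
    have tf: "t f = c (fst f) / c (snd f)" using c(2)[OF f] c(1) by simp
    show ?thesis
    proof
      assume "Q (snd f)"
      then obtain z where z: "\<And>w. boundary E z w = of_bool (a = w) - of_bool (snd f = w)"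
        "(\<Prod>h\<in>E. t h powi z h) = c a / c (snd f)" unfolding Q_def by blast
      show "Q (fst f)" unfolding Q_def
        using c(1) by (intro exI[of _ "z(f := z f - 1)"])
            (simp add: shift[of z "-1", unfolded add_uminus_conv_diff] z tf power_int_minus del: fun_upd_apply)
    next
      assume "Q (fst f)"
      then obtain z where z: "\<And>w. boundary E z w = of_bool (a = w) - of_bool (fst f = w)"
        "(\<Prod>h\<in>E. t h powi z h) = c a / c (fst f)" unfolding Q_def by blast
      show "Q (snd f)" unfolding Q_def
        using c(1) by (intro exI[of _ "z(f := z f + 1)"]) (simp add: shift[of z 1] z tf del: fun_upd_apply)
    qed
  qed
  show ?case
  proof (cases "Q b")
    case True
    then obtain z where z: "\<And>w. boundary E z w = of_bool (a = w) - of_bool (b = w)"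
      "(\<Prod>f\<in>E. t f powi z f) = c a / c b" unfolding Q_def by blast
    \<comment> \<open>The chain from \<open>a\<close> to \<open>b\<close> is closed by the new edge
      run backwards.\<close>
    have "(\<Prod>f\<in>insert e E. t f powi (z(e := -1)) f) = 1"
      by (rule insert.prems(2)) (simp add: bd upd z del: fun_upd_apply add: fun_upd_same)
    then have "inverse (t e) * (c a / c b) = 1"
      using insert.hyps upd(2)[of z "-1"] by (simp add: z power_int_minus)
    then have "c a = t e * c b" using c(1)[of b] insert.prems(1)[of e] by (simp add: field_simps)
    then show ?thesis using c by (intro exI[of _ c]) (simp add: e)
  next
    case False
    define c' where "c' v = (if Q v then c v * (t e * c b / c a) else c v)" for v
    have "c' v \<noteq> 0" for v using c(1) insert.prems(1)[of e] by (simp add: c'_def)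
    moreover have "c' (fst f) = t f * c' (snd f)" if "f \<in> insert e E" for f
      using that Qa False Qstep[of f] c(1)[of a] c(2)[of f] by (auto simp: c'_def e)
    ultimately show ?thesis by blast
  qed
qed

section \<open>The graph on seven vertices and its cycle lattice\<close>

abbreviation edges :: "(nat \<times> nat) set" where
  "edges \<equiv> {(3, 0), (4, 1), (5, 2), (6, 3), (4, 0), (5, 1), (6, 2), (5, 0), (6, 1)}"

lemma edge_iff: "(i, j) \<in> edges \<longleftrightarrow> i < 7 \<and> i - j \<in> {3, 4, 5}"
proof
  assume *: "i < 7 \<and> i - j \<in> {3, 4, 5}"
  then have "i = 0 \<or> i = 1 \<or> i = 2 \<or> i = 3 \<or> i = 4 \<or> i = 5 \<or> i = 6" "i = j + 3 \<or> i = j + 4 \<or> i = j + 5" by auto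
  then show "(i, j) \<in> edges" using * by (elim disjE) auto
qed auto

text \<open>Seven boundary equations of rank six leave three free values. They are taken at
  \<open>(4, 1)\<close>, \<open>(5, 2)\<close> and \<open>(6, 3)\<close> because each of these edges
  occurs in exactly one of the ratios \<open>I0\<close>, \<open>I1\<close>,
  \<open>J0\<close>.\<close>

lemma edges_cycle:
  assumes "\<And>v. boundary edges z v = 0"
  shows "z (4, 0) = - z (4, 1)" "z (6, 2) = - z (5, 2)" "z (3, 0) = z (6, 3)" "z (5, 0) = z (4, 1) - z (6, 3)"
    "z (5, 1) = z (6, 3) - z (4, 1) - z (5, 2)" "z (6, 1) = z (5, 2) - z (6, 3)"
  using assms[of 0] assms[of 1] assms[of 2] assms[of 3] assms[of 4] assms[of 5] assms[of 6]
  by (simp_all add: boundary_def)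

definition edge_sym :: "complex \<Rightarrow> nat \<times> nat \<Rightarrow> Bsym" where
  "edge_sym n e = (snd e mod 2, n + of_nat (fst e) / 2, n + of_nat (snd e) / 2)"

text \<open>Distinct edges never share a symbol, so the formal cancellation in \<open>Simp\<close>
  is exactly the cancellation of exponents on edges.\<close>

lemma edge_sym_eq_iff [simp]: "edge_sym n e = edge_sym n f \<longleftrightarrow> e = f"
  by (cases e; cases f) (auto simp: edge_sym_def)

lemma Iratio_edges:
  "Iratio n I0 = ({#edge_sym n (5, 0), edge_sym n (4, 1)#}, {#edge_sym n (5, 1), edge_sym n (4, 0)#})"
  "Iratio n I1 = ({#edge_sym n (6, 1), edge_sym n (5, 2)#}, {#edge_sym n (6, 2), edge_sym n (5, 1)#})"
  "Iratio n J0 = ({#edge_sym n (6, 1), edge_sym n (5, 0)#}, {#edge_sym n (6, 3), edge_sym n (5, 1), edge_sym n (3, 0)#})"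
  by (simp_all add: Iratio_def edge_sym_def)

text \<open>\<open>N\<close> lists the factors of the ratio and \<open>M\<close> the inverted ones.
  Only the differences of multiplicities matter, and they give the integral cycle that the ratio
  stands for.\<close>

definition cycle_exp :: "Iname multiset \<Rightarrow> Iname multiset \<Rightarrow> nat \<times> nat \<Rightarrow> int" where
  "cycle_exp N M e = (let a = int (count N I0) - int (count M I0); b = int (count N I1) - int (count M I1);
       c = int (count N J0) - int (count M J0) in
     a * (of_bool (e = (5, 0)) + of_bool (e = (4, 1)) - of_bool (e = (5, 1)) - of_bool (e = (4, 0))) +
     b * (of_bool (e = (6, 1)) + of_bool (e = (5, 2)) - of_bool (e = (6, 2)) - of_bool (e = (5, 1))) +
     c * (of_bool (e = (6, 1)) + of_bool (e = (5, 0)) - of_bool (e = (6, 3)) - of_bool (e = (5, 1)) - of_bool (e = (3, 0))))"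

lemma count_sum_Iname:
  "count (sum_mset (image_mset f N)) s =
     count N I0 * count (f I0) s + count N I1 * count (f I1) s + count N J0 * count (f J0) s"
proof (induction N)
  case (add x N)
  then show ?case by (cases x) simp_all
qed simp

lemma count_ratio_of:
  "int (count (fst (ratio_of n N M)) (edge_sym n e)) - int (count (snd (ratio_of n N M)) (edge_sym n e)) = cycle_exp N M e"
  by (simp add: ratio_of_def count_sum_Iname Iratio_edges cycle_exp_def Let_def algebra_simps of_bool_def)

lemma set_ratio_of:
  "set_mset (fst (ratio_of n N M)) \<union> set_mset (snd (ratio_of n N M)) \<subseteq> edge_sym n ` edges"
proof -
  have "set_mset (fst (Iratio n x)) \<union> set_mset (snd (Iratio n x)) \<subseteq> edge_sym n ` edges" for x
    by (cases x) (auto simp: Iratio_edges)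
  then show ?thesis by (fastforce simp: ratio_of_def)
qed

lemma prod_mset_diff_edges:
  assumes "set_mset A \<subseteq> edge_sym n ` edges"
  shows "prod_mset (image_mset f (A - B)) = (\<Prod>e\<in>edges. (f (edge_sym n e) :: complex) ^ (count A (edge_sym n e) - count B (edge_sym n e)))"
proof -
  have "prod_mset (image_mset f (A - B)) = (\<Prod>s\<in>set_mset (A - B). f s ^ count (A - B) s)"
    by (rule image_prod_mset_multiplicity)
  also have "\<dots> = (\<Prod>s\<in>edge_sym n ` edges. f s ^ count (A - B) s)"
  proof (rule prod.mono_neutral_left)
    show "set_mset (A - B) \<subseteq> edge_sym n ` edges" using assms by (meson in_diffD subset_iff)
    show "\<forall>s\<in>edge_sym n ` edges - set_mset (A - B). f s ^ count (A - B) s = 1"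
      by (metis DiffD2 count_eq_zero_iff power_0)
  qed simp
  also have "\<dots> = (\<Prod>e\<in>edges. f (edge_sym n e) ^ (count A (edge_sym n e) - count B (edge_sym n e)))"
    by (subst prod.reindex) (auto simp: inj_on_def simp del: insert_iff)
  finally show ?thesis .
qed

lemma ratio_value_Simp:
  "ratio_value (Simp (ratio_of n N M)) lam mu =
     (\<Prod>e\<in>edges. Bsym_val (edge_sym n e) lam mu powi cycle_exp N M e)"
proof -
  \<comment> \<open>One of the two truncated differences is 0, so the identity holds for
    \<open>x = 0\<close> too.\<close>
  have *: "x ^ (p - q) / x ^ (q - p) = x powi (int p - int q)" for x :: complex and p q :: nat
  proof (cases "q \<le> p")
    case True
    then have "int p - int q = int (p - q)" by simp
    then show ?thesis using True by (simp only: power_int_of_nat) simp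
  next
    case False
    then have "int p - int q = - int (q - p)" by simp
    then show ?thesis using False by (simp only: power_int_minus power_int_of_nat) (simp add: divide_inverse)
  qed
  have sub: "set_mset (fst (ratio_of n N M)) \<subseteq> edge_sym n ` edges" "set_mset (snd (ratio_of n N M)) \<subseteq> edge_sym n ` edges"
    using set_ratio_of[of n N M] by auto
  show ?thesis
    unfolding ratio_value_def Simp_def fst_conv snd_conv prod_mset_diff_edges[OF sub(1)] prod_mset_diff_edges[OF sub(2)]
    by (simp only: prod_dividef[symmetric] * count_ratio_of)
qed

lemma ratio_factors_Simp:
  "s \<in> ratio_factors (Simp (ratio_of n N M)) \<longleftrightarrow> (\<exists>e\<in>edges. s = edge_sym n e \<and> cycle_exp N M e \<noteq> 0)"
proof -
  have "s \<in> ratio_factors (Simp (ratio_of n N M)) \<longleftrightarrow>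
      count (fst (ratio_of n N M)) s \<noteq> count (snd (ratio_of n N M)) s"
    by (auto simp: ratio_factors_def Simp_def in_diff_count)
  also have "\<dots> \<longleftrightarrow> (\<exists>e\<in>edges. s = edge_sym n e \<and> cycle_exp N M e \<noteq> 0)"
  proof
    assume ne: "count (fst (ratio_of n N M)) s \<noteq> count (snd (ratio_of n N M)) s"
    then have "s \<in># fst (ratio_of n N M) \<or> s \<in># snd (ratio_of n N M)" by (metis count_eq_zero_iff)
    then obtain e where "e \<in> edges" "s = edge_sym n e" using set_ratio_of[of n N M] by blast
    then show "\<exists>e\<in>edges. s = edge_sym n e \<and> cycle_exp N M e \<noteq> 0"
      using ne count_ratio_of[of n N M e] by (intro bexI[of _ e]) auto
  next
    assume "\<exists>e\<in>edges. s = edge_sym n e \<and> cycle_exp N M e \<noteq> 0"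
    then obtain e where "s = edge_sym n e" "cycle_exp N M e \<noteq> 0" by blast
    then show "count (fst (ratio_of n N M)) s \<noteq> count (snd (ratio_of n N M)) s"
      using count_ratio_of[of n N M e] by auto
  qed
  finally show ?thesis .
qed

lemma cycle_exp_surj:
  assumes "\<And>v. boundary edges z v = 0"
  obtains N M where "\<And>e. e \<in> edges \<Longrightarrow> cycle_exp N M e = z e"
proof -
  \<comment> \<open>\<open>rep 1\<close> and \<open>rep (-1)\<close> hold the positive and the
    negative parts of the coefficients. The sign at \<open>J0\<close> is reversed because
    \<open>(6, 3)\<close> stands in its denominator.\<close>
  define rep where "rep s = replicate_mset (nat (s * z (4, 1))) I0 + replicate_mset (nat (s * z (5, 2))) I1
     + replicate_mset (nat (- s * z (6, 3))) J0" for s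
  have nn: "int (nat x) - int (nat (- x)) = x" for x by simp
  have "int (count (rep 1) I0) - int (count (rep (-1)) I0) = z (4, 1)"
    "int (count (rep 1) I1) - int (count (rep (-1)) I1) = z (5, 2)"
    "int (count (rep 1) J0) - int (count (rep (-1)) J0) = - z (6, 3)"
    by (simp_all add: rep_def)
  then have "cycle_exp (rep 1) (rep (-1)) e = z e" if "e \<in> edges" for e
    using that edges_cycle[OF assms] unfolding cycle_exp_def by auto
  then show thesis by (rule that)
qed

text \<open>Telescoping: in each of the three basic cycles the signed contributions at every vertex
  cancel.\<close>

lemma cycle_exp_coboundary:
  assumes "\<And>v. c v \<noteq> (0 :: complex)"
  shows "(\<Prod>e\<in>edges. (c (fst e) / c (snd e)) powi cycle_exp N M e) = 1"
proof -
  define x y w where "x = int (count N I0) - int (count M I0)" and "y = int (count N I1) - int (count M I1)"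
    and "w = int (count N J0) - int (count M J0)"
  have "c v powi k \<noteq> 0" for v k using assms by simp
  then show ?thesis
    using assms unfolding cycle_exp_def
    by (simp add: power_int_add power_int_diff power_int_divide_distrib power_int_minus field_simps
        flip: x_def y_def w_def)
qed


section \<open>The weights \<open>S\<close>, the symbols \<open>B\<close> and the factors between
  them\<close>

lemma gauge_equiv_edges:
  "gauge_equiv r s s' \<longleftrightarrow> (\<exists>c. (\<forall>i. c i \<noteq> 0) \<and>
     (\<forall>e\<in>edges. r \<le> snd e \<longrightarrow> c (fst e) * s (fst e) (snd e) = c (snd e) * s' (fst e) (snd e)))"
proof -
  have "(\<forall>i j. r \<le> j \<longrightarrow> i < 7 \<longrightarrow> i - j \<in> {3, 4, 5} \<longrightarrow> P i j) \<longleftrightarrow> (\<forall>e\<in>edges. r \<le> snd e \<longrightarrow> P (fst e) (snd e))"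
    for P :: "nat \<Rightarrow> nat \<Rightarrow> bool"
    using edge_iff by (metis fst_conv snd_conv surj_pair)
  then show ?thesis unfolding gauge_equiv_def by simp
qed

lemma SVC_iff:
  "SVC n False False 7 lam mu lam' mu' \<longleftrightarrow>
    (\<forall>e\<in>edges. S_fun False n (fst e) (snd e) lam mu = 0 \<longleftrightarrow> S_fun False n (fst e) (snd e) lam' mu' = 0)"
proof -
  have "(I < 7 \<and> 3 \<le> int I - int J \<and> int I - int J \<le> 5) \<longleftrightarrow> (I, J) \<in> edges" for I J
    unfolding edge_iff by auto
  then show ?thesis unfolding SVC_def by (metis fst_conv snd_conv surj_pair)
qed

lemma sqrt3_powers: "complex_of_real (sqrt 3) ^ 2 = 3" "complex_of_real (sqrt 3) ^ 3 = 3 * complex_of_real (sqrt 3)"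
proof -
  show "complex_of_real (sqrt 3) ^ 2 = 3" by (simp flip: of_real_power)
  then show "complex_of_real (sqrt 3) ^ 3 = 3 * complex_of_real (sqrt 3)" by (simp add: power3_eq_cube power2_eq_square)
qed

lemma S_fun_red_S:
  assumes "i - j \<in> {3, 4, 5}"
  obtains \<rho> where "\<rho> \<noteq> 0" "\<And>lam mu. S_fun False n i j lam mu = \<rho> * red_S lam mu n i j"
proof -
  have "i = j + 3 \<or> i = j + 4 \<or> i = j + 5" using assms by auto
  then have r: "n + of_nat i / 2 - (n + of_nat j / 2) = of_nat (i - j) / 2" by (auto simp: field_simps)
  \<comment> \<open>The irrational factor appears exactly where \<open>B\<close> has odd powers of
    \<open>\<gamma>^{1/2}\<close>: in \<open>B^0\<close> at distance 3 and in \<open>B^1\<close> at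
    distance 5.\<close>
  define \<rho> where "\<rho> = (if even j \<and> i - j = 3 \<or> odd j \<and> i - j = 5 then complex_of_real (sqrt 3) else 1)"
  have "Bval (j mod 2) (n + of_nat i / 2) (n + of_nat j / 2) lam mu = \<rho> * red_B (j mod 2) (i - j) (n + of_nat j / 2) lam mu" for lam mu
    unfolding Bval_def Let_def r red_B_def \<rho>_def gam_half_def power_mult_distrib sqrt3_powers
    using assms by (auto simp: algebra_simps)
  moreover have "\<rho> \<noteq> 0" by (simp add: \<rho>_def)
  ultimately show thesis
    by (intro that[of \<rho>]) (auto simp: S_fun_def red_S_def Let_def)
qed

lemma SQ_equiv_iff_gauge:
  assumes "nonresonant n"
  shows "SQ_equiv lam mu (mu - lam - n) False lam' mu' (mu' - lam' - n) False 7 \<longleftrightarrow>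
      gauge_equiv 0 (\<lambda>i j. S_fun False n i j lam mu) (\<lambda>i j. S_fun False n i j lam' mu')"
    and "SQ_equiv lam mu (mu - lam - n - 1/2) True lam' mu' (mu' - lam' - n - 1/2) True 6 \<longleftrightarrow>
      gauge_equiv 1 (\<lambda>i j. S_fun False n i j lam mu) (\<lambda>i j. S_fun False n i j lam' mu')"
proof -
  have "gauge_equiv r (\<lambda>i j. S_fun False n i j lam mu) (\<lambda>i j. S_fun False n i j lam' mu') \<longleftrightarrow>
      gauge_equiv r (red_S lam mu n) (red_S lam' mu' n)" for r
    by (rule gauge_equiv_rescale) (metis S_fun_red_S)
  then show "SQ_equiv lam mu (mu - lam - n) False lam' mu' (mu' - lam' - n) False 7 \<longleftrightarrow>
      gauge_equiv 0 (\<lambda>i j. S_fun False n i j lam mu) (\<lambda>i j. S_fun False n i j lam' mu')"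
    "SQ_equiv lam mu (mu - lam - n - 1/2) True lam' mu' (mu' - lam' - n - 1/2) True 6 \<longleftrightarrow>
      gauge_equiv 1 (\<lambda>i j. S_fun False n i j lam mu) (\<lambda>i j. S_fun False n i j lam' mu')"
    unfolding SQ_equiv_even_iff SQ_equiv_odd_iff intertwines_sq_iff_gauge[OF assms] by simp_all
qed

text \<open>Vanishing factors are replaced by 1, so that the potential is never zero.\<close>

definition ffall_potential :: "complex \<Rightarrow> nat \<Rightarrow> complex" where
  "ffall_potential k i = (\<Prod>t<(i + 1) div 2. if k = of_nat t then 1 else k - of_nat t)"

lemma ffall_potential_nonzero: "ffall_potential k i \<noteq> 0"
  by (simp add: ffall_potential_def)

lemma ffall_prod: "p \<le> q \<Longrightarrow> ffall (k - of_nat p) (q - p) = (\<Prod>t\<in>{p..<q}. k - of_nat t)"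
  unfolding ffall_def
  by (rule prod.reindex_bij_witness[of _ "\<lambda>t. t - p" "\<lambda>i. i + p"]) (auto simp: algebra_simps of_nat_diff)

text \<open>As a product over the levels \<open>t\<close> between the two ends, the falling
  factorial shows which values of \<open>\<delta> - n\<close> kill which edges.\<close>

lemma S_fun_ffall:
  assumes "j \<le> i"
  shows "S_fun False n i j lam mu =
    (\<Prod>t\<in>{(j + 1) div 2..<(i + 1) div 2}. mu - lam - n - of_nat t) * Bsym_val (edge_sym n (i, j)) lam mu"
  using ffall_prod[of "(j + 1) div 2" "(i + 1) div 2" "mu - lam - n"] assms
  by (simp add: S_fun_def Bsym_val_def edge_sym_def Let_def div_le_mono)

text \<open>The falling factorial of an edge is the quotient of the potentials at its ends, provided
  that none of its factors vanishes.\<close>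

lemma S_fun_potential:
  assumes "j \<le> i" "\<And>t. (j + 1) div 2 \<le> t \<Longrightarrow> t < (i + 1) div 2 \<Longrightarrow> mu - lam - n \<noteq> of_nat t"
  shows "S_fun False n i j lam mu * ffall_potential (mu - lam - n) j
    = Bsym_val (edge_sym n (i, j)) lam mu * ffall_potential (mu - lam - n) i"
proof -
  let ?h = "\<lambda>t. if mu - lam - n = of_nat t then 1 else mu - lam - n - of_nat t"
  have "ffall_potential (mu - lam - n) i = ffall_potential (mu - lam - n) j * (\<Prod>t\<in>{(j + 1) div 2..<(i + 1) div 2}. ?h t)"
    unfolding ffall_potential_def using assms(1)
    by (subst prod.union_disjoint[symmetric]) (auto intro!: prod.cong simp: div_le_mono)
  also have "(\<Prod>t\<in>{(j + 1) div 2..<(i + 1) div 2}. ?h t) = (\<Prod>t\<in>{(j + 1) div 2..<(i + 1) div 2}. mu - lam - n - of_nat t)"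
    using assms(2) by (intro prod.cong) auto
  finally show ?thesis by (simp add: S_fun_ffall[OF assms(1)])
qed

lemma S_fun_eq_0_iff:
  assumes "j \<le> i"
  shows "S_fun False n i j lam mu = 0 \<longleftrightarrow> (\<exists>t. (j + 1) div 2 \<le> t \<and> t < (i + 1) div 2 \<and> mu - lam - n = of_nat t)
    \<or> Bsym_val (edge_sym n (i, j)) lam mu = 0"
  by (auto simp: S_fun_ffall[OF assms] Bex_def)

text \<open>On the edges that carry a non-zero weight the falling factorials form a coboundary, so they drop out
  of every cycle and only the ratios of the \<open>B\<close> symbols remain.\<close>

lemma gauge_of_active_cycles:
  assumes svc: "SVC n False False 7 lam mu lam' mu'"
    and cyc: "\<And>z. (\<And>v. boundary edges z v = 0) \<Longrightarrow>
      (\<And>e. e \<in> edges \<Longrightarrow> z e \<noteq> 0 \<Longrightarrow> S_fun False n (fst e) (snd e) lam mu \<noteq> 0 \<and> S_fun False n (fst e) (snd e) lam' mu' \<noteq> 0) \<Longrightarrow>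
      (\<Prod>e\<in>edges. Bsym_val (edge_sym n e) lam' mu' powi z e) = (\<Prod>e\<in>edges. Bsym_val (edge_sym n e) lam mu powi z e)"
  shows "gauge_equiv 0 (\<lambda>i j. S_fun False n i j lam mu) (\<lambda>i j. S_fun False n i j lam' mu')"
proof -
  let ?S = "\<lambda>e. S_fun False n (fst e) (snd e) lam mu" and ?S' = "\<lambda>e. S_fun False n (fst e) (snd e) lam' mu'"
  let ?B = "\<lambda>e. Bsym_val (edge_sym n e) lam mu" and ?B' = "\<lambda>e. Bsym_val (edge_sym n e) lam' mu'"
  let ?h = "ffall_potential (mu - lam - n)" and ?h' = "ffall_potential (mu' - lam' - n)"
  define E where "E = {e \<in> edges. ?S e \<noteq> 0}"
  have le: "snd e \<le> fst e" if "e \<in> edges" for e using that by auto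
  have S': "?S' e \<noteq> 0 \<longleftrightarrow> ?S e \<noteq> 0" if "e \<in> edges" for e using svc that unfolding SVC_iff by blast
  have act: "?B e \<noteq> 0" "?B' e \<noteq> 0" "?S e * ?h (snd e) = ?B e * ?h (fst e)" "?S' e * ?h' (snd e) = ?B' e * ?h' (fst e)"
    if e: "e \<in> E" for e
  proof -
    have "e \<in> edges" "?S e \<noteq> 0" "?S' e \<noteq> 0" using e S' by (auto simp: E_def simp del: insert_iff)
    then show "?B e \<noteq> 0" "?B' e \<noteq> 0" "?S e * ?h (snd e) = ?B e * ?h (fst e)" "?S' e * ?h' (snd e) = ?B' e * ?h' (fst e)"
      using S_fun_eq_0_iff[OF le] S_fun_potential[OF le] by (metis prod.collapse)+
  qed
  have "\<exists>c. (\<forall>v. c v \<noteq> 0) \<and> (\<forall>e\<in>E. c (fst e) = (?B' e / ?B e) * c (snd e))"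
  proof (rule potential_exists)
    show "finite E" by (simp add: E_def)
    show "?B' e / ?B e \<noteq> 0" if "e \<in> E" for e using act[OF that] by simp
    fix z assume z: "\<And>v. boundary E z v = 0"
    \<comment> \<open>Extended by 0, a cycle of the active edges is a cycle of the whole
      graph.\<close>
    define y where "y e = (if e \<in> E then z e else 0)" for e
    have "boundary edges y v = boundary E z v" for v
      unfolding boundary_def by (rule sum.mono_neutral_cong_right) (auto simp: E_def y_def)
    then have bd: "boundary edges y v = 0" for v using z by metis
    have "(\<Prod>e\<in>edges. ?B' e powi y e) = (\<Prod>e\<in>edges. ?B e powi y e)"
    proof (rule cyc[OF bd])
      fix e assume "e \<in> edges" "y e \<noteq> 0"
      then show "?S e \<noteq> 0 \<and> ?S' e \<noteq> 0" using S'[of e] by (simp add: y_def E_def del: insert_iff split: if_splits)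
    qed
    moreover have "(\<Prod>e\<in>edges. b e powi y e) = (\<Prod>e\<in>E. b e powi z e)" for b :: "nat \<times> nat \<Rightarrow> complex"
      by (rule prod.mono_neutral_cong_right) (auto simp: E_def y_def)
    ultimately have "(\<Prod>e\<in>E. ?B' e powi z e) = (\<Prod>e\<in>E. ?B e powi z e)" by (simp only:)
    moreover have "(\<Prod>e\<in>E. ?B e powi z e) \<noteq> 0" using act(1) by (simp add: E_def)
    ultimately show "(\<Prod>e\<in>E. (?B' e / ?B e) powi z e) = 1"
      by (simp add: power_int_divide_distrib prod_dividef)
  qed
  then obtain c where c: "\<And>v. c v \<noteq> 0" "\<And>e. e \<in> E \<Longrightarrow> c (fst e) = (?B' e / ?B e) * c (snd e)" by blast
  \<comment> \<open>The scalars \<open>c\<close> match the symbols \<open>B\<close>; the quotient of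
    the two potentials turns them into scalars that match \<open>S\<close>.\<close>
  define d where "d v = c v * ?h' v / ?h v" for v
  have "d v \<noteq> 0" for v using c(1) by (simp add: d_def ffall_potential_nonzero)
  moreover have "d (fst e) * ?S e = d (snd e) * ?S' e" if e: "e \<in> edges" for e
  proof (cases "e \<in> E")
    case True
    have "?S e = ?B e * ?h (fst e) / ?h (snd e)" "?S' e = ?B' e * ?h' (fst e) / ?h' (snd e)"
      using act(3,4)[OF True] by (simp_all add: ffall_potential_nonzero eq_divide_eq)
    then show ?thesis
      using act(1,2)[OF True] c(1) ffall_potential_nonzero by (simp add: d_def c(2)[OF True] field_simps)
  next
    case False
    then have "?S e = 0" "?S' e = 0" using S' e by (auto simp: E_def simp del: insert_iff)
    then show ?thesis by simp
  qed
  ultimately show ?thesis unfolding gauge_equiv_edges by blast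
qed

lemma nonresonantI:
  assumes "n \<notin> {0, -1/2, -1, -3/2, -2, -5/2}"
  shows "nonresonant n"
  unfolding nonresonant_def
proof (intro allI impI notI)
  fix r :: nat assume r: "r < 6" "2 * n + of_nat r = 0"
  then have "n = - of_nat r / 2" by (simp add: add_eq_0_iff2 field_simps)
  moreover have "r = 0 \<or> r = 1 \<or> r = 2 \<or> r = 3 \<or> r = 4 \<or> r = 5" using r(1) by linarith
  ultimately show False using assms by auto
qed

theorem theorem5p2:
  fixes n lam mu lam' mu' :: complex
  assumes "n \<notin> {0, -1/2, -1, -3/2, -2, -5/2}"
  shows "SQ_equiv lam mu (mu - lam - n) False lam' mu' (mu' - lam' - n) False 7
     \<longleftrightarrow> SVC n False False 7 lam mu lam' mu' \<and>
         ((mu - lam - n \<in> {1, 2} \<or> mu' - lam' - n \<in> {1, 2}) \<or>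
          ((mu - lam - n = 0 \<or> mu' - lam' - n = 0) \<and>
             SQ_equiv lam mu (mu - lam - n - 1/2) True lam' mu' (mu' - lam' - n - 1/2) True 6) \<or>
          (\<forall>N M. (\<forall>s\<in>ratio_factors (Simp (ratio_of n N M)). Bsym_val s lam mu \<noteq> 0) \<longrightarrow>
               ratio_value (Simp (ratio_of n N M)) lam mu = ratio_value (Simp (ratio_of n N M)) lam' mu'))"
    (is "?L \<longleftrightarrow> ?svc \<and> (?i \<or> ?ii \<or> ?iii)")
proof -
  let ?S = "\<lambda>i j. S_fun False n i j lam mu" and ?S' = "\<lambda>i j. S_fun False n i j lam' mu'"
  let ?B = "\<lambda>e. Bsym_val (edge_sym n e) lam mu" and ?B' = "\<lambda>e. Bsym_val (edge_sym n e) lam' mu'"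
  let ?k = "mu - lam - n" and ?k' = "mu' - lam' - n"
  note gauge = SQ_equiv_iff_gauge[OF nonresonantI[OF assms], of lam mu lam' mu']
  have le: "snd e \<le> fst e" "(fst e + 1) div 2 \<le> 3" if "e \<in> edges" for e using that by auto
  have vanish: "?S i j = 0 \<or> ?S' i j = 0"
    if "j \<le> i" "(j + 1) div 2 \<le> t" "t < (i + 1) div 2" "?k = of_nat t \<or> ?k' = of_nat t" for i j t
    using that S_fun_eq_0_iff[of j i n lam mu] S_fun_eq_0_iff[of j i n lam' mu'] by blast
  show ?thesis
  proof
    assume L: ?L
    then obtain c where c: "\<And>v. c v \<noteq> 0" "\<And>e. e \<in> edges \<Longrightarrow> c (fst e) * ?S (fst e) (snd e) = c (snd e) * ?S' (fst e) (snd e)"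
      unfolding gauge gauge_equiv_edges by (metis le0)
    have svc: ?svc unfolding SVC_iff using c by (metis mult_eq_0_iff)
    \<comment> \<open>The same scalars solve the equations on the vertices 1 to 6, which is the
      equivalence of the subquotients of length 6.\<close>
    have ?ii if "?k = 0 \<or> ?k' = 0"
      unfolding gauge gauge_equiv_edges using that c by blast
    \<comment> \<open>No factor of a falling factorial vanishes, so \<open>?B'\<close> and
      \<open>?B\<close> differ by a coboundary on all nine edges, including those where they are
      zero.\<close>
    moreover have ?iii if k: "?k \<notin> {0, 1, 2}" "?k' \<notin> {0, 1, 2}"
    proof (intro allI impI)
      fix N M assume ne: "\<forall>s\<in>ratio_factors (Simp (ratio_of n N M)). Bsym_val s lam mu \<noteq> 0"
      let ?h = "ffall_potential ?k" and ?h' = "ffall_potential ?k'"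
      define d where "d v = c v * ?h v / ?h' v" for v
      have d: "d v \<noteq> 0" for v using c(1) by (simp add: d_def ffall_potential_nonzero)
      have small: "?k \<noteq> of_nat t" "?k' \<noteq> of_nat t" if "t < 3" for t
      proof -
        have "t = 0 \<or> t = 1 \<or> t = 2" using that by linarith
        then show "?k \<noteq> of_nat t" "?k' \<noteq> of_nat t" using k by auto
      qed
      have "?B' e = d (fst e) / d (snd e) * ?B e" if e: "e \<in> edges" for e
      proof -
        have "?S (fst e) (snd e) * ?h (snd e) = ?B e * ?h (fst e)"
          using S_fun_potential[OF le(1)[OF e], of mu lam n] le(2)[OF e] small(1) by (metis less_le_trans prod.collapse)
        moreover have "?S' (fst e) (snd e) * ?h' (snd e) = ?B' e * ?h' (fst e)"
          using S_fun_potential[OF le(1)[OF e], of mu' lam' n] le(2)[OF e] small(2) by (metis less_le_trans prod.collapse)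
        ultimately have "?B e = ?S (fst e) (snd e) * ?h (snd e) / ?h (fst e)"
          "?B' e = ?S' (fst e) (snd e) * ?h' (snd e) / ?h' (fst e)"
          by (simp_all add: ffall_potential_nonzero eq_divide_eq)
        moreover have "?S' (fst e) (snd e) = c (fst e) * ?S (fst e) (snd e) / c (snd e)"
          using c(2)[OF e] c(1)[of "snd e"] by (simp add: field_simps)
        ultimately show ?thesis using c(1) ffall_potential_nonzero by (simp add: d_def mult_ac)
      qed
      then have "(\<Prod>e\<in>edges. ?B' e powi cycle_exp N M e)
        = (\<Prod>e\<in>edges. (d (fst e) / d (snd e)) powi cycle_exp N M e * ?B e powi cycle_exp N M e)"
        by (intro prod.cong) (simp_all only: power_int_mult_distrib)
      also have "\<dots> = (\<Prod>e\<in>edges. ?B e powi cycle_exp N M e)"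
        by (simp only: prod.distrib cycle_exp_coboundary[of d, OF d] mult_1_left)
      finally show "ratio_value (Simp (ratio_of n N M)) lam mu = ratio_value (Simp (ratio_of n N M)) lam' mu'"
        unfolding ratio_value_Simp by (simp only:)
    qed
    ultimately show "?svc \<and> (?i \<or> ?ii \<or> ?iii)" using svc by blast
  next
    assume R: "?svc \<and> (?i \<or> ?ii \<or> ?iii)"
    then have svc: ?svc by blast
    from R consider (i) ?i | (ii) ?ii | (iii) ?iii by blast
    then show ?L
    proof cases
      case i
      then have "(?k = 1 \<or> ?k' = 1) \<or> (?k = 2 \<or> ?k' = 2)" by blast
      have trivial: "z e = 0" if z: "\<And>v. boundary edges z v = 0" and e: "e \<in> edges"
        and act: "\<And>e. e \<in> edges \<Longrightarrow> z e \<noteq> 0 \<Longrightarrow> ?S (fst e) (snd e) \<noteq> 0 \<and> ?S' (fst e) (snd e) \<noteq> 0" for z e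
      proof -
        have zz: "z (i, j) = 0" if "(i, j) \<in> edges" "j \<le> i" "(j + 1) div 2 \<le> t" "t < (i + 1) div 2"
          "?k = of_nat t \<or> ?k' = of_nat t" for i j t
          using act[OF that(1)] vanish[OF that(2-)] unfolding fst_conv snd_conv by blast
        from \<open>(?k = 1 \<or> ?k' = 1) \<or> (?k = 2 \<or> ?k' = 2)\<close> show ?thesis
        proof
          assume k: "?k = 1 \<or> ?k' = 1"
          \<comment> \<open>These edges cross level 1, so one of the two weights vanishes on each.
            As \<open>z (3, 0) = z (6, 3)\<close>, all three free values of the cycle are 0.\<close>
          have "z (4, 1) = 0" "z (5, 2) = 0" "z (3, 0) = 0"
            by (rule zz[of _ _ 1]; use k in simp)+
          then show ?thesis using edges_cycle[OF z] e by (auto simp del: One_nat_def)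
        next
          assume k: "?k = 2 \<or> ?k' = 2"
          \<comment> \<open>The edge \<open>(4, 1)\<close> ends below level 2; its value is obtained
            from \<open>(5, 1)\<close> and the two others.\<close>
          have "z (6, 3) = 0" "z (5, 2) = 0" "z (5, 1) = 0"
            by (rule zz[of _ _ 2]; use k in simp)+
          then show ?thesis using edges_cycle[OF z] e by (auto simp del: One_nat_def)
        qed
      qed
      show ?L unfolding gauge
      proof (rule gauge_of_active_cycles[OF svc])
        fix z assume *: "\<And>v. boundary edges z v = 0"
          "\<And>e. e \<in> edges \<Longrightarrow> z e \<noteq> 0 \<Longrightarrow> ?S (fst e) (snd e) \<noteq> 0 \<and> ?S' (fst e) (snd e) \<noteq> 0"
        have "z e = 0" if "e \<in> edges" for e using trivial[OF *(1) that *(2)] .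
        then show "(\<Prod>e\<in>edges. ?B' e powi z e) = (\<Prod>e\<in>edges. ?B e powi z e)"
          by (intro prod.cong refl) (simp only: power_int_0_right)
      qed
    next
      case ii
      then obtain c where c: "\<And>v. c v \<noteq> 0"
        "\<And>e. e \<in> edges \<Longrightarrow> 1 \<le> snd e \<Longrightarrow> c (fst e) * ?S (fst e) (snd e) = c (snd e) * ?S' (fst e) (snd e)"
        unfolding gauge gauge_equiv_edges by blast
      \<comment> \<open>Every edge at vertex 0 has the factor \<open>\<delta> - n\<close>, so its
        weight vanishes for one parameter pair and, by the SVC, for the other.\<close>
      have zero: "?S i 0 = 0 \<and> ?S' i 0 = 0" if "(i, 0) \<in> edges" for i
      proof -
        have "3 \<le> i" using that unfolding edge_iff by auto
        then have "?S i 0 = 0 \<or> ?S' i 0 = 0" by (intro vanish[of _ _ 0]) (use ii in auto)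
        then show ?thesis using svc that unfolding SVC_iff by (metis fst_conv snd_conv)
      qed
      have "c (fst e) * ?S (fst e) (snd e) = c (snd e) * ?S' (fst e) (snd e)" if e: "e \<in> edges" for e
      proof (cases "snd e")
        case 0
        then have "(fst e, 0) \<in> edges" using e by (metis prod.collapse)
        then show ?thesis using zero[of "fst e"] 0 by simp
      next
        case Suc
        then show ?thesis using c(2)[OF e] by simp
      qed
      then show ?L unfolding gauge gauge_equiv_edges using c(1) by blast
    next
      case iii
      show ?L unfolding gauge
      proof (rule gauge_of_active_cycles[OF svc])
        fix z assume *: "\<And>v. boundary edges z v = 0"
          "\<And>e. e \<in> edges \<Longrightarrow> z e \<noteq> 0 \<Longrightarrow> ?S (fst e) (snd e) \<noteq> 0 \<and> ?S' (fst e) (snd e) \<noteq> 0"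
        \<comment> \<open>The cycle comes from a ratio. It is supported on edges with non-zero
          \<open>S\<close>, so no factor of the simplified ratio is zero and (iii) applies.\<close>
        obtain N M where NM: "\<And>e. e \<in> edges \<Longrightarrow> cycle_exp N M e = z e"
          by (rule cycle_exp_surj[of z thesis, OF *(1)]) (rule that, assumption)
        have "Bsym_val s lam mu \<noteq> 0" if "s \<in> ratio_factors (Simp (ratio_of n N M))" for s
        proof -
          from that have "\<exists>e\<in>edges. s = edge_sym n e \<and> cycle_exp N M e \<noteq> 0" unfolding ratio_factors_Simp .
          then obtain e where e: "e \<in> edges" "s = edge_sym n e" "cycle_exp N M e \<noteq> 0"
            by (elim bexE conjE) (rule that)
          then have "?S (fst e) (snd e) \<noteq> 0" using *(2)[OF e(1)] NM[OF e(1)] by metis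
          then show ?thesis using S_fun_eq_0_iff[OF le(1)[OF e(1)], of n lam mu] e(2) by simp
        qed
        then have "ratio_value (Simp (ratio_of n N M)) lam mu = ratio_value (Simp (ratio_of n N M)) lam' mu'"
          using iii by blast
        moreover have "(\<Prod>e\<in>edges. b e powi cycle_exp N M e) = (\<Prod>e\<in>edges. b e powi z e)" for b :: "nat \<times> nat \<Rightarrow> complex"
          by (rule prod.cong[OF refl]) (simp only: NM)
        ultimately show "(\<Prod>e\<in>edges. ?B' e powi z e) = (\<Prod>e\<in>edges. ?B e powi z e)"
          unfolding ratio_value_Simp by (simp only:)
      qed
    qed
  qed
qed

end
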